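(* Let $(M,\mu)$ be a doubling measure metric space. Let $1\leq p_0<q_0\leq\infty$ and $p\in(p_0,q_0)$. Let $\mathscr{D}$ be a dyadic system in $M$ and let $\lambda\geq2$. Let $0<\varepsilon<1$ and let $\mathscr{S}\subseteq\mathscr{D}$ be an $\varepsilon$-sparse collection. Set $$t:=\frac{p}{p_0},\quad s:=\frac{q_0}{p},\quad a:=\frac{p}{t-1},\quad b:=s'p .$$ Let $W$ be a $d\times d$ matrix weight on $M$ such that $[W^{s'}]_{A_{a',b}}<\infty$. Then there exists a constant $C=C(\mu,d,p_0,q_0,p)$ such that for all $f\in L^{p}_{W}(M,\mu)$ and all $g\in L^{p'}_{W'}(M,\mu)$ $$\sum_{P\in\mathscr{S}}\mu(P)\,\big|\langle\!\langle f\rangle\!\rangle_{p_0,\lambda P}\cdot\langle\!\langle g\rangle\!\rangle_{q_0',\lambda P}\big|\leq\frac{C}{\varepsilon}\left([W^{s'}]_{A_{a',b}}\right)^{\alpha}\|f\|_{L^{p}_{W}(M,\mu)}\|g\|_{L^{p'}_{W'}(M,\mu)},$$ where $W':=W^{-1/(p-1)}$ and $$\alpha:=\frac{1}{s'(p-p_0)}+\frac{1}{p'} .$$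
   Context: Conventions. $p'$ denotes the Hölder conjugate of $p$ (with $1'=\infty$, $\infty'=1$). For $v,w\in\mathbb{C}^d$, $v\cdot w=\sum_i v^i\overline{w^i}$; for $A,B\subseteq\mathbb{C}^d$, $A\cdot B:=\{a\cdot b:a\in A,b\in B\}\subseteq\mathbb{C}$, and $|E|:=\sup\{|e|:e\in E\}$ for a set $E$. For a matrix, $|\cdot|$ is the spectral norm. Ambient space. $(M,d,\mu)$ is a locally compact separable metric space with more than one point, with a non-zero Borel measure $\mu$ finite on compact sets, which is doubling: there is $C>0$ with $\mu(B(x,2r))\leq C\mu(B(x,r))$ for all $x\in M$, $r>0$ ($B(x,r)$ open balls). Dyadic system. Fix constants $0<c_0\leq C_0<\infty$, $\delta\in(0,1)$ with $12C_0\delta\leq c_0$. A dyadic system $\mathscr{D}=\bigcup_{k\in\mathbb{Z}}\mathscr{D}_k$ with these parameters consists of countable families $\mathscr{D}_k=\{Q_i^k:i\in\mathcal{A}_k\}$ of open sets ("cubes") such that: (1) if $l\geq k$ then either $Q_i^l\subseteq Q_j^k$ or $Q_i^l\cap Q_j^k=\emptyset$; (2) for each $k$, $M$ is the disjoint union of the $Q_i^k$, $i\in\mathcal{A}_k$, and a $\mu$-null set; (3) there are points $z_i^k\in M$ with $B(z_i^k,\frac{c_0}{3}\delta^k)\subseteq Q_i^k\subseteq B(z_i^k,2C_0\delta^k)$; (4) if $l\geq k$ and $Q_i^l\subseteq Q_j^k$ then $B(z_i^l,2C_0\delta^l)\subseteq B(z_j^k,2C_0\delta^k)$. The points also satisfy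 $d(z_i^k,z_j^k)\geq c_0\delta^k$ for $i\neq j$ and $\min_i d(x,z_i^k)<C_0\delta^k$ for all $x\in M$. For $Q\in\mathscr{D}_k$ put $\ell(Q):=2C_0\delta^k$ and, for $\lambda>1$, $\lambda Q:=\{x\in M:d(x,Q)\leq(\lambda-1)\ell(Q)\}$. Sparse. A collection $\mathscr{S}$ of Borel sets of positive finite measure is $\varepsilon$-sparse if there are pairwise disjoint measurable sets $F_Q\subseteq Q$, $Q\in\mathscr{S}$, with $\mu(F_Q)\geq\varepsilon\mu(Q)$. Convex body averages. For $1\leq r<\infty$, a Borel set $E$ with $0<\mu(E)<\infty$ and $f\in L^r(E,\mu;\mathbb{C}^d)$, $$\langle\!\langle f\rangle\!\rangle_{r,E}:=\left\{\frac1{\mu(E)}\int_E\varphi f\,\mathrm{d}\mu:\ \varphi:E\to\mathbb{C}\text{ measurable},\ \|\varphi\|_{L^{r'}(E,\mu/\mu(E))}\leq1\right\}\subseteq\mathbb{C}^d .$$ Weights. A $d\times d$ matrix weight on $M$ is a measurable $W:M\to M_d(\mathbb{C})$ with $W(x)$ positive definite for $\mu$-a.e. $x$ and $\int_E|W|\,\mathrm{d}\mu<\infty$ for every bounded Borel $E\subseteq M$. $L^p_W(M,\mu)$ is the space of (classes of) measurable $f:M\to\mathbb{C}^d$ with $\|f\|_{L^p_W(M,\mu)}=(\int_M|W(x)^{1/p}f(x)|^p\,\mathrm{d}\mu(x))^{1/p}<\infty$. For $1<\rho\leq\sigma<\infty$ and a measurable, a.e. positive-definite-matrix-valued $V$,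 $$[V]_{A_{\rho,\sigma}}:=\sup_B\frac1{\mu(B)}\int_B\left(\frac1{\mu(B)}\int_B|V(x)^{1/\sigma}V(y)^{-1/\sigma}|^{\rho'}\,\mathrm{d}\mu(y)\right)^{\sigma/\rho'}\mathrm{d}\mu(x),$$ supremum over all open balls $B\subseteq M$. (One has $1<a'\leq b<\infty$.) *)

theory Defs
  imports "HOL-Probability.Probability"
begin

text \<open>The exponent \<open>p'\<close> with \<open>1/p + 1/p' = 1\<close>, for \<open>1 \<le> p \<le> \<infinity>\<close>. In \<^typ>\<open>ereal\<close> one has
  \<open>inverse \<infinity> = 0\<close> and \<open>inverse 0 = \<infinity>\<close>, so \<open>1' = \<infinity>\<close> and \<open>\<infinity>' = 1\<close>.\<close>

definition holder_conj :: "ereal \<Rightarrow> ereal"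
  where "holder_conj p = inverse (1 - inverse p)"

text \<open>For exponents whose conjugate is known to be finite, i.e. \<open>p > 1\<close>.\<close>

definition holder_conj_real :: "ereal \<Rightarrow> real"
  where "holder_conj_real p = real_of_ereal (holder_conj p)"

text \<open>\<open>x\<^sup>r\<close> on \<open>[0,\<infinity>]\<close>, only used with \<open>r > 0\<close>.\<close>

definition ennreal_powr :: "ennreal \<Rightarrow> real \<Rightarrow> ennreal"
  where "ennreal_powr x r = (if x = \<top> then \<top> else ennreal (enn2real x powr r))"

definition Lp_norm :: "ereal \<Rightarrow> 'a measure \<Rightarrow> ('a \<Rightarrow> 'b::real_normed_vector) \<Rightarrow> ennreal"
  where "Lp_norm r N f =
    (if r = \<infinity> then esssup N (\<lambda>x. ennreal (norm (f x)))
     else ennreal_powr (\<integral>\<^sup>+ x. ennreal (norm (f x) powr real_of_ereal r) \<partial>N)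
            (1 / real_of_ereal r))"

definition average :: "'a measure \<Rightarrow> 'a set \<Rightarrow> ('a \<Rightarrow> ennreal) \<Rightarrow> ennreal"
  where "average \<mu> E h = (\<integral>\<^sup>+ x\<in>E. h x \<partial>\<mu>) / emeasure \<mu> E"

definition cdot :: "complex ^ 'n \<Rightarrow> complex ^ 'n \<Rightarrow> complex"
  where "cdot v w = (\<Sum>i\<in>UNIV. v $ i * cnj (w $ i))"

definition cdot_set :: "(complex ^ 'n) set \<Rightarrow> (complex ^ 'n) set \<Rightarrow> complex set"
  where "cdot_set A B = {cdot v w | v w. v \<in> A \<and> w \<in> B}"

definition set_abs :: "complex set \<Rightarrow> ennreal"
  where "set_abs E = (SUP e\<in>E. ennreal (norm e))"

text \<open>The library's \<^const>\<open>norm\<close> on matrices is the Frobenius norm, so the spectral norm is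
  written as the operator norm for the Euclidean norm.\<close>

definition spectral_norm :: "complex ^ 'n ^ 'n \<Rightarrow> real"
  where "spectral_norm A = onorm (\<lambda>v. A *v v)"

definition adjoint_matrix :: "complex ^ 'n ^ 'n \<Rightarrow> complex ^ 'n ^ 'n"
  where "adjoint_matrix A = (\<chi> i j. cnj (A $ j $ i))"

definition pos_def :: "complex ^ 'n ^ 'n \<Rightarrow> bool"
  where "pos_def A \<longleftrightarrow> adjoint_matrix A = A \<and> (\<forall>v. v \<noteq> 0 \<longrightarrow> 0 < Re (cdot (A *v v) v))"

definition unitary_matrix :: "complex ^ 'n ^ 'n \<Rightarrow> bool"
  where "unitary_matrix U \<longleftrightarrow> adjoint_matrix U ** U = mat 1 \<and> U ** adjoint_matrix U = mat 1"

definition diag_matrix :: "('n \<Rightarrow> real) \<Rightarrow> complex ^ 'n ^ 'n"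
  where "diag_matrix l = (\<chi> i j. if i = j then complex_of_real (l i) else 0)"

text \<open>Real powers of a positive definite matrix: if \<open>A = U diag(l) U\<^sup>*\<close> with \<open>U\<close> unitary, then
  \<open>A\<^sup>r = U diag(l\<^sup>r) U\<^sup>*\<close>, which does not depend on the diagonalization. The value is
  irrelevant when \<open>A\<close> is not positive definite.\<close>

definition mat_powr :: "complex ^ 'n ^ 'n \<Rightarrow> real \<Rightarrow> complex ^ 'n ^ 'n"
  where "mat_powr A r = (THE B. \<exists>U l. unitary_matrix U \<and> (\<forall>i. 0 < l i) \<and>
      A = U ** diag_matrix l ** adjoint_matrix U \<and>
      B = U ** diag_matrix (\<lambda>i. l i powr r) ** adjoint_matrix U)"

text \<open>The space \<open>M\<close> is the whole type \<open>'a\<close>. Separability is the type class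
  \<^class>\<open>second_countable_topology\<close>, to which it is equivalent for metric spaces.\<close>

definition doubling_space :: "'a::{metric_space, second_countable_topology} measure \<Rightarrow> bool"
  where "doubling_space \<mu> \<longleftrightarrow>
    locally_compact_space (euclidean :: 'a topology) \<and>
    (\<exists>x y :: 'a. x \<noteq> y) \<and>
    sets \<mu> = sets borel \<and>
    emeasure \<mu> UNIV \<noteq> 0 \<and>
    (\<forall>K. compact K \<longrightarrow> emeasure \<mu> K < \<infinity>) \<and>
    (\<exists>C>0. \<forall>x r. 0 < r \<longrightarrow> emeasure \<mu> (ball x (2 * r)) \<le> ennreal C * emeasure \<mu> (ball x r))"

definition side_length :: "real \<Rightarrow> real \<Rightarrow> int \<Rightarrow> real"
  where "side_length C0 \<delta> k = 2 * C0 * \<delta> powi k"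

text \<open>\<open>D k\<close> is the family of cubes of generation \<open>k\<close>. Cubes of one generation are non-empty and
  pairwise disjoint, so the index \<open>i\<close> of \<open>Q\<^sub>i\<^sup>k\<close> is determined by the set and is dropped; \<open>z k Q\<close> is
  the centre of \<open>Q \<in> D k\<close>.\<close>

definition dyadic_system ::
    "'a::metric_space measure \<Rightarrow> real \<Rightarrow> real \<Rightarrow> real \<Rightarrow> (int \<Rightarrow> 'a set set) \<Rightarrow> bool"
  where "dyadic_system \<mu> c0 C0 \<delta> D \<longleftrightarrow>
    0 < c0 \<and> c0 \<le> C0 \<and> 0 < \<delta> \<and> \<delta> < 1 \<and> 12 * C0 * \<delta> \<le> c0 \<and>
    (\<forall>k. countable (D k) \<and> (\<forall>Q\<in>D k. open Q)) \<and>
    (\<forall>k l. k \<le> l \<longrightarrow> (\<forall>Q\<in>D l. \<forall>R\<in>D k. Q \<subseteq> R \<or> Q \<inter> R = {})) \<and>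
    (\<forall>k. disjoint (D k) \<and> - \<Union>(D k) \<in> null_sets \<mu>) \<and>
    (\<exists>z :: int \<Rightarrow> 'a set \<Rightarrow> 'a.
      (\<forall>k. \<forall>Q\<in>D k. ball (z k Q) (c0 / 3 * \<delta> powi k) \<subseteq> Q \<and>
                     Q \<subseteq> ball (z k Q) (2 * C0 * \<delta> powi k)) \<and>
      (\<forall>k l. k \<le> l \<longrightarrow> (\<forall>Q\<in>D l. \<forall>R\<in>D k. Q \<subseteq> R \<longrightarrow>
         ball (z l Q) (2 * C0 * \<delta> powi l) \<subseteq> ball (z k R) (2 * C0 * \<delta> powi k))) \<and>
      (\<forall>k. \<forall>Q\<in>D k. \<forall>R\<in>D k. Q \<noteq> R \<longrightarrow> c0 * \<delta> powi k \<le> dist (z k Q) (z k R)) \<and>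
      (\<forall>k x. \<exists>Q\<in>D k. dist x (z k Q) < C0 * \<delta> powi k))"

text \<open>One and the same set can be a cube of several generations (e.g. at an isolated point), while
  its side length depends on the generation. A cube is therefore a pair of a generation and a
  set.\<close>

definition dyadic_cubes :: "(int \<Rightarrow> 'a set set) \<Rightarrow> (int \<times> 'a set) set"
  where "dyadic_cubes D = {(k, Q). Q \<in> D k}"

definition dilate :: "real \<Rightarrow> real \<Rightarrow> real \<Rightarrow> int \<times> 'a::metric_space set \<Rightarrow> 'a set"
  where "dilate C0 \<delta> lam P = {x. infdist x (snd P) \<le> (lam - 1) * side_length C0 \<delta> (fst P)}"

text \<open>Sparseness of the collection of sets \<open>E P\<close> with labels \<open>P \<in> S\<close>.\<close>

definition sparse_family :: "'a measure \<Rightarrow> real \<Rightarrow> 'i set \<Rightarrow> ('i \<Rightarrow> 'a set) \<Rightarrow> bool"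
  where "sparse_family \<mu> \<epsilon> S E \<longleftrightarrow>
    (\<forall>P\<in>S. E P \<in> sets \<mu> \<and> 0 < emeasure \<mu> (E P) \<and> emeasure \<mu> (E P) < \<infinity>) \<and>
    (\<exists>F. disjoint_family_on F S \<and>
      (\<forall>P\<in>S. F P \<in> sets \<mu> \<and> F P \<subseteq> E P \<and> ennreal \<epsilon> * emeasure \<mu> (E P) \<le> emeasure \<mu> (F P)))"

text \<open>Measurable functions on \<open>E\<close> are represented by measurable functions on the whole space; only
  their values on \<open>E\<close> matter. The normalized measure on \<open>E\<close> is \<^term>\<open>uniform_measure \<mu> E\<close>.\<close>

definition convex_body_average ::
    "'a measure \<Rightarrow> real \<Rightarrow> 'a set \<Rightarrow> ('a \<Rightarrow> complex ^ 'n) \<Rightarrow> (complex ^ 'n) set"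
  where "convex_body_average \<mu> r E f =
    {(1 / measure \<mu> E) *\<^sub>R (LINT x:E|\<mu>. \<phi> x *s f x) | \<phi> :: 'a \<Rightarrow> complex.
       \<phi> \<in> borel_measurable \<mu> \<and> Lp_norm (holder_conj (ereal r)) (uniform_measure \<mu> E) \<phi> \<le> 1}"

definition matrix_weight :: "'a::metric_space measure \<Rightarrow> ('a \<Rightarrow> complex ^ 'n ^ 'n) \<Rightarrow> bool"
  where "matrix_weight \<mu> W \<longleftrightarrow>
    W \<in> borel_measurable \<mu> \<and>
    (AE x in \<mu>. pos_def (W x)) \<and>
    (\<forall>E\<in>sets borel. bounded E \<longrightarrow> (\<integral>\<^sup>+ x\<in>E. ennreal (spectral_norm (W x)) \<partial>\<mu>) < \<infinity>)"

definition weighted_norm ::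
    "'a measure \<Rightarrow> real \<Rightarrow> ('a \<Rightarrow> complex ^ 'n ^ 'n) \<Rightarrow> ('a \<Rightarrow> complex ^ 'n) \<Rightarrow> ennreal"
  where "weighted_norm \<mu> p W f = Lp_norm (ereal p) \<mu> (\<lambda>x. mat_powr (W x) (1 / p) *v f x)"

definition weighted_space ::
    "'a measure \<Rightarrow> real \<Rightarrow> ('a \<Rightarrow> complex ^ 'n ^ 'n) \<Rightarrow> ('a \<Rightarrow> complex ^ 'n) set"
  where "weighted_space \<mu> p W = {f \<in> borel_measurable \<mu>. weighted_norm \<mu> p W f < \<infinity>}"

definition A_const ::
    "'a::metric_space measure \<Rightarrow> real \<Rightarrow> real \<Rightarrow> ('a \<Rightarrow> complex ^ 'n ^ 'n) \<Rightarrow> ennreal"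
  where "A_const \<mu> \<rho> \<sigma> V =
    (SUP B\<in>{ball x r | x r. 0 < r}.
       average \<mu> B (\<lambda>x. ennreal_powr
         (average \<mu> B (\<lambda>y. ennreal
            (spectral_norm (mat_powr (V x) (1 / \<sigma>) ** mat_powr (V y) (- 1 / \<sigma>))
               powr holder_conj_real (ereal \<rho>))))
         (\<sigma> / holder_conj_real (ereal \<rho>))))"

end

theory Submission
  imports Defs
begin

text \<open>
  Put \<open>P = W^(1/p)\<close> and \<open>M = W^(-1/p)\<close>, and let \<open>K\<close> be the weight constant. Since \<open>b = s' p\<close>,
  finiteness of \<open>K\<close> says that for every ball \<open>B\<close> the average over \<open>x \<in> B\<close> of
  \<open>(avg\<^bsub>y \<in> B\<^esub> |P(x) M(y)|^a)^(b/a)\<close> is at most \<open>K\<close>; the two weighted norms are \<open>\<parallel>P f\<parallel>\<^sub>p\<close> and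
  \<open>\<parallel>M g\<parallel>\<^sub>p\<^sub>'\<close>; and the exponents satisfy \<open>1/p\<^sub>0 = 1/a + 1/p\<close> and \<open>1/q\<^sub>0' = 1/b + 1/p'\<close>.

  \<^bold>\<open>Reduction to scalars.\<close> On \<open>\<complex>^d\<close> consider \<open>N(v) = (avg\<^sub>B |M v|^a)^(1/a)\<close>. An almost Auerbach basis
  \<open>\<xi>\<^sub>i\<close> for \<open>N\<close>, with dual basis \<open>e\<^sub>i\<close>, satisfies \<open>avg\<^sub>B |M \<xi>\<^sub>i|^a \<le> 1\<close> and \<open>avg\<^sub>B |P e\<^sub>i|^b \<le> 2^b K\<close>
  (\<open>dual_vectors\<close>); this pair of bases replaces the reducing matrices of the ball. As
  \<open>v \<sqdot> w = \<Sum>\<^sub>i (v \<sqdot> \<xi>\<^sub>i) (e\<^sub>i \<sqdot> w)\<close>, the product of the two convex bodies is controlled by \<open>d\<close> products of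
  the scalar averages \<open>(avg (|M \<xi>\<^sub>i| |P f|)^p\<^sub>0)^(1/p\<^sub>0)\<close> and \<open>(avg (|P e\<^sub>i| |M g|)^q\<^sub>0')^(1/q\<^sub>0')\<close>.
  Normalizing \<open>e\<^sub>i\<close> so that \<open>avg\<^sub>B |P e\<^sub>i|^b \<le> 1\<close> costs a factor \<open>K^(1/b)\<close>.

  \<^bold>\<open>Scalar weights.\<close> For each fixed vector, \<open>|P e|^b\<close> satisfies an \<open>A\<^bsub>1+b/a\<^esub>\<close> condition with constant
  \<open>K\<close> and \<open>|M \<xi>|^a\<close> an \<open>A\<^bsub>1+a/b\<^esub>\<close> condition with constant \<open>K^(a/b)\<close> (\<open>muckenhoupt_left\<close>,
  \<open>muckenhoupt_right\<close>). A weight with constant \<open>L\<close> has a weak reverse Hoelder inequality with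
  exponent \<open>1 + c/L\<close> (\<open>reverse_holder\<close>, \<open>reverse_holder_exponent\<close>). By Hoelder's inequality the
  average of \<open>(|M \<xi>\<^sub>i| H)^p\<^sub>0\<close>, raised to the power \<open>p/p\<^sub>0\<close>, is then at most a constant times
  \<open>(avg H^(p/Q))^Q\<close> with \<open>Q - 1\<close> of size \<open>1/L\<close>. The maximal inequality on \<open>L^Q\<close> has a constant of size
  \<open>1/(Q - 1)\<close>, that is, of size \<open>L\<close>, so the sum over the disjoint sparse parts is at most
  \<open>C L \<integral> H^p\<close> (\<open>weighted_maximal_estimate\<close>). With \<open>L = K^(a/b)\<close> for \<open>f\<close> and \<open>L = K\<close> for \<open>g\<close>, and
  Hoelder's inequality for the sum over the cubes, the total power of \<open>K\<close> is
  \<open>1/b + a/(bp) + 1/p' = \<alpha>\<close> (\<open>sparse_form_bound\<close>).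

  \<^bold>\<open>The reverse Hoelder inequality\<close> is proved by a stopping-time argument on a finite tree of nested
  cells (\<open>tree_reverse_holder\<close>). If only finitely many scales are required, nested partitions of a
  ball are obtained from separated nets by sending every point of a net to a nearest point of the
  next coarser one. Letting the finest scale tend to zero requires a convergence argument for
  partitions that are not nested from one step to the next (\<open>cell_average_fatou\<close>).
\<close>

section \<open>Powers on the extended half-line and Hoelder's inequality\<close>

text \<open>All estimates are stated in \<open>[0,\<infinity>]\<close>, where the conventions \<open>0 \<cdot> \<infinity> = 0\<close>, \<open>0^r = 0\<close> and
  \<open>\<infinity>^r = \<infinity>\<close> make the rules for products and iterated powers hold without side conditions.\<close>

abbreviation epowr :: "ennreal \<Rightarrow> real \<Rightarrow> ennreal" (infixr "powe" 80)
  where "x powe r \<equiv> ennreal_powr x r"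

lemma ennreal_powr_ennreal: "0 \<le> x \<Longrightarrow> ennreal x powe r = ennreal (x powr r)"
  by (simp add: ennreal_powr_def)

lemma top_powe [simp]: "\<top> powe r = \<top>"
  by (simp add: ennreal_powr_def)

lemma zero_powe [simp]: "0 powe r = 0"
  by (simp add: ennreal_powr_def)

lemma one_powe [simp]: "1 powe r = 1"
  by (simp add: ennreal_powr_def)

lemma powe_one [simp]: "x powe 1 = x"
  by (cases x) (auto simp: ennreal_powr_ennreal)

lemma powe_eq_top_iff [simp]: "x powe r = \<top> \<longleftrightarrow> x = \<top>"
  by (cases x) (auto simp: ennreal_powr_ennreal)

lemma powe_less_top_iff [simp]: "x powe r < \<top> \<longleftrightarrow> x < \<top>"
  by (simp flip: less_top)

lemma powe_eq_0_iff [simp]: "x powe r = 0 \<longleftrightarrow> x = 0"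
  by (cases x) (auto simp: ennreal_powr_ennreal)

lemma powe_mono: "x \<le> y \<Longrightarrow> 0 \<le> r \<Longrightarrow> x powe r \<le> y powe r"
  by (cases x; cases y) (auto simp: ennreal_powr_ennreal powr_mono2 top_unique)

lemma powe_mult: "(x * y) powe r = x powe r * y powe r"
  by (cases x; cases y)
    (auto simp: ennreal_powr_ennreal powr_mult ennreal_mult_eq_top_iff ennreal_mult_top ennreal_top_mult
      simp flip: ennreal_mult)

lemma powe_powe: "(x powe r) powe s = x powe (r * s)"
  by (cases x) (auto simp: ennreal_powr_ennreal powr_powr)

lemma powe_add: "x powe (r + s) = x powe r * x powe s"
  by (cases x) (auto simp: ennreal_powr_ennreal powr_add simp flip: ennreal_mult)

lemma powe_le_iff: "0 < r \<Longrightarrow> x powe r \<le> y powe r \<longleftrightarrow> x \<le> y"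
  using powe_mono[of x y r] powe_mono[of "x powe r" "y powe r" "1/r"]
  by (auto simp: powe_powe)

lemma powe_inverse: "0 < x \<Longrightarrow> x < \<top> \<Longrightarrow> (inverse x) powe r = inverse (x powe r)"
  by (cases x) (auto simp: ennreal_powr_ennreal powr_divide inverse_ennreal inverse_eq_divide powr_gt_zero)

lemma powe_divide: "0 < y \<Longrightarrow> y < \<top> \<Longrightarrow> (x / y) powe r = x powe r / y powe r"
  by (simp add: divide_ennreal_def powe_mult powe_inverse)

lemma measurable_powe [measurable]:
  "f \<in> borel_measurable M \<Longrightarrow> (\<lambda>x. f x powe r) \<in> borel_measurable M"
  unfolding ennreal_powr_def
  by (rule measurable_If) (auto intro!: measurable_compose[OF _ measurable_ennreal] powr_real_measurable)

lemma powe_young: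
  assumes "0 < s" "0 < t" "s + t = 1"
  shows "x powe s * y powe t \<le> ennreal s * x + ennreal t * y"
proof (cases "x = 0 \<or> y = 0 \<or> x = \<top> \<or> y = \<top>")
  case True
  then show ?thesis using assms by (auto simp: ennreal_mult_top)
next
  case False
  then obtain a b where ab: "x = ennreal a" "y = ennreal b" "0 < a" "0 < b"
    by (cases x; cases y) auto
  have "a powr s * b powr t \<le> s * a + t * b"
    using assms ab by (intro Youngs_inequality_0) auto
  then show ?thesis
    using assms ab by (simp add: ennreal_powr_ennreal ennreal_leI flip: ennreal_mult ennreal_plus)
qed

text \<open>Hoelder's inequality in the homogeneous form with exponents adding up to 1, for which the
  integrability of neither factor has to be discussed: Young's inequality is applied to the
  normalized functions \<open>f / \<integral> f\<close> and \<open>g / \<integral> g\<close>.\<close>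

lemma holder_nn_integral:
  assumes [measurable]: "f \<in> borel_measurable M" "g \<in> borel_measurable M"
    and st: "0 < s" "0 < t" "s + t = 1"
  shows "(\<integral>\<^sup>+x. f x powe s * g x powe t \<partial>M) \<le> (\<integral>\<^sup>+x. f x \<partial>M) powe s * (\<integral>\<^sup>+x. g x \<partial>M) powe t"
proof -
  define F where "F = (\<integral>\<^sup>+x. f x \<partial>M)"
  define G where "G = (\<integral>\<^sup>+x. g x \<partial>M)"
  consider "F = 0 \<or> G = 0" | "F \<noteq> 0" "G \<noteq> 0" "F = \<top> \<or> G = \<top>" | "F \<noteq> 0" "G \<noteq> 0" "F < \<top>" "G < \<top>"
    by (metis less_top)
  then show ?thesis
  proof cases
    case 1
    then have "(AE x in M. f x = 0) \<or> (AE x in M. g x = 0)"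
      by (auto simp: F_def G_def nn_integral_0_iff_AE)
    then have "AE x in M. f x powe s * g x powe t = 0"
      by auto
    then have "(\<integral>\<^sup>+x. f x powe s * g x powe t \<partial>M) = 0"
      by (subst nn_integral_0_iff_AE) auto
    then show ?thesis by simp
  next
    case 2
    then have "F powe s * G powe t = \<top>"
      by (auto simp: ennreal_mult_eq_top_iff)
    then show ?thesis by (simp add: F_def G_def)
  next
    case 3
    have eq: "f x powe s * g x powe t = F powe s * G powe t * ((f x / F) powe s * (g x / G) powe t)" for x
    proof -
      have *: "f x = F * (f x / F)" "g x = G * (g x / G)"
        using 3 by (simp_all add: ennreal_times_divide mult.commute[of F] mult.commute[of G] mult_divide_eq_ennreal)
      show ?thesis
        by (subst (1) *(1), subst (1) *(2)) (simp only: powe_mult ac_simps)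
    qed
    have "(\<integral>\<^sup>+x. f x powe s * g x powe t \<partial>M) =
        F powe s * G powe t * (\<integral>\<^sup>+x. (f x / F) powe s * (g x / G) powe t \<partial>M)"
      unfolding eq by (rule nn_integral_cmult) auto
    also have "\<dots> \<le> F powe s * G powe t * (\<integral>\<^sup>+x. ennreal s * (f x / F) + ennreal t * (g x / G) \<partial>M)"
      by (intro mult_left_mono nn_integral_mono powe_young st) auto
    also have "(\<integral>\<^sup>+x. ennreal s * (f x / F) + ennreal t * (g x / G) \<partial>M) = ennreal s * (F / F) + ennreal t * (G / G)"
      by (simp add: nn_integral_add nn_integral_cmult nn_integral_divide F_def G_def)
    also have "\<dots> = 1"
      using 3 st by (simp flip: ennreal_plus)
    finally show ?thesis by (simp add: F_def G_def)
  qed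
qed

section \<open>Doubling measures\<close>

locale doubling_measure =
  fixes \<mu> :: "'a::{metric_space, second_countable_topology} measure" and Cd :: real
  assumes sets_mu [measurable_cong, simp]: "sets \<mu> = sets borel"
    and ball_pos: "0 < r \<Longrightarrow> 0 < emeasure \<mu> (ball x r)"
    and ball_finite: "emeasure \<mu> (ball x r) < \<top>"
    and doubling: "0 < r \<Longrightarrow> emeasure \<mu> (ball x (2 * r)) \<le> ennreal Cd * emeasure \<mu> (ball x r)"
    and Cd_ge_1: "1 \<le> Cd"
begin

lemma space_mu [simp]: "space \<mu> = UNIV"
  using sets_eq_imp_space_eq[OF sets_mu] by simp

lemma doubling_power:
  "0 < r \<Longrightarrow> emeasure \<mu> (ball x (2 ^ n * r)) \<le> ennreal (Cd ^ n) * emeasure \<mu> (ball x r)"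
proof (induction n)
  case (Suc n)
  have "emeasure \<mu> (ball x (2 ^ Suc n * r)) \<le> ennreal Cd * emeasure \<mu> (ball x (2 ^ n * r))"
    using doubling[of "2 ^ n * r" x] Suc by (simp add: mult.assoc)
  also have "\<dots> \<le> ennreal Cd * (ennreal (Cd ^ n) * emeasure \<mu> (ball x r))"
    using Suc by (intro mult_left_mono) auto
  finally show ?case
    using Cd_ge_1 by (simp add: ennreal_mult mult.assoc)
qed auto

lemma ball_compare:
  assumes "0 < s" "dist x y + r \<le> 2 ^ n * s"
  shows "emeasure \<mu> (ball x r) \<le> ennreal (Cd ^ n) * emeasure \<mu> (ball y s)"
proof -
  have "ball x r \<subseteq> ball y (2 ^ n * s)"
  proof
    fix u assume "u \<in> ball x r"
    then show "u \<in> ball y (2 ^ n * s)"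
      using assms(2) dist_triangle[of y u x] by (simp add: dist_commute)
  qed
  then have "emeasure \<mu> (ball x r) \<le> emeasure \<mu> (ball y (2 ^ n * s))"
    by (intro emeasure_mono) auto
  also have "\<dots> \<le> ennreal (Cd ^ n) * emeasure \<mu> (ball y s)"
    by (rule doubling_power[OF assms(1)])
  finally show ?thesis .
qed

lemma ball_finite' [simp]: "emeasure \<mu> (ball x r) \<noteq> \<top>"
  using ball_finite[of x r] by simp

lemma subset_ball_finite: "A \<subseteq> ball x r \<Longrightarrow> emeasure \<mu> A < \<top>"
  by (rule le_less_trans[OF emeasure_mono ball_finite]) auto

sublocale sigma_finite_measure \<mu>
proof
  have "\<exists>x::'a. True" by simp
  then obtain x :: 'a where True ..
  show "\<exists>A. countable A \<and> A \<subseteq> sets \<mu> \<and> \<Union>A = space \<mu> \<and> (\<forall>a\<in>A. emeasure \<mu> a \<noteq> \<infinity>)"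
  proof (intro exI[of _ "range (\<lambda>n::nat. ball x (real n))"] conjI)
    show "\<Union>(range (\<lambda>n::nat. ball x (real n))) = space \<mu>"
      using reals_Archimedean2 by auto
  qed auto
qed

end

text \<open>Positivity and finiteness of balls follow from the doubling condition in the same way: iterated
  doubling compares any ball with any other concentric one. If one ball were null, so would be the
  whole space, while by local compactness some small ball is contained in a compact set.\<close>

lemma doubling_spaceD:
  assumes "doubling_space \<mu>"
  shows "\<exists>Cd. doubling_measure \<mu> Cd"
proof -
  from assms obtain C where lc: "locally_compact_space (euclidean :: 'a topology)"
    and sets: "sets \<mu> = sets borel" and nz: "emeasure \<mu> UNIV \<noteq> 0"
    and cpt: "\<And>K. compact K \<Longrightarrow> emeasure \<mu> K < \<infinity>"
    and C: "C > 0" "\<And>x r. 0 < r \<Longrightarrow> emeasure \<mu> (ball x (2 * r)) \<le> ennreal C * emeasure \<mu> (ball x r)"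
    unfolding doubling_space_def by blast
  have bm: "ball x r \<in> sets \<mu>" for x r
    by (simp add: sets)
  have dp: "0 < r \<Longrightarrow> emeasure \<mu> (ball x (2 ^ n * r)) \<le> ennreal (C ^ n) * emeasure \<mu> (ball x r)" for n r x
  proof (induction n)
    case (Suc n)
    have "emeasure \<mu> (ball x (2 ^ Suc n * r)) \<le> ennreal C * emeasure \<mu> (ball x (2 ^ n * r))"
      using C(2)[of "2 ^ n * r" x] Suc by (simp add: mult.assoc)
    also have "\<dots> \<le> ennreal C * (ennreal (C ^ n) * emeasure \<mu> (ball x r))"
      using Suc by (intro mult_left_mono) auto
    finally show ?case
      using C(1) by (simp add: ennreal_mult mult.assoc)
  qed auto
  have pos: "0 < emeasure \<mu> (ball x r)" if r: "0 < r" for x r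
  proof (rule ccontr)
    assume "\<not> 0 < emeasure \<mu> (ball x r)"
    then have z: "emeasure \<mu> (ball x (2 ^ n * r)) = 0" for n
      using dp[OF r, of x n] by simp
    have U: "UNIV = (\<Union>n. ball x (2 ^ n * r))"
    proof -
      have "\<exists>n. dist x y < 2 ^ n * r" for y
      proof -
        obtain n where "dist x y / r < 2 ^ n"
          using real_arch_pow[of 2 "dist x y / r"] by auto
        then show ?thesis using r by (auto simp: field_simps intro!: exI[of _ n])
      qed
      then show ?thesis by auto
    qed
    have "emeasure \<mu> (\<Union>n. ball x (2 ^ n * r)) \<le> (\<Sum>n. emeasure \<mu> (ball x (2 ^ n * r)))"
      by (intro emeasure_subadditive_countably) (auto simp: bm)
    also have "\<dots> = 0" by (simp add: z)
    finally show False using nz by (simp flip: U)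
  qed
  have fin: "emeasure \<mu> (ball x r) < \<top>" for x r
  proof (cases "0 < r")
    case True
    obtain U K where UK: "open U" "compact K" "x \<in> U" "U \<subseteq> K"
      using lc unfolding locally_compact_space_def by simp blast
    obtain e where e: "0 < e" "ball x e \<subseteq> U"
      using UK by (meson openE)
    have "emeasure \<mu> (ball x e) \<le> emeasure \<mu> K"
      using e UK by (intro emeasure_mono) (auto simp: sets compact_imp_closed)
    also have "\<dots> < \<top>" using cpt[OF UK(2)] by simp
    finally have f: "emeasure \<mu> (ball x e) < \<top>" .
    obtain n where n: "r / e < 2 ^ n"
      using real_arch_pow[of 2 "r / e"] by auto
    have "emeasure \<mu> (ball x r) \<le> emeasure \<mu> (ball x (2 ^ n * e))"
      using n e by (intro emeasure_mono) (auto simp: bm field_simps)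
    also have "\<dots> \<le> ennreal (C ^ n) * emeasure \<mu> (ball x e)"
      by (rule dp[OF e(1)])
    also have "\<dots> < \<top>" using f by (simp add: ennreal_mult_less_top)
    finally show ?thesis .
  qed (auto simp: not_less ball_empty)
  have "doubling_measure \<mu> (max C 1)"
  proof
    fix r :: real and x :: 'a assume r: "0 < r"
    have "emeasure \<mu> (ball x (2 * r)) \<le> ennreal C * emeasure \<mu> (ball x r)"
      by (rule C(2)[OF r])
    also have "\<dots> \<le> ennreal (max C 1) * emeasure \<mu> (ball x r)"
      by (intro mult_right_mono) (auto simp: ennreal_leI)
    finally show "emeasure \<mu> (ball x (2 * r)) \<le> ennreal (max C 1) * emeasure \<mu> (ball x r)" .
  qed (use sets pos fin in auto)
  then show ?thesis by blast
qed

section \<open>A maximal inequality for finitely many balls\<close>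

text \<open>A greedy selection: keep a ball of largest radius, discard all balls that meet it, and repeat.
  A discarded ball lies in the dilate by 3 of the ball it meets; the factor 4 is used because
  it is a power of 2.\<close>

lemma vitali_covering_finite:
  fixes z :: "'i \<Rightarrow> 'a::metric_space" and r :: "'i \<Rightarrow> real"
  assumes "finite J" "\<And>j. j \<in> J \<Longrightarrow> 0 < r j"
  shows "\<exists>J'\<subseteq>J. disjoint_family_on (\<lambda>j. ball (z j) (r j)) J' \<and>
    (\<Union>j\<in>J. ball (z j) (r j)) \<subseteq> (\<Union>j\<in>J'. ball (z j) (2 ^ 2 * r j))"
  using assms
proof (induction J rule: finite_psubset_induct)
  case (psubset J)
  show ?case
  proof (cases "J = {}")
    case False
    have "Max (r ` J) \<in> r ` J"
      using False psubset(1) by (intro Max_in) auto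
    then obtain j0 where "j0 \<in> J" "r j0 = Max (r ` J)" by auto
    then have j0: "j0 \<in> J" "\<And>j. j \<in> J \<Longrightarrow> r j \<le> r j0"
      using psubset(1) by auto
    define J1 where "J1 = {j\<in>J. ball (z j) (r j) \<inter> ball (z j0) (r j0) = {}}"
    have "j0 \<notin> J1" using psubset.prems[OF j0(1)] by (auto simp: J1_def)
    moreover have "J1 \<subseteq> J" by (auto simp: J1_def)
    ultimately have "J1 \<subset> J" using j0(1) by blast
    from psubset.IH[OF this] psubset.prems obtain J' where
      J': "J' \<subseteq> J1" "disjoint_family_on (\<lambda>j. ball (z j) (r j)) J'"
        "(\<Union>j\<in>J1. ball (z j) (r j)) \<subseteq> (\<Union>j\<in>J'. ball (z j) (2 ^ 2 * r j))"
      by (auto simp: J1_def)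
    have "ball (z j) (r j) \<subseteq> ball (z j0) (2 ^ 2 * r j0)" if "j \<in> J" "j \<notin> J1" for j
    proof
      fix x assume x: "x \<in> ball (z j) (r j)"
      from that obtain y where y: "dist (z j) y < r j" "dist (z j0) y < r j0"
        by (auto simp: J1_def)
      have "dist (z j0) x \<le> dist (z j0) y + dist y (z j) + dist (z j) x"
        using dist_triangle[of "z j0" x y] dist_triangle[of y x "z j"] by linarith
      also have "\<dots> < r j0 + r j + r j" using x y by (simp add: dist_commute)
      also have "\<dots> \<le> 2 ^ 2 * r j0" using j0(2)[OF that(1)] psubset.prems[OF j0(1)] by simp
      finally show "x \<in> ball (z j0) (2 ^ 2 * r j0)" by simp
    qed
    moreover have "disjoint_family_on (\<lambda>j. ball (z j) (r j)) (insert j0 J')"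
      using J'(1,2) unfolding disjoint_family_on_def J1_def by blast
    ultimately show ?thesis
    proof (intro exI[of _ "insert j0 J'"] conjI)
      assume far: "\<And>j. j \<in> J \<Longrightarrow> j \<notin> J1 \<Longrightarrow> ball (z j) (r j) \<subseteq> ball (z j0) (2 ^ 2 * r j0)"
      show "insert j0 J' \<subseteq> J" using J'(1) j0(1) by (auto simp: J1_def)
      show "(\<Union>j\<in>J. ball (z j) (r j)) \<subseteq> (\<Union>j\<in>insert j0 J'. ball (z j) (2 ^ 2 * r j))"
      proof
        fix x assume "x \<in> (\<Union>j\<in>J. ball (z j) (r j))"
        then obtain j where "j \<in> J" "x \<in> ball (z j) (r j)" by blast
        then show "x \<in> (\<Union>j\<in>insert j0 J'. ball (z j) (2 ^ 2 * r j))"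
          using far[of j] J'(3) by (cases "j \<in> J1") blast+
      qed
    qed
  qed (auto simp: disjoint_family_on_def)
qed

lemma layer_cake_powe:
  fixes y :: ennreal
  assumes s: "0 < s"
  shows "(\<integral>\<^sup>+t. ennreal (t powr (s - 1)) * indicator {t. 0 < t \<and> ennreal t < y} t \<partial>lborel)
    = ennreal (1 / s) * y powe s"
proof -
  have real_case: "(\<integral>\<^sup>+t. ennreal (t powr (s - 1)) * indicator {t. 0 < t \<and> ennreal t < ennreal c} t \<partial>lborel)
    = ennreal (1 / s) * ennreal c powe s" if c: "0 \<le> c" for c :: real
  proof -
    have "((\<lambda>t. t powr (s - 1)) has_integral (c powr (s - 1 + 1) / (s - 1 + 1))) {0..c}"
      using s c by (intro has_integral_powr_from_0) auto
    then have "((\<lambda>t. if t \<in> {0..c} then t powr (s - 1) else 0) has_integral (c powr s / s)) UNIV"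
      by (simp only: has_integral_restrict_UNIV) simp
    then have *: "(\<integral>\<^sup>+t. ennreal (if t \<in> {0..c} then t powr (s - 1) else 0) \<partial>lborel) = ennreal (c powr s / s)"
      by (intro nn_integral_has_integral_lborel) auto
    have "(\<integral>\<^sup>+t. ennreal (t powr (s - 1)) * indicator {t. 0 < t \<and> ennreal t < ennreal c} t \<partial>lborel)
      = (\<integral>\<^sup>+t. ennreal (if t \<in> {0..c} then t powr (s - 1) else 0) \<partial>lborel)"
    proof (intro nn_integral_cong_AE)
      have "AE t in lborel. t \<noteq> 0 \<and> t \<noteq> c"
        using AE_lborel_singleton[of 0] AE_lborel_singleton[of c] by eventually_elim auto
      then show "AE t in lborel. ennreal (t powr (s - 1)) * indicator {t. 0 < t \<and> ennreal t < ennreal c} t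
          = ennreal (if t \<in> {0..c} then t powr (s - 1) else 0)"
        by eventually_elim (auto simp: indicator_def ennreal_less_iff split: if_splits)
    qed
    also have "\<dots> = ennreal (1 / s) * ennreal c powe s"
      using * s c by (simp add: ennreal_powr_ennreal flip: ennreal_mult)
    finally show ?thesis .
  qed
  show ?thesis
  proof (cases y)
    case (real c)
    then show ?thesis using real_case by simp
  next
    case top
    let ?I = "\<integral>\<^sup>+t. ennreal (t powr (s - 1)) * indicator {t. 0 < t \<and> ennreal t < y} t \<partial>lborel"
    have "ennreal B \<le> ?I" if B: "0 \<le> B" for B
    proof -
      define c where "c = (s * B) powr (1 / s)"
      have "ennreal B = ennreal (1 / s) * ennreal c powe s"
        using s B by (simp add: ennreal_powr_ennreal c_def powr_powr flip: ennreal_mult)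
      also have "\<dots> = (\<integral>\<^sup>+t. ennreal (t powr (s - 1)) * indicator {t. 0 < t \<and> ennreal t < ennreal c} t \<partial>lborel)"
        by (subst real_case) (auto simp: c_def)
      also have "\<dots> \<le> ?I"
        using top by (intro nn_integral_mono mult_left_mono) (auto simp: indicator_def)
      finally show ?thesis .
    qed
    from this[of "enn2real ?I + 1"] have "?I = \<top>"
      by (cases ?I) (auto simp: enn2real_nonneg)
    then show ?thesis using top s by (simp add: ennreal_mult_top)
  qed
qed

context doubling_measure
begin

text \<open>Where \<open>h \<le> t/2\<close>, the function contributes at most \<open>t/2\<close> to an average, hence at most half of any
  average exceeding \<open>t\<close>. Only the large values of \<open>h\<close> thus enter the right-hand side, which makes
  the integration over \<open>t\<close> in the strong-type inequality converge.\<close>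

lemma weak_type_finite:
  fixes h :: "'a \<Rightarrow> ennreal"
  assumes J: "finite J" "\<And>j. j \<in> J \<Longrightarrow> 0 < r j" and [measurable]: "h \<in> borel_measurable \<mu>"
    and t: "0 < t" and avg: "\<And>j. j \<in> J \<Longrightarrow> ennreal t < average \<mu> (ball (z j) (r j)) h"
  shows "emeasure \<mu> (\<Union>j\<in>J. ball (z j) (r j))
    \<le> ennreal (2 * Cd ^ 2 / t) * (\<integral>\<^sup>+x. h x * indicator {x. ennreal t < 2 * h x} x \<partial>\<mu>)"
proof -
  obtain J' where J': "J' \<subseteq> J" "disjoint_family_on (\<lambda>j. ball (z j) (r j)) J'"
      "(\<Union>j\<in>J. ball (z j) (r j)) \<subseteq> (\<Union>j\<in>J'. ball (z j) (2 ^ 2 * r j))"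
    using vitali_covering_finite[of J r z] J by blast
  have fin: "finite J'" using J'(1) J(1) finite_subset by blast
  let ?g = "\<lambda>x. h x * indicator {x. ennreal t < 2 * h x} x"
  let ?B = "\<lambda>j. ball (z j) (r j)"
  have g: "?g \<in> borel_measurable \<mu>" by measurable
  have m1: "(\<lambda>x. ?g x * indicator (?B j) x) \<in> borel_measurable \<mu>" for j
    by (intro borel_measurable_times_ennreal g borel_measurable_indicator) simp
  have m2: "(\<lambda>x. ennreal (t / 2) * indicator (?B j) x) \<in> borel_measurable \<mu>" for j
    by (intro borel_measurable_times_ennreal borel_measurable_indicator) simp_all
  have one: "emeasure \<mu> (?B j) \<le> ennreal (2 / t) * (\<integral>\<^sup>+x\<in>?B j. ?g x \<partial>\<mu>)" if j: "j \<in> J'" for j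
  proof -
    have r: "0 < r j" "j \<in> J" using j J' J by auto
    have pt: "h x * indicator (?B j) x \<le> ?g x * indicator (?B j) x + ennreal (t / 2) * indicator (?B j) x" for x
    proof (cases "ennreal t < 2 * h x")
      case False
      then have "2 * h x \<le> ennreal t" by simp
      then have "h x \<le> ennreal (t / 2)"
        using t by (cases "h x")
          (auto simp: ennreal_mult_top top_unique ennreal_numeral[symmetric] simp flip: ennreal_mult simp del: ennreal_numeral)
      then show ?thesis by (auto simp: indicator_def)
    qed (auto simp: indicator_def)
    have "ennreal t * emeasure \<mu> (?B j) \<le> (\<integral>\<^sup>+x\<in>?B j. h x \<partial>\<mu>)"
    proof -
      have "ennreal t * emeasure \<mu> (?B j) \<le> average \<mu> (?B j) h * emeasure \<mu> (?B j)"
        using avg[OF r(2)] by (intro mult_right_mono) auto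
      also have "\<dots> = (\<integral>\<^sup>+x\<in>?B j. h x \<partial>\<mu>)"
        using ball_pos[OF r(1), of "z j"] ball_finite[of "z j" "r j"]
        by (simp add: average_def ennreal_divide_times mult_divide_eq_ennreal)
      finally show ?thesis .
    qed
    also have "\<dots> \<le> (\<integral>\<^sup>+x. ?g x * indicator (?B j) x + ennreal (t / 2) * indicator (?B j) x \<partial>\<mu>)"
      by (rule nn_integral_mono) (rule pt)
    also have "\<dots> = (\<integral>\<^sup>+x\<in>?B j. ?g x \<partial>\<mu>) + ennreal (t / 2) * emeasure \<mu> (?B j)"
      by (subst nn_integral_add[OF m1 m2]) (simp_all add: nn_integral_cmult_indicator)
    finally have *: "ennreal t * emeasure \<mu> (?B j) \<le> (\<integral>\<^sup>+x\<in>?B j. ?g x \<partial>\<mu>) + ennreal (t / 2) * emeasure \<mu> (?B j)" .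
    obtain m where m: "emeasure \<mu> (?B j) = ennreal m" "0 \<le> m"
      using ball_finite[of "z j" "r j"] by (cases "emeasure \<mu> (?B j)") auto
    show ?thesis
    proof (cases "\<integral>\<^sup>+x\<in>?B j. ?g x \<partial>\<mu>")
      case (real I)
      then have "t * m \<le> I + t / 2 * m"
        using * t m by (simp flip: ennreal_mult ennreal_plus)
      then have "m \<le> 2 / t * I" using t by (simp add: field_simps)
      then show ?thesis
        unfolding real(2) m(1) using t real(1) by (simp add: ennreal_leI flip: ennreal_mult)
    next
      case top
      then show ?thesis using t by (simp add: ennreal_mult_top)
    qed
  qed
  have "emeasure \<mu> (\<Union>j\<in>J. ?B j) \<le> emeasure \<mu> (\<Union>j\<in>J'. ball (z j) (2 ^ 2 * r j))"
    using J'(3) fin by (intro emeasure_mono) auto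
  also have "\<dots> \<le> (\<Sum>j\<in>J'. emeasure \<mu> (ball (z j) (2 ^ 2 * r j)))"
    using fin by (intro emeasure_subadditive_finite) auto
  also have "\<dots> \<le> (\<Sum>j\<in>J'. ennreal (Cd ^ 2) * (ennreal (2 / t) * (\<integral>\<^sup>+x\<in>?B j. ?g x \<partial>\<mu>)))"
  proof (intro sum_mono)
    fix j assume j: "j \<in> J'"
    have "emeasure \<mu> (ball (z j) (2 ^ 2 * r j)) \<le> ennreal (Cd ^ 2) * emeasure \<mu> (?B j)"
      using j J' J by (intro doubling_power) auto
    also have "\<dots> \<le> ennreal (Cd ^ 2) * (ennreal (2 / t) * (\<integral>\<^sup>+x\<in>?B j. ?g x \<partial>\<mu>))"
      by (intro mult_left_mono one[OF j]) auto
    finally show "emeasure \<mu> (ball (z j) (2 ^ 2 * r j)) \<le> \<dots>" .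
  qed
  also have "\<dots> = ennreal (2 * Cd ^ 2 / t) * (\<Sum>j\<in>J'. \<integral>\<^sup>+x\<in>?B j. ?g x \<partial>\<mu>)"
    using t by (simp add: sum_distrib_left mult.assoc[symmetric] mult.commute flip: ennreal_mult)
  also have "(\<Sum>j\<in>J'. \<integral>\<^sup>+x\<in>?B j. ?g x \<partial>\<mu>) = (\<integral>\<^sup>+x\<in>(\<Union>j\<in>J'. ?B j). ?g x \<partial>\<mu>)"
    using fin J'(2)
    by (subst nn_integral_sum[OF m1, symmetric])
       (auto intro!: nn_integral_cong simp: indicator_UN_disjoint sum_distrib_left)
  also have "\<dots> \<le> (\<integral>\<^sup>+x. ?g x \<partial>\<mu>)"
    by (intro nn_integral_mono) (auto simp: indicator_def)
  finally show ?thesis by (simp add: mult_left_mono)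
qed

text \<open>The maximal inequality in \<open>L^q\<close>, with the disjoint sets \<open>F j\<close> in place of a maximal function: on
  \<open>F j\<close> the maximal function is at least the average over the \<open>j\<close>-th ball. For sums over finitely many
  balls this form avoids measurability questions. Essential is the behaviour
  of the constant as \<open>q \<rightarrow> 1\<close>: it grows like \<open>1/(q - 1)\<close>.\<close>

lemma maximal_inequality_finite:
  fixes h :: "'a \<Rightarrow> ennreal"
  assumes J: "finite J" "\<And>j. j \<in> J \<Longrightarrow> 0 < r j" and h [measurable]: "h \<in> borel_measurable \<mu>"
    and F: "disjoint_family_on F J" "\<And>j. j \<in> J \<Longrightarrow> F j \<in> sets \<mu>" "\<And>j. j \<in> J \<Longrightarrow> F j \<subseteq> ball (z j) (r j)"
    and q: "1 < q"
  shows "(\<Sum>j\<in>J. emeasure \<mu> (F j) * average \<mu> (ball (z j) (r j)) h powe q)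
    \<le> ennreal (Cd ^ 2 * 2 powr q * q / (q - 1)) * (\<integral>\<^sup>+x. h x powe q \<partial>\<mu>)"
proof -
  define A where "A j = average \<mu> (ball (z j) (r j)) h" for j
  interpret P: pair_sigma_finite lborel \<mu>
    by (simp add: pair_sigma_finite_def lborel.sigma_finite_measure_axioms sigma_finite_measure_axioms)
  have "(\<Sum>j\<in>J. emeasure \<mu> (F j) * A j powe q)
    = (\<Sum>j\<in>J. emeasure \<mu> (F j) * (ennreal q * (\<integral>\<^sup>+t. ennreal (t powr (q - 1)) * indicator {t. 0 < t \<and> ennreal t < A j} t \<partial>lborel)))"
    using q by (subst layer_cake_powe) (auto simp: mult.assoc[symmetric] simp flip: ennreal_mult)
  also have "\<dots> = (\<integral>\<^sup>+t. (\<Sum>j\<in>J. emeasure \<mu> (F j) * (ennreal q * (ennreal (t powr (q - 1)) * indicator {t. 0 < t \<and> ennreal t < A j} t))) \<partial>lborel)"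
    by (simp add: nn_integral_cmult nn_integral_sum)
  also have "\<dots> \<le> (\<integral>\<^sup>+t. (\<integral>\<^sup>+x. ennreal (2 * Cd ^ 2 * q) * h x *
      (ennreal (t powr (q - 1 - 1)) * indicator {t. 0 < t \<and> ennreal t < 2 * h x} t) \<partial>\<mu>) \<partial>lborel)"
  proof (rule nn_integral_mono)
    fix t :: real
    show "(\<Sum>j\<in>J. emeasure \<mu> (F j) * (ennreal q * (ennreal (t powr (q - 1)) * indicator {t. 0 < t \<and> ennreal t < A j} t)))
      \<le> (\<integral>\<^sup>+x. ennreal (2 * Cd ^ 2 * q) * h x *
        (ennreal (t powr (q - 1 - 1)) * indicator {t. 0 < t \<and> ennreal t < 2 * h x} t) \<partial>\<mu>)"
    proof (cases "0 < t")
      case t: True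
      define Jt where "Jt = {j\<in>J. ennreal t < A j}"
      have "(\<Sum>j\<in>J. emeasure \<mu> (F j) * (ennreal q * (ennreal (t powr (q - 1)) * indicator {t. 0 < t \<and> ennreal t < A j} t)))
        = (\<Sum>j\<in>Jt. ennreal (q * t powr (q - 1)) * emeasure \<mu> (F j))"
        unfolding Jt_def using J(1) t q
        by (subst sum.inter_filter) (auto intro!: sum.cong simp: ennreal_mult ac_simps)
      also have "\<dots> = ennreal (q * t powr (q - 1)) * emeasure \<mu> (\<Union>j\<in>Jt. F j)"
      proof -
        have "disjoint_family_on F Jt"
          using F(1) by (rule disjoint_family_on_mono[rotated]) (auto simp: Jt_def)
        then show ?thesis
          using F(2) J(1) by (subst sum_emeasure[symmetric]) (auto simp: Jt_def sum_distrib_left)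
      qed
      also have "\<dots> \<le> ennreal (q * t powr (q - 1)) * emeasure \<mu> (\<Union>j\<in>Jt. ball (z j) (r j))"
        using F(3) J by (intro mult_left_mono emeasure_mono) (auto simp: Jt_def)
      also have "\<dots> \<le> ennreal (q * t powr (q - 1)) * (ennreal (2 * Cd ^ 2 / t) * (\<integral>\<^sup>+x. h x * indicator {x. ennreal t < 2 * h x} x \<partial>\<mu>))"
        using J t by (intro mult_left_mono weak_type_finite) (auto simp: Jt_def A_def)
      also have "\<dots> = ennreal ((2 * Cd ^ 2 * q) * t powr (q - 1 - 1)) * (\<integral>\<^sup>+x. h x * indicator {x. ennreal t < 2 * h x} x \<partial>\<mu>)"
      proof -
        have "(q * t powr (q - 1)) * (2 * Cd ^ 2 / t) = (2 * Cd ^ 2 * q) * t powr (q - 1 - 1)"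
          using t by (simp add: powr_diff power2_eq_square)
        then have "ennreal (q * t powr (q - 1)) * ennreal (2 * Cd ^ 2 / t) = ennreal ((2 * Cd ^ 2 * q) * t powr (q - 1 - 1))"
          using t q by (subst ennreal_mult[symmetric]) auto
        then show ?thesis by (simp only: mult.assoc[symmetric])
      qed
      also have "\<dots> = (\<integral>\<^sup>+x. ennreal (2 * Cd ^ 2 * q) * h x *
        (ennreal (t powr (q - 1 - 1)) * indicator {t. 0 < t \<and> ennreal t < 2 * h x} t) \<partial>\<mu>)"
      proof -
        have "ennreal ((2 * Cd ^ 2 * q) * t powr (q - 1 - 1)) = ennreal (2 * Cd ^ 2 * q) * ennreal (t powr (q - 1 - 1))"
          using q by (intro ennreal_mult) auto
        then show ?thesis
          using t by (subst nn_integral_cmult[symmetric])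
            (auto intro!: nn_integral_cong simp: ac_simps indicator_def)
      qed
      finally show ?thesis .
    qed auto
  qed
  also have "\<dots> = (\<integral>\<^sup>+x. (\<integral>\<^sup>+t. ennreal (2 * Cd ^ 2 * q) * h x *
      (ennreal (t powr (q - 1 - 1)) * indicator {t. 0 < t \<and> ennreal t < 2 * h x} t) \<partial>lborel) \<partial>\<mu>)"
    by (rule P.Fubini'[symmetric]) (simp add: split_beta', measurable)
  also have "\<dots> = (\<integral>\<^sup>+x. ennreal (2 * Cd ^ 2 * q) * h x * (ennreal (1 / (q - 1)) * (2 * h x) powe (q - 1)) \<partial>\<mu>)"
  proof (rule nn_integral_cong)
    fix x
    show "(\<integral>\<^sup>+t. ennreal (2 * Cd ^ 2 * q) * h x *
      (ennreal (t powr (q - 1 - 1)) * indicator {t. 0 < t \<and> ennreal t < 2 * h x} t) \<partial>lborel)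
      = ennreal (2 * Cd ^ 2 * q) * h x * (ennreal (1 / (q - 1)) * (2 * h x) powe (q - 1))"
      using q by (subst layer_cake_powe[symmetric]) (auto intro!: nn_integral_cmult)
  qed
  also have "\<dots> = (\<integral>\<^sup>+x. ennreal (Cd ^ 2 * 2 powr q * q / (q - 1)) * h x powe q \<partial>\<mu>)"
  proof (rule nn_integral_cong)
    fix x
    have 1: "(2 * h x) powe (q - 1) = ennreal (2 powr (q - 1)) * h x powe (q - 1)"
      by (simp add: powe_mult ennreal_powr_ennreal ennreal_numeral[symmetric] del: ennreal_numeral)
    have 2: "h x powe q = h x * h x powe (q - 1)"
      using powe_add[of "h x" 1 "q - 1"] by simp
    have "2 powr q = 2 * 2 powr (q - 1)"
      by (simp add: powr_diff)
    then have 3: "Cd ^ 2 * 2 powr q * q / (q - 1) = (2 * Cd ^ 2 * q) * (1 / (q - 1)) * 2 powr (q - 1)"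
      by simp
    have 4: "ennreal (Cd ^ 2 * 2 powr q * q / (q - 1)) = ennreal (2 * Cd ^ 2 * q) * ennreal (1 / (q - 1)) * ennreal (2 powr (q - 1))"
      unfolding 3 using q by (subst ennreal_mult, simp, simp, subst ennreal_mult) simp_all
    show "ennreal (2 * Cd ^ 2 * q) * h x * (ennreal (1 / (q - 1)) * (2 * h x) powe (q - 1))
      = ennreal (Cd ^ 2 * 2 powr q * q / (q - 1)) * h x powe q"
      unfolding 1 2 4 by (simp only: ac_simps)
  qed
  also have "\<dots> = ennreal (Cd ^ 2 * 2 powr q * q / (q - 1)) * (\<integral>\<^sup>+x. h x powe q \<partial>\<mu>)"
    by (rule nn_integral_cmult) simp
  finally show ?thesis by (simp add: A_def)
qed

end

section \<open>The reverse Hoelder inequality on a finite tree\<close>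

text \<open>A tree of finite height, given by maps \<open>par h\<close> that send the nodes of height \<open>h - 1\<close> to their
  parents of height \<open>h\<close>; the leaves have height 0. The map depends on \<open>h\<close> because one and the same
  point may be a node at several heights.\<close>

primrec ancestor :: "(nat \<Rightarrow> 'a \<Rightarrow> 'a) \<Rightarrow> nat \<Rightarrow> 'a \<Rightarrow> 'a" where
  "ancestor par 0 x = x"
| "ancestor par (Suc h) x = par (Suc h) (ancestor par h x)"

text \<open>The leaves with the same ancestor at height \<open>h\<close> as \<open>x\<close>. Cells are indexed by the leaves they
  contain rather than by nodes.\<close>

definition cell :: "'a set \<Rightarrow> (nat \<Rightarrow> 'a \<Rightarrow> 'a) \<Rightarrow> nat \<Rightarrow> 'a \<Rightarrow> 'a set"
  where "cell L par h x = {y\<in>L. ancestor par h y = ancestor par h x}"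

lemma cell_self: "x \<in> L \<Longrightarrow> x \<in> cell L par h x"
  by (simp add: cell_def)

lemma cell_eq: "y \<in> cell L par h x \<Longrightarrow> cell L par h y = cell L par h x"
  by (auto simp: cell_def)

lemma ancestor_eq_mono:
  "ancestor par h x = ancestor par h y \<Longrightarrow> h \<le> k \<Longrightarrow> ancestor par k x = ancestor par k y"
  by (induction k) (auto simp: le_Suc_eq)

lemma cell_mono: "h \<le> k \<Longrightarrow> cell L par h x \<subseteq> cell L par k x"
  unfolding cell_def by (auto intro: ancestor_eq_mono[where h = h])

lemma cell_eq_mono: "y \<in> cell L par h x \<Longrightarrow> h \<le> k \<Longrightarrow> cell L par k y = cell L par k x"
  using cell_mono[of h k L par x] cell_eq[of y L par k x] by blast

text \<open>A stopping-time argument by induction on the height. In a cell \<open>Q\<close>, select the largest cells on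
  which the average of \<open>w\<close> exceeds twice its average \<open>av Q\<close>, and let \<open>B\<close> be their union. Outside \<open>B\<close> the
  density \<open>w/m\<close> is at most \<open>2 av Q\<close>. On a selected cell the average is at most \<open>2 D av Q\<close>, as the parent
  was not selected, and the induction hypothesis applies. Since \<open>B\<close> has at most half of the mass of \<open>Q\<close>,
  the assumption on large subsets leaves at most \<open>(1 - \<eta>) w(Q)\<close> for it. Hence
  \<open>\<Sum> w (w/m)^e \<le> (w(Q - B) + 2 w(B)) (2 D av Q)^e \<le> (2 - \<eta>) (1 + \<eta>/2) w(Q) (av Q)^e\<close>, and
  \<open>(2 - \<eta>) (1 + \<eta>/2) \<le> 2\<close>: the smallness of \<open>e\<close> makes the constant 2 reproduce itself, whatever the
  height.\<close>

lemma tree_reverse_holder: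
  fixes m w :: "'a \<Rightarrow> real"
  assumes fin: "finite L" and m: "\<And>x. x \<in> L \<Longrightarrow> 0 < m x" and w: "\<And>x. x \<in> L \<Longrightarrow> 0 \<le> w x"
    and parent: "\<And>h x. x \<in> L \<Longrightarrow> h < N \<Longrightarrow> sum m (cell L par (Suc h) x) \<le> D * sum m (cell L par h x)"
    and ainf: "\<And>h x A. x \<in> L \<Longrightarrow> h \<le> N \<Longrightarrow> A \<subseteq> cell L par h x \<Longrightarrow>
       sum m (cell L par h x) \<le> 2 * sum m A \<Longrightarrow> \<eta> * sum w (cell L par h x) \<le> sum w A"
    and e: "0 \<le> e" and \<eta>: "0 \<le> \<eta>" and D: "1 \<le> D"
    and small: "(2 * D) powr e \<le> 1 + \<eta> / 2"
    and x: "x \<in> L" and h: "h \<le> N"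
  shows "(\<Sum>y\<in>cell L par h x. w y * (w y / m y) powr e)
    \<le> 2 * sum w (cell L par h x) * (sum w (cell L par h x) / sum m (cell L par h x)) powr e"
  using x h
proof (induction h arbitrary: x rule: less_induct)
  case (less h)
  define Q where "Q = cell L par h x"
  define av where "av A = sum w A / sum m A" for A
  define \<Phi> where "\<Phi> A = (\<Sum>y\<in>A. w y * (w y / m y) powr e)" for A
  have QL: "Q \<subseteq> L" by (auto simp: Q_def cell_def)
  have finQ: "finite Q" by (rule finite_subset[OF QL fin])
  have cL: "cell L par j y \<subseteq> L" "finite (cell L par j y)" for j y
    using fin by (auto simp: cell_def)
  have mpos: "0 < sum m (cell L par j y)" if "y \<in> L" for j y
  proof (rule sum_pos)
    show "cell L par j y \<noteq> {}" using cell_self[OF that, of par j] by blast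
    show "0 < m u" if "u \<in> cell L par j y" for u using that cL(1) by (intro m) blast
  qed (rule cL)
  have wnn: "0 \<le> sum w A" if "A \<subseteq> L" for A
    using w that by (intro sum_nonneg) auto
  have avnn: "0 \<le> av A" if "A \<subseteq> L" for A
    unfolding av_def using w m that by (intro divide_nonneg_nonneg sum_nonneg) (auto intro: less_imp_le)
  have xQ: "x \<in> Q" using less.prems by (auto simp: Q_def cell_def)
  \<comment> \<open>The leaf \<open>y\<close> belongs to \<open>B\<close> if some proper subcell of \<open>Q\<close> containing it has a large average; \<open>\<tau> y\<close> is the
    height of the largest such cell \<open>T y\<close>, and the cells \<open>T y\<close> partition \<open>B\<close>.\<close>
  define bad where "bad y j \<longleftrightarrow> j < h \<and> 2 * av Q < av (cell L par j y)" for y j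
  define B where "B = {y\<in>Q. \<exists>j. bad y j}"
  define \<tau> where "\<tau> y = (GREATEST j. bad y j)" for y
  define T where "T y = cell L par (\<tau> y) y" for y
  have \<tau>: "bad y (\<tau> y)" "\<And>j. bad y j \<Longrightarrow> j \<le> \<tau> y" if "y \<in> B" for y
  proof -
    have ex: "\<exists>j. bad y j" using that by (auto simp: B_def)
    have bd: "\<And>j. bad y j \<Longrightarrow> j \<le> h" by (auto simp: bad_def)
    show "bad y (\<tau> y)" unfolding \<tau>_def using ex bd by (metis GreatestI_nat)
    show "\<And>j. bad y j \<Longrightarrow> j \<le> \<tau> y" unfolding \<tau>_def using bd by (metis Greatest_le_nat)
  qed
  have BQ: "B \<subseteq> Q" "B \<subseteq> L" "finite B" using QL finQ by (auto simp: B_def)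
  have T_sub: "T y \<subseteq> B \<and> (\<forall>u\<in>T y. T u = T y)" if y: "y \<in> B" for y
  proof -
    have \<tau>h: "\<tau> y < h" using \<tau>(1)[OF y] by (simp add: bad_def)
    have "u \<in> B \<and> T u = T y" if u: "u \<in> T y" for u
    proof -
      have cu: "cell L par j u = cell L par j y" if "\<tau> y \<le> j" for j
        using cell_eq_mono[of u L par "\<tau> y" y j] u that by (simp add: T_def)
      have uQ: "u \<in> Q"
      proof -
        have "y \<in> Q" using y by (simp add: B_def)
        then have "cell L par h y = Q" using cell_eq[of y L par h x] by (simp add: Q_def)
        moreover have "u \<in> cell L par h y"
          using u \<tau>h cell_mono[of "\<tau> y" h L par y] by (auto simp: T_def)
        ultimately show ?thesis by simp
      qed
      have bu: "bad u (\<tau> y)" using \<tau>(1)[OF y] cu[of "\<tau> y"] by (simp add: bad_def)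
      then have uB: "u \<in> B" using uQ by (auto simp: B_def)
      have "\<tau> y \<le> \<tau> u" using \<tau>(2)[OF uB bu] .
      moreover have "bad y (\<tau> u)" using \<tau>(1)[OF uB] cu[OF calculation] by (simp add: bad_def)
      then have "\<tau> u \<le> \<tau> y" using \<tau>(2)[OF y] by simp
      ultimately have "\<tau> u = \<tau> y" by simp
      then show ?thesis using uB cu[of "\<tau> y"] by (simp add: T_def)
    qed
    then show ?thesis by blast
  qed
  have T_self: "y \<in> T y" if "y \<in> B" for y
    using that BQ by (auto simp: T_def intro: cell_self)
  have fibre: "{u\<in>B. T u = T y} = T y" if "y \<in> B" for y
    using T_sub[OF that] T_self by blast
  have group: "sum g B = (\<Sum>C\<in>T ` B. sum g C)" for g :: "'a \<Rightarrow> real"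
  proof -
    have "sum g B = (\<Sum>C\<in>T ` B. sum g {u\<in>B. T u = C})"
      by (rule sum.image_gen[OF BQ(3)])
    also have "\<dots> = (\<Sum>C\<in>T ` B. sum g C)"
      using fibre by (intro sum.cong) auto
    finally show ?thesis .
  qed
  have one: "\<Phi> C \<le> 2 * sum w C * (2 * D * av Q) powr e \<and> 2 * av Q * sum m C \<le> sum w C" if "C \<in> T ` B" for C
  proof -
    from that obtain y where y: "y \<in> B" "C = cell L par (\<tau> y) y" by (auto simp: T_def)
    have yL: "y \<in> L" using y BQ by auto
    have t: "\<tau> y < h" "2 * av Q < av C" using \<tau>(1)[OF y(1)] y(2) by (auto simp: bad_def)
    have "av (cell L par (Suc (\<tau> y)) y) \<le> 2 * av Q"
    proof (cases "Suc (\<tau> y) = h")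
      case True
      have "y \<in> Q" using y(1) BQ by blast
      then have "cell L par h y = Q" using cell_eq[of y L par h x] by (simp add: Q_def)
      then show ?thesis using True avnn[OF QL] by simp
    next
      case False
      then have "\<not> bad y (Suc (\<tau> y))" using \<tau>(2)[OF y(1)] by fastforce
      then show ?thesis using t False by (simp add: bad_def)
    qed
    moreover have "av C \<le> D * av (cell L par (Suc (\<tau> y)) y)"
    proof -
      let ?P = "cell L par (Suc (\<tau> y)) y"
      have "sum w C \<le> sum w ?P"
      proof (rule sum_mono2)
        show "C \<subseteq> ?P" unfolding y(2) by (rule cell_mono) simp
        show "0 \<le> w u" if "u \<in> ?P - C" for u using that cL(1) w by blast
      qed (rule cL)
      moreover have "sum m ?P \<le> D * sum m C"
        unfolding y(2) using parent[OF yL] t less.prems by auto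
      moreover have "0 < sum m C" "0 < sum m ?P" using mpos yL y(2) by auto
      moreover have "0 \<le> sum w C" using wnn cL(1) y(2) by auto
      ultimately have "sum w C * sum m ?P \<le> sum w ?P * (D * sum m C)"
        by (intro mult_mono) auto
      then show ?thesis
        using \<open>0 < sum m C\<close> \<open>0 < sum m ?P\<close> by (simp add: av_def field_simps)
    qed
    ultimately have "av C \<le> D * (2 * av Q)"
      using D by (meson mult_left_mono order.trans zero_le_one)
    moreover have "0 \<le> av C" using avnn cL(1) y(2) by auto
    moreover have "0 \<le> sum w C" using wnn cL(1) y(2) by auto
    moreover have "\<Phi> C \<le> 2 * sum w C * av C powr e"
      using less.IH[OF t(1) yL] t less.prems by (simp add: \<Phi>_def av_def y(2))
    moreover have "2 * av Q * sum m C \<le> sum w C"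
      using t(2) mpos[OF yL, of "\<tau> y"] y(2) by (simp add: av_def field_simps)
    moreover have "2 * sum w C * av C powr e \<le> 2 * sum w C * (2 * D * av Q) powr e"
      using calculation e by (intro mult_left_mono powr_mono2) (auto simp: mult.left_commute mult.assoc)
    ultimately show ?thesis by linarith
  qed
  have CmB: "2 * av Q * sum m B \<le> sum w B"
  proof -
    have "2 * av Q * sum m B = (\<Sum>C\<in>T ` B. 2 * av Q * sum m C)"
      by (subst group) (rule sum_distrib_left)
    also have "\<dots> \<le> (\<Sum>C\<in>T ` B. sum w C)" using one by (intro sum_mono) blast
    also have "\<dots> = sum w B" by (rule group[symmetric])
    finally show ?thesis .
  qed
  have wB: "sum w B \<le> (1 - \<eta>) * sum w Q"
  proof -
    \<comment> \<open>On \<open>B\<close> the average of \<open>w\<close> is at least \<open>2 av Q\<close>, so \<open>B\<close> has at most half of the mass.\<close>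
    have mB: "sum m Q \<le> 2 * sum m (Q - B)"
    proof (cases "sum w Q = 0")
      case True
      then have "av C = 0" if "C \<subseteq> Q" for C
      proof -
        have "sum w C \<le> sum w Q" using that finQ w QL by (intro sum_mono2) auto
        moreover have "0 \<le> sum w C" using that QL by (intro wnn) blast
        ultimately show ?thesis using True by (simp add: av_def)
      qed
      moreover have "T y \<subseteq> Q" if "y \<in> B" for y using T_sub[OF that] BQ by blast
      ultimately have "B = {}" using \<tau>(1) avnn[OF QL] unfolding bad_def T_def
        by (metis (no_types, lifting) equals0I less_le_not_le mult_zero_right order_refl T_def)
      then show ?thesis using mpos[OF less.prems(1), of h] by (simp add: Q_def)
    next
      case False
      then have wp: "0 < sum w Q" using wnn[OF QL] by simp
      have mp: "0 < sum m Q" using mpos[OF less.prems(1)] by (simp add: Q_def)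
      have "sum w B \<le> sum w Q" using BQ finQ w QL by (intro sum_mono2) auto
      then have "2 * (sum w Q / sum m Q) * sum m B \<le> sum w Q" using CmB by (simp add: av_def)
      then have "2 * sum m B \<le> sum m Q" using wp mp by (simp add: field_simps)
      moreover have "sum m (Q - B) = sum m Q - sum m B"
        using BQ finQ by (intro sum_diff) auto
      ultimately show ?thesis by simp
    qed
    have "\<eta> * sum w Q \<le> sum w (Q - B)"
      unfolding Q_def using less.prems mB by (intro ainf) (auto simp: Q_def)
    moreover have "sum w (Q - B) = sum w Q - sum w B"
      using BQ finQ by (intro sum_diff) auto
    ultimately show ?thesis by (simp add: algebra_simps)
  qed
  have good: "\<Phi> (Q - B) \<le> sum w (Q - B) * (2 * D * av Q) powr e"
    unfolding \<Phi>_def sum_distrib_right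
  proof (intro sum_mono mult_left_mono)
    fix y assume y: "y \<in> Q - B"
    have le: "w y / m y \<le> 2 * D * av Q"
    proof (cases "h = 0")
      case True
      then have "Q = {y}" using y less.prems by (auto simp: Q_def cell_def)
      then have "w y / m y = av Q" by (simp add: av_def)
      then show ?thesis using D avnn[OF QL] mult_right_mono[of 1 "2 * D" "av Q"] by simp
    next
      case False
      then have "\<not> bad y 0" using y by (auto simp: B_def)
      moreover have "cell L par 0 y = {y}" using y QL by (auto simp: cell_def)
      ultimately have "w y / m y \<le> 2 * av Q" using False by (simp add: bad_def av_def)
      also have "\<dots> \<le> 2 * D * av Q" using D avnn[OF QL] mult_right_mono[of 2 "2 * D" "av Q"] by simp
      finally show ?thesis .
    qed
    have "y \<in> L" using y QL by blast
    then have "0 \<le> w y / m y" using w[of y] m[of y] by simp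
    then show "(w y / m y) powr e \<le> (2 * D * av Q) powr e"
      using le e by (intro powr_mono2) auto
    show "0 \<le> w y" using y QL w by auto
  qed
  have badB: "\<Phi> B \<le> 2 * sum w B * (2 * D * av Q) powr e"
  proof -
    have "\<Phi> B = (\<Sum>C\<in>T ` B. \<Phi> C)" unfolding \<Phi>_def by (rule group)
    also have "\<dots> \<le> (\<Sum>C\<in>T ` B. 2 * sum w C * (2 * D * av Q) powr e)"
      using one by (intro sum_mono) auto
    also have "\<dots> = (\<Sum>C\<in>T ` B. 2 * (2 * D * av Q) powr e * sum w C)"
      by (simp add: mult_ac)
    also have "\<dots> = 2 * (2 * D * av Q) powr e * sum w B"
      by (subst group[of w]) (rule sum_distrib_left[symmetric])
    also have "\<dots> = 2 * sum w B * (2 * D * av Q) powr e" by (simp add: mult_ac)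
    finally show ?thesis .
  qed
  have "\<Phi> Q = \<Phi> (Q - B) + \<Phi> B"
    unfolding \<Phi>_def by (rule sum.subset_diff[OF BQ(1) finQ])
  also have "\<dots> \<le> (sum w (Q - B) + 2 * sum w B) * (2 * D * av Q) powr e"
    using good badB by (simp add: algebra_simps)
  also have "sum w (Q - B) = sum w Q - sum w B"
    using BQ finQ by (intro sum_diff) auto
  also have "(sum w Q - sum w B + 2 * sum w B) * (2 * D * av Q) powr e
    \<le> ((2 - \<eta>) * sum w Q) * (2 * D * av Q) powr e"
    using wB by (intro mult_right_mono) (auto simp: algebra_simps)
  also have "\<dots> = ((2 - \<eta>) * (2 * D) powr e) * (sum w Q * av Q powr e)"
    using D avnn[OF QL] by (simp add: powr_mult)
  also have "\<dots> \<le> 2 * (sum w Q * av Q powr e)"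
  proof (cases "\<eta> \<le> 2")
    case True
    have "(2 - \<eta>) * (2 * D) powr e \<le> (2 - \<eta>) * (1 + \<eta> / 2)"
      using small True by (intro mult_left_mono) auto
    also have "\<dots> \<le> 2" using zero_le_square[of \<eta>] by (simp add: algebra_simps)
    finally show ?thesis using wnn[OF QL] by (intro mult_right_mono) auto
  next
    case False
    then have "(2 - \<eta>) * (2 * D) powr e \<le> 0" by (intro mult_nonpos_nonneg) auto
    then show ?thesis using wnn[OF QL] by (intro mult_right_mono) auto
  qed
  finally show ?case by (simp add: \<Phi>_def Q_def av_def mult.assoc)
qed

section \<open>Nested partitions at finitely many scales\<close>

text \<open>A measurable choice of a nearest point in a finite set; ties are decided by the order in which the
  points are added.\<close>

lemma nearest_point_map:
  fixes X :: "'a::{metric_space, second_countable_topology} set"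
  assumes "finite X" "X \<noteq> {}"
  shows "\<exists>f. f \<in> borel_measurable borel \<and> (\<forall>x. f x \<in> X \<and> (\<forall>y\<in>X. dist x (f x) \<le> dist x y))"
  using assms
proof (induction X rule: finite_ne_induct)
  case (singleton a)
  then show ?case by (intro exI[of _ "\<lambda>_. a"]) auto
next
  case (insert a X)
  then obtain f where [measurable]: "f \<in> borel_measurable borel"
    and f: "\<And>x. f x \<in> X" "\<And>x y. y \<in> X \<Longrightarrow> dist x (f x) \<le> dist x y" by blast
  define g where "g x = (if dist x a < dist x (f x) then a else f x)" for x
  have "g \<in> borel_measurable borel" unfolding g_def by measurable
  moreover have "g x \<in> insert a X" for x using f(1) by (simp add: g_def)
  moreover have "dist x (g x) \<le> dist x y" if "y \<in> insert a X" for x y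
    using that f(2)[of y x] by (auto simp: g_def)
  ultimately show ?case by blast
qed

context doubling_measure
begin

lemma Cd_pos [simp]: "0 < Cd" "0 \<le> Cd" "Cd \<noteq> 0"
  using Cd_ge_1 by auto

lemma ball_measure_pos: "0 < r \<Longrightarrow> 0 < measure \<mu> (ball x r)"
  using ball_pos[of r x] ball_finite[of x r] by (simp add: measure_def enn2real_positive_iff)

lemma emeasure_ball: "emeasure \<mu> (ball x r) = ennreal (measure \<mu> (ball x r))"
  by (simp add: emeasure_eq_ennreal_measure)

text \<open>A separated subset of largest cardinality is a net. The cardinality is bounded because the balls
  of radius \<open>s/2\<close> about its points are disjoint and each has a definite share of the measure of a
  fixed ball.\<close>

lemma finite_separated_net:
  fixes z :: 'a
  assumes s: "0 < s" and \<rho>: "0 < \<rho>"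
  shows "\<exists>X. finite X \<and> X \<subseteq> ball z \<rho> \<and> X \<noteq> {} \<and> (\<forall>x\<in>X. \<forall>y\<in>X. x \<noteq> y \<longrightarrow> s \<le> dist x y) \<and>
    (\<forall>x\<in>ball z \<rho>. \<exists>y\<in>X. dist x y < s)"
proof -
  define P where "P X \<longleftrightarrow> finite X \<and> X \<subseteq> ball z \<rho> \<and> (\<forall>x\<in>X. \<forall>y\<in>X. x \<noteq> y \<longrightarrow> s \<le> dist x y)" for X
  obtain n :: nat where n: "(2 * \<rho> + s) / (s / 2) < 2 ^ n"
    using real_arch_pow[of 2 "(2 * \<rho> + s) / (s / 2)"] by auto
  then have n': "2 * \<rho> + s \<le> 2 ^ n * (s / 2)" using s by (simp add: field_simps)
  define M where "M = measure \<mu> (ball z (\<rho> + s))"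
  have M: "0 < M" "emeasure \<mu> (ball z (\<rho> + s)) = ennreal M"
    unfolding M_def using ball_measure_pos[of "\<rho> + s" z] s \<rho> by (auto simp: emeasure_ball)
  have bound: "real (card X) \<le> Cd ^ n" if X: "P X" for X
  proof -
    have disj: "disjoint_family_on (\<lambda>x. ball x (s / 2)) X"
      unfolding disjoint_family_on_def
    proof (intro ballI impI)
      fix x y assume xy: "x \<in> X" "y \<in> X" "x \<noteq> y"
      then have d: "s \<le> dist x y" using X by (auto simp: P_def)
      show "ball x (s / 2) \<inter> ball y (s / 2) = {}"
      proof (rule ccontr)
        assume "ball x (s / 2) \<inter> ball y (s / 2) \<noteq> {}"
        then obtain u where "u \<in> ball x (s / 2)" "u \<in> ball y (s / 2)" by blast
        then show False using d dist_triangle2[of x y u] by simp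
      qed
    qed
    have "ennreal (real (card X) * M) = (\<Sum>x\<in>X. ennreal M)"
      using M by (simp add: ennreal_mult ennreal_of_nat_eq_real_of_nat)
    also have "\<dots> \<le> (\<Sum>x\<in>X. ennreal (Cd ^ n) * emeasure \<mu> (ball x (s / 2)))"
    proof (rule sum_mono)
      fix x assume "x \<in> X"
      then have "dist z x < \<rho>" using X by (auto simp: P_def)
      then show "ennreal M \<le> ennreal (Cd ^ n) * emeasure \<mu> (ball x (s / 2))"
        unfolding M(2)[symmetric] using s n' by (intro ball_compare) auto
    qed
    also have "\<dots> = ennreal (Cd ^ n) * emeasure \<mu> (\<Union>x\<in>X. ball x (s / 2))"
      using disj X by (subst sum_emeasure[symmetric]) (auto simp: P_def sum_distrib_left)
    also have "\<dots> \<le> ennreal (Cd ^ n) * emeasure \<mu> (ball z (\<rho> + s))"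
    proof (intro mult_left_mono emeasure_mono UN_least)
      fix x assume "x \<in> X"
      then have x: "dist z x < \<rho>" using X by (auto simp: P_def)
      show "ball x (s / 2) \<subseteq> ball z (\<rho> + s)"
      proof
        fix u assume "u \<in> ball x (s / 2)"
        then have "dist x u < s / 2" by simp
        then show "u \<in> ball z (\<rho> + s)" using x s dist_triangle[of z u x] by simp
      qed
    qed auto
    also have "\<dots> = ennreal (Cd ^ n * M)" using M Cd_ge_1 by (simp add: ennreal_mult)
    finally have "real (card X) * M \<le> Cd ^ n * M"
      using M Cd_ge_1 by (simp add: ennreal_le_iff)
    then show ?thesis using M by simp
  qed
  have bd: "\<forall>X. P X \<longrightarrow> card X < Suc (nat \<lceil>Cd ^ n\<rceil>)"
  proof (intro allI impI)
    fix X assume "P X"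
    then have "real (card X) \<le> Cd ^ n" by (rule bound)
    then show "card X < Suc (nat \<lceil>Cd ^ n\<rceil>)" by linarith
  qed
  have "P {z}" using \<rho> by (simp add: P_def)
  from ex_has_greatest_nat[OF this bd] obtain X where X: "P X" "\<And>Y. P Y \<Longrightarrow> card Y \<le> card X" by auto
  have fX: "finite X" using X(1) by (simp add: P_def)
  have "\<exists>y\<in>X. dist x y < s" if x: "x \<in> ball z \<rho>" for x
  proof (rule ccontr)
    assume "\<not> (\<exists>y\<in>X. dist x y < s)"
    then have far: "\<And>y. y \<in> X \<Longrightarrow> s \<le> dist x y" by force
    have "x \<notin> X" using far[of x] s by auto
    moreover have "P (insert x X)"
      using X(1) x far by (auto simp: P_def dist_commute)
    ultimately show False using X(2)[of "insert x X"] fX by simp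
  qed
  moreover have "X \<noteq> {}" using X(2)[OF \<open>P {z}\<close>] by auto
  ultimately show ?thesis using X(1) by (auto simp: P_def)
qed

text \<open>The \<open>A\<^sub>q\<close> condition tested on indicator functions, \<open>(\<mu>(A)/\<mu>(B))^q \<le> L w(A)/w(B)\<close> for
  \<open>A \<subseteq> B\<close>, multiplied out so that no quotient occurs, together with integrability on balls. It is
  what the comparison of \<open>|P(x) e|\<close> with \<open>|P(y) e|\<close> gives directly, and all that the reverse Hoelder
  inequality needs.\<close>

definition muckenhoupt :: "real \<Rightarrow> real \<Rightarrow> ('a \<Rightarrow> ennreal) \<Rightarrow> bool"
  where "muckenhoupt q L w \<longleftrightarrow> w \<in> borel_measurable \<mu> \<and>
    (\<forall>x r. (\<integral>\<^sup>+y\<in>ball x r. w y \<partial>\<mu>) < \<top>) \<and>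
    (\<forall>x r A. 0 < r \<longrightarrow> A \<in> sets \<mu> \<longrightarrow> A \<subseteq> ball x r \<longrightarrow>
      (\<integral>\<^sup>+y\<in>ball x r. w y \<partial>\<mu>) * emeasure \<mu> A powe q
        \<le> ennreal L * emeasure \<mu> (ball x r) powe q * (\<integral>\<^sup>+y\<in>A. w y \<partial>\<mu>))"

text \<open>The reverse Hoelder inequality for the conditional expectation of \<open>w\<close> onto a partition of mesh
  \<open>2 R / 8^N\<close>; the fibres of \<open>f\<close> are the cells. The radius \<open>s h = R 8^h / 8^N\<close> belongs to height \<open>h\<close>, a
  node of height \<open>h\<close> is a point of an \<open>s h\<close>-separated net, and its parent is a nearest point of the
  next coarser net. A cell of height \<open>h\<close> lies between the balls of radius \<open>s h / 4\<close> and \<open>2 s h\<close> about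
  its node, so that the doubling and \<open>A\<^sub>q\<close> conditions carry over from balls to cells with constants
  independent of \<open>N\<close>. The larger ball \<open>G\<close> appears on the right because the cells of height \<open>N\<close>
  that meet \<open>ball z R\<close> need not be contained in it.\<close>

lemma discrete_reverse_holder:
  fixes z :: 'a and R e q L :: real
  assumes w: "muckenhoupt q L w" and L: "1 \<le> L" and q: "1 \<le> q" and R: "0 < R"
    and e: "0 \<le> e" "(2 * Cd ^ 7) powr e \<le> 1 + 1 / (2 * Cd ^ 3) powr q / L / 2"
  defines "G \<equiv> ball z (16 * R)"
  shows "\<exists>f. f \<in> borel_measurable borel \<and> finite (range f) \<and> (\<forall>x\<in>G. dist x (f x) \<le> R / 8 ^ N) \<and>
    (\<integral>\<^sup>+x\<in>ball z R. ((\<integral>\<^sup>+y\<in>{y\<in>G. f y = f x}. w y \<partial>\<mu>) / emeasure \<mu> {y\<in>G. f y = f x}) powe (1 + e) \<partial>\<mu>)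
      \<le> 4 * ((\<integral>\<^sup>+y\<in>G. w y \<partial>\<mu>) * average \<mu> G w powe e)"
proof -
  define s where "s h = R * 8 ^ h / 8 ^ N" for h :: nat
  have s_pos: "0 < s h" for h using R by (simp add: s_def)
  have s_Suc: "s (Suc h) = 8 * s h" for h by (simp add: s_def)
  have s_N: "s N = R" by (simp add: s_def)
  have s_le: "s h \<le> R" if "h \<le> N" for h
    using that R unfolding s_def by (simp add: field_simps power_increasing)
  have "\<forall>h. \<exists>X. finite X \<and> X \<subseteq> G \<and> X \<noteq> {} \<and> (\<forall>x\<in>X. \<forall>y\<in>X. x \<noteq> y \<longrightarrow> s h \<le> dist x y) \<and>
    (\<forall>x\<in>G. \<exists>y\<in>X. dist x y < s h)"
    unfolding G_def using R s_pos by (intro allI finite_separated_net) auto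
  then obtain X where X: "\<And>h. finite (X h)" "\<And>h. X h \<subseteq> G" "\<And>h. X h \<noteq> {}"
    "\<And>h x y. x \<in> X h \<Longrightarrow> y \<in> X h \<Longrightarrow> x \<noteq> y \<Longrightarrow> s h \<le> dist x y"
    "\<And>h x. x \<in> G \<Longrightarrow> \<exists>y\<in>X h. dist x y < s h"
    by metis
  have "\<forall>h. \<exists>f. f \<in> borel_measurable borel \<and> (\<forall>x. f x \<in> X h \<and> (\<forall>y\<in>X h. dist x (f x) \<le> dist x y))"
    using X by (intro allI nearest_point_map) auto
  then obtain f where fm [measurable]: "\<And>h. f h \<in> borel_measurable borel"
    and f: "\<And>h x. f h x \<in> X h" "\<And>h x y. y \<in> X h \<Longrightarrow> dist x (f h x) \<le> dist x y"
    by metis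
  have f_near: "dist x (f h x) < s h" if x: "x \<in> G" for x h
  proof -
    obtain y where "y \<in> X h" "dist x y < s h" using X(5)[OF x] by blast
    then show ?thesis using f(2)[of y h x] by linarith
  qed
  have f_eq: "f h x = y" if "y \<in> X h" "dist x y < s h / 2" for h x y
  proof (rule ccontr)
    assume "f h x \<noteq> y"
    then have "s h \<le> dist y (f h x)" using X(4)[of y h "f h x"] that f(1) by auto
    then show False using f(2)[OF that(1), of x] that(2) dist_triangle[of y "f h x" x]
      by (simp add: dist_commute)
  qed
  \<comment> \<open>The node of height \<open>h\<close> to which \<open>x\<close> belongs. The distances along the chain of ancestors form a geometric
    series with ratio 1/8, whence the factor 8/7.\<close>
  define an where "an h x = ancestor f h (f 0 x)" for h x
  have an_Suc: "an (Suc h) x = f (Suc h) (an h x)" for h x by (simp add: an_def)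
  have an_X: "an h x \<in> X h" for h x by (cases h) (auto simp: an_def f)
  have an_G: "an h x \<in> G" for h x using an_X X(2) by blast
  have an_dist: "dist x (an h x) \<le> 8 / 7 * s h" if x: "x \<in> G" for h x
  proof (induction h)
    case 0
    then show ?case using f_near[OF x, of 0] s_pos[of 0] by (simp add: an_def)
  next
    case (Suc h)
    have "dist (an h x) (an (Suc h) x) < s (Suc h)"
      unfolding an_Suc by (rule f_near[OF an_G])
    then show ?case using Suc dist_triangle[of x "an (Suc h) x" "an h x"] s_Suc[of h] by simp
  qed
  \<comment> \<open>Since \<open>8/7 s(h-1) = s h / 7\<close> and \<open>1/7 + 1/4 < 1/2\<close>, the node of height \<open>h - 1\<close> of a point near \<open>\<alpha>\<close> is
    closer to \<open>\<alpha>\<close> than to any other point of the \<open>s h\<close>-separated net.\<close>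
  have an_inner: "an h x = \<alpha>" if "x \<in> G" "\<alpha> \<in> X h" "dist \<alpha> x < s h / 4" for h x \<alpha>
  proof (cases h)
    case 0
    then show ?thesis using that s_pos[of 0] by (auto simp: an_def dist_commute intro!: f_eq)
  next
    case (Suc k)
    have "dist (an k x) \<alpha> \<le> dist x (an k x) + dist \<alpha> x"
      using dist_triangle[of "an k x" \<alpha> x] by (simp add: dist_commute)
    also have "\<dots> < 8 / 7 * s k + s h / 4" using an_dist[OF that(1), of k] that(3) by simp
    also have "\<dots> \<le> s h / 2" using Suc s_Suc[of k] s_pos[of k] by simp
    finally show ?thesis unfolding Suc an_Suc using that(2) Suc by (intro f_eq) auto
  qed
  have f0_id: "f 0 l = l" if "l \<in> X 0" for l
    using that s_pos[of 0] by (intro f_eq) auto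
  \<comment> \<open>Only leaves whose node of height \<open>N\<close> lies within \<open>4 R\<close> of \<open>z\<close> are kept: these include the nodes of all
    points of \<open>ball z R\<close>, and the inner balls of their cells stay in \<open>G = ball z (16 R)\<close>.\<close>
  define \<Lambda> where "\<Lambda> = {l\<in>X 0. dist (ancestor f N l) z < 4 * R}"
  have finL: "finite \<Lambda>" using X(1) by (simp add: \<Lambda>_def)
  define V where "V A = {x\<in>G. f 0 x \<in> A}" for A
  have V_set: "V A \<in> sets \<mu>" if "finite A" for A
  proof -
    have "V A = G \<inter> (f 0 -` A \<inter> space borel)" by (auto simp: V_def)
    also have "\<dots> \<in> sets borel"
      using that fm[of 0] by (intro sets.Int measurable_sets[of _ borel borel]) (auto simp: G_def finite_imp_closed)
    finally show ?thesis by simp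
  qed
  have V_borel: "V A \<in> sets borel" if "finite A" for A
    using V_set[OF that] by simp
  have GV: "V A \<subseteq> G" for A by (auto simp: V_def)
  have emG: "emeasure \<mu> G < \<top>" unfolding G_def by (rule ball_finite)
  have emV: "emeasure \<mu> (V A) = ennreal (measure \<mu> (V A))" for A
    using subset_ball_finite[OF GV[of A, unfolded G_def]] by (simp add: emeasure_eq_ennreal_measure)
  define W where "W S = enn2real (\<integral>\<^sup>+y\<in>S. w y \<partial>\<mu>)" for S
  have wm [measurable]: "w \<in> borel_measurable \<mu>" using w by (simp add: muckenhoupt_def)
  have W: "(\<integral>\<^sup>+y\<in>S. w y \<partial>\<mu>) = ennreal (W S)" if "S \<subseteq> ball c r" for S c r
  proof -
    have "(\<integral>\<^sup>+y\<in>S. w y \<partial>\<mu>) \<le> (\<integral>\<^sup>+y\<in>ball c r. w y \<partial>\<mu>)"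
      using that by (intro nn_integral_mono mult_left_mono) (auto simp: indicator_def)
    also have "\<dots> < \<top>" using w by (simp add: muckenhoupt_def)
    finally show ?thesis by (simp add: W_def)
  qed
  have WV: "(\<integral>\<^sup>+y\<in>V A. w y \<partial>\<mu>) = ennreal (W (V A))" for A
    using GV W unfolding G_def by blast
  have Wnn: "0 \<le> W S" for S by (simp add: W_def)
  define m where "m l = measure \<mu> (V {l})" for l
  define ww where "ww l = W (V {l})" for l
  have V_UN: "V A = (\<Union>l\<in>A. V {l})" for A by (auto simp: V_def)
  have V_disj: "disjoint_family_on (\<lambda>l. V {l}) A" for A by (auto simp: disjoint_family_on_def V_def)
  have sum_m: "sum m A = measure \<mu> (V A)" if "finite A" for A
  proof -
    have "ennreal (sum m A) = (\<Sum>l\<in>A. emeasure \<mu> (V {l}))"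
      unfolding emV m_def by (rule sum_ennreal[symmetric]) simp
    also have "\<dots> = emeasure \<mu> (V A)"
      unfolding V_UN[of A] using that V_disj by (intro sum_emeasure) (auto simp: V_borel)
    finally show ?thesis unfolding emV by (simp add: m_def sum_nonneg)
  qed
  have sum_w: "sum ww A = W (V A)" if "finite A" for A
  proof -
    have "ennreal (sum ww A) = (\<Sum>l\<in>A. \<integral>\<^sup>+y\<in>V {l}. w y \<partial>\<mu>)"
      unfolding WV ww_def by (rule sum_ennreal[symmetric]) (simp add: Wnn)
    also have "\<dots> = (\<integral>\<^sup>+y. (\<Sum>l\<in>A. w y * indicator (V {l}) y) \<partial>\<mu>)"
      by (intro nn_integral_sum[symmetric] borel_measurable_times_ennreal borel_measurable_indicator) (auto simp: V_borel)
    also have "\<dots> = (\<integral>\<^sup>+y\<in>V A. w y \<partial>\<mu>)"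
      unfolding V_UN[of A] using that V_disj
      by (intro nn_integral_cong) (simp add: indicator_UN_disjoint sum_distrib_left)
    finally show ?thesis unfolding WV by (simp add: ww_def sum_nonneg Wnn)
  qed
  have LG: "l \<in> G" if "l \<in> \<Lambda>" for l using that X(2) by (auto simp: \<Lambda>_def)
  have an_leaf: "an h l = ancestor f h l" if "l \<in> \<Lambda>" for h l
    using that by (simp add: an_def f0_id \<Lambda>_def)
  have cell_V: "V (cell \<Lambda> f h l) = {x\<in>G. an h x = an h l}" if l: "l \<in> \<Lambda>" and h: "h \<le> N" for h l
  proof -
    have "f 0 x \<in> \<Lambda>" if "x \<in> G" "an h x = an h l" for x
    proof -
      have "ancestor f N (f 0 x) = ancestor f N l"
        using that(2) l h ancestor_eq_mono[of f h "f 0 x" l N] an_leaf[OF l] by (simp add: an_def)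
      then show ?thesis using l f(1) by (simp add: \<Lambda>_def)
    qed
    then show ?thesis using an_leaf[OF l, of h] by (auto simp: V_def cell_def an_def)
  qed
  have cellfin: "finite (cell \<Lambda> f h l)" for h l using finL by (simp add: cell_def)
  have outer: "V (cell \<Lambda> f h l) \<subseteq> ball (an h l) (2 * s h)" if l: "l \<in> \<Lambda>" and h: "h \<le> N" for h l
  proof
    fix x assume "x \<in> V (cell \<Lambda> f h l)"
    then have "x \<in> G" "an h x = an h l" using cell_V[OF l h] by auto
    then show "x \<in> ball (an h l) (2 * s h)" using an_dist[of x h] s_pos[of h] by (simp add: dist_commute)
  qed
  have inner: "ball (an h l) (s h / 4) \<subseteq> V (cell \<Lambda> f h l)" if l: "l \<in> \<Lambda>" and h: "h \<le> N" for h l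
  proof
    fix x assume "x \<in> ball (an h l) (s h / 4)"
    then have x: "dist (an h l) x < s h / 4" by simp
    have "dist l (an h l) \<le> 8 / 7 * R" using an_dist[OF LG[OF l], of h] s_le[OF h] by simp
    moreover have "dist l (an N l) \<le> 8 / 7 * R" using an_dist[OF LG[OF l], of N] s_N by simp
    moreover have "dist (an N l) z < 4 * R" using l an_leaf[OF l] by (simp add: \<Lambda>_def)
    moreover have "dist z x \<le> dist (an N l) z + dist l (an N l) + dist l (an h l) + dist (an h l) x"
      using dist_triangle[of z x "an h l"] dist_triangle[of z "an h l" l] dist_triangle[of z l "an N l"]
      by (simp add: dist_commute)
    ultimately have "x \<in> G" using x s_le[OF h] R by (simp add: G_def)
    have "an h x = an h l" by (rule an_inner[OF \<open>x \<in> G\<close> an_X x])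
    then show "x \<in> V (cell \<Lambda> f h l)" using \<open>x \<in> G\<close> cell_V[OF l h] by simp
  qed
  have inner_em: "emeasure \<mu> (ball (an h l) (s h / 4)) \<le> ennreal (sum m (cell \<Lambda> f h l))"
    if l: "l \<in> \<Lambda>" and h: "h \<le> N" for h l
    unfolding sum_m[OF cellfin] emV[symmetric]
    by (rule emeasure_mono[OF inner[OF l h] V_set[OF cellfin]])
  have D1: "1 \<le> Cd ^ 7" "1 \<le> Cd ^ 3" using Cd_ge_1 by (auto simp: one_le_power)
  have mpos: "0 < sum m (cell \<Lambda> f h l)" if l: "l \<in> \<Lambda>" and h: "h \<le> N" for h l
    using less_le_trans[OF ball_pos inner_em[OF l h]] s_pos[of h] by simp
  have parent: "sum m (cell \<Lambda> f (Suc h) l) \<le> Cd ^ 7 * sum m (cell \<Lambda> f h l)" if l: "l \<in> \<Lambda>" and h: "h < N" for h l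
  proof -
    have "ennreal (sum m (cell \<Lambda> f (Suc h) l)) \<le> emeasure \<mu> (ball (an (Suc h) l) (2 * s (Suc h)))"
      unfolding sum_m[OF cellfin] emV[symmetric]
      using outer[OF l, of "Suc h"] h by (intro emeasure_mono) auto
    also have "\<dots> \<le> ennreal (Cd ^ 7) * emeasure \<mu> (ball (an h l) (s h / 4))"
    proof (rule ball_compare)
      have "dist (an h l) (an (Suc h) l) < s (Suc h)" unfolding an_Suc by (rule f_near[OF an_G])
      then show "dist (an (Suc h) l) (an h l) + 2 * s (Suc h) \<le> 2 ^ 7 * (s h / 4)"
        using s_Suc[of h] s_pos[of h] by (simp add: dist_commute)
    qed (use s_pos in simp)
    also have "\<dots> \<le> ennreal (Cd ^ 7) * ennreal (sum m (cell \<Lambda> f h l))"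
      using inner_em[OF l, of h] h by (intro mult_left_mono) auto
    also have "\<dots> = ennreal (Cd ^ 7 * sum m (cell \<Lambda> f h l))"
      using D1 by (simp add: ennreal_mult m_def sum_nonneg)
    finally show ?thesis
      using D1 by (subst (asm) ennreal_le_iff) (auto simp: m_def sum_nonneg)
  qed
  define \<eta> where "\<eta> = 1 / (2 * Cd ^ 3) powr q / L"
  have \<eta>: "0 \<le> \<eta>" using L by (simp add: \<eta>_def)
  have ainf: "\<eta> * sum ww (cell \<Lambda> f h l) \<le> sum ww A"
    if l: "l \<in> \<Lambda>" and h: "h \<le> N" and A: "A \<subseteq> cell \<Lambda> f h l" and big: "sum m (cell \<Lambda> f h l) \<le> 2 * sum m A" for h l A
  proof -
    let ?Q = "cell \<Lambda> f h l" and ?B = "ball (an h l) (2 * s h)"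
    have fA: "finite A" using A cellfin finite_subset by blast
    have mA: "0 < sum m A" using big mpos[OF l h] by simp
    have VA: "V A \<subseteq> ?B" using outer[OF l h] A by (auto simp: V_def)
    have "emeasure \<mu> ?B \<le> ennreal (Cd ^ 3) * emeasure \<mu> (ball (an h l) (s h / 4))"
      using s_pos[of h] by (intro ball_compare) auto
    also have "\<dots> \<le> ennreal (Cd ^ 3) * ennreal (sum m ?Q)"
      by (intro mult_left_mono inner_em l h) simp
    also have "\<dots> \<le> ennreal (Cd ^ 3) * ennreal (2 * sum m A)"
      using big by (intro mult_left_mono ennreal_leI) auto
    also have "\<dots> = ennreal (2 * Cd ^ 3 * sum m A)"
      using D1 mA by (subst ennreal_mult[symmetric]) (simp_all add: mult_ac)
    finally have B: "emeasure \<mu> ?B \<le> ennreal (2 * Cd ^ 3 * sum m A)" .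
    have "ennreal (W ?B * sum m A powr q) = (\<integral>\<^sup>+y\<in>?B. w y \<partial>\<mu>) * emeasure \<mu> (V A) powe q"
      unfolding emV sum_m[OF fA, symmetric] using mA
      by (simp add: ennreal_powr_ennreal ennreal_mult Wnn W[OF order_refl])
    also have "\<dots> \<le> ennreal L * emeasure \<mu> ?B powe q * (\<integral>\<^sup>+y\<in>V A. w y \<partial>\<mu>)"
      using w s_pos[of h] VA V_set[OF fA] by (simp add: muckenhoupt_def)
    also have "\<dots> \<le> ennreal L * ennreal (2 * Cd ^ 3 * sum m A) powe q * (\<integral>\<^sup>+y\<in>V A. w y \<partial>\<mu>)"
      using q by (intro mult_right_mono mult_left_mono powe_mono B) auto
    also have "ennreal (2 * Cd ^ 3 * sum m A) powe q = ennreal ((2 * Cd ^ 3 * sum m A) powr q)"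
      using mA by (intro ennreal_powr_ennreal) simp
    also have "ennreal L * ennreal ((2 * Cd ^ 3 * sum m A) powr q) * (\<integral>\<^sup>+y\<in>V A. w y \<partial>\<mu>)
        = ennreal (L * (2 * Cd ^ 3 * sum m A) powr q * sum ww A)"
      unfolding WV sum_w[OF fA] using L by (simp add: ennreal_mult Wnn)
    finally have "W ?B * sum m A powr q \<le> L * (2 * Cd ^ 3 * sum m A) powr q * sum ww A"
      using L Wnn by (subst (asm) ennreal_le_iff) (auto simp: ww_def sum_nonneg)
    also have "\<dots> = (L * (2 * Cd ^ 3) powr q * sum ww A) * sum m A powr q"
      using D1 mA by (simp add: powr_mult)
    finally have "W ?B \<le> L * (2 * Cd ^ 3) powr q * sum ww A" using mA by simp
    moreover have "sum ww ?Q \<le> W ?B"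
    proof -
      have "ennreal (sum ww ?Q) \<le> (\<integral>\<^sup>+y\<in>?B. w y \<partial>\<mu>)"
        unfolding sum_w[OF cellfin] WV[symmetric] using outer[OF l h]
        by (intro nn_integral_mono mult_left_mono) (auto simp: indicator_def)
      then show ?thesis unfolding W[OF order_refl] by (simp add: Wnn)
    qed
    ultimately have "sum ww ?Q \<le> L * (2 * Cd ^ 3) powr q * sum ww A" by simp
    moreover have "0 < L * (2 * Cd ^ 3) powr q" using L by (intro mult_pos_pos) auto
    ultimately show ?thesis unfolding \<eta>_def by (simp add: field_simps)
  qed
  have tree: "(\<Sum>y\<in>cell \<Lambda> f N l. ww y * (ww y / m y) powr e)
      \<le> 2 * sum ww (cell \<Lambda> f N l) * (sum ww (cell \<Lambda> f N l) / sum m (cell \<Lambda> f N l)) powr e" if l: "l \<in> \<Lambda>" for l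
  proof (rule tree_reverse_holder[where N = N and \<eta> = \<eta> and D = "Cd ^ 7"])
    show "0 < m x" if "x \<in> \<Lambda>" for x
    proof -
      have "cell \<Lambda> f 0 x = {x}" using that by (auto simp: cell_def)
      then show ?thesis using mpos[OF that, of 0] by simp
    qed
  qed (use finL Wnn parent ainf \<eta> e D1 l in \<open>auto simp: ww_def \<eta>_def\<close>)
  have m0: "0 < m l" if "l \<in> \<Lambda>" for l
  proof -
    have "cell \<Lambda> f 0 l = {l}" using that by (auto simp: cell_def)
    then show ?thesis using mpos[OF that, of 0] by simp
  qed
  define av where "av = W G / measure \<mu> G"
  have G0: "0 < measure \<mu> G" "emeasure \<mu> G = ennreal (measure \<mu> G)"
    using ball_measure_pos[of "16 * R" z] R by (auto simp: G_def emeasure_ball)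
  have WG: "(\<integral>\<^sup>+y\<in>G. w y \<partial>\<mu>) = ennreal (W G)" using W[of G z "16 * R"] by (simp add: G_def)
  have avG: "average \<mu> G w = ennreal av"
    unfolding average_def WG av_def G0(2) using G0 Wnn by (simp add: divide_ennreal)
  have av0: "0 \<le> av" using G0 Wnn by (simp add: av_def)
  \<comment> \<open>A cell of height \<open>N\<close> has average at most \<open>Cd^7\<close> times that of \<open>G\<close>; with the constant 2 of the tree
    inequality this gives the factor 4.\<close>
  have D2: "(Cd ^ 7) powr e \<le> 2"
  proof -
    have "(Cd ^ 7) powr e \<le> (2 * Cd ^ 7) powr e" using D1 e by (intro powr_mono2) auto
    also have "\<dots> \<le> 1 + \<eta> / 2" using e by (simp add: \<eta>_def)
    also have "\<dots> \<le> 2"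
    proof -
      have "1 \<le> (2 * Cd ^ 3) powr q" using D1 q by (intro ge_one_powr_ge_zero) auto
      then have "1 \<le> (2 * Cd ^ 3) powr q * L" using L mult_mono[of 1 "(2 * Cd ^ 3) powr q" 1 L] by simp
      then show ?thesis by (simp add: \<eta>_def)
    qed
    finally show ?thesis .
  qed
  have total: "(\<Sum>y\<in>\<Lambda>. ww y * (ww y / m y) powr e) \<le> 4 * (W G * av powr e)"
  proof -
    define TC where "TC l = cell \<Lambda> f N l" for l
    have fib: "{u\<in>\<Lambda>. TC u = C} = C" if "C \<in> TC ` \<Lambda>" for C
    proof -
      from that obtain l where "l \<in> \<Lambda>" "C = TC l" by blast
      then show ?thesis by (auto simp: TC_def cell_def)
    qed
    have grp: "sum g \<Lambda> = (\<Sum>C\<in>TC ` \<Lambda>. sum g C)" for g :: "'a \<Rightarrow> real"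
    proof -
      have "sum g \<Lambda> = (\<Sum>C\<in>TC ` \<Lambda>. sum g {u\<in>\<Lambda>. TC u = C})" by (rule sum.image_gen[OF finL])
      also have "\<dots> = (\<Sum>C\<in>TC ` \<Lambda>. sum g C)" using fib by (intro sum.cong) auto
      finally show ?thesis .
    qed
    have "(\<Sum>y\<in>\<Lambda>. ww y * (ww y / m y) powr e) = (\<Sum>C\<in>TC ` \<Lambda>. \<Sum>y\<in>C. ww y * (ww y / m y) powr e)"
      by (rule grp)
    also have "\<dots> \<le> (\<Sum>C\<in>TC ` \<Lambda>. 4 * av powr e * sum ww C)"
    proof (rule sum_mono)
      fix C assume "C \<in> TC ` \<Lambda>"
      then obtain l where l: "l \<in> \<Lambda>" "C = cell \<Lambda> f N l" by (auto simp: TC_def)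
      have fC: "finite C" using l(2) cellfin by simp
      have mC: "0 < sum m C" using mpos[OF l(1), of N] l(2) by simp
      have wC: "0 \<le> sum ww C" by (simp add: ww_def sum_nonneg Wnn)
      have "ennreal (measure \<mu> G) \<le> ennreal (Cd ^ 7) * emeasure \<mu> (ball (an N l) (s N / 4))"
        unfolding G0(2)[symmetric] unfolding G_def
      proof (rule ball_compare)
        have "dist (an N l) z < 4 * R" using l(1) an_leaf by (simp add: \<Lambda>_def)
        then show "dist z (an N l) + 16 * R \<le> 2 ^ 7 * (s N / 4)" using s_N R by (simp add: dist_commute)
      qed (use s_pos in simp)
      also have "\<dots> \<le> ennreal (Cd ^ 7) * ennreal (sum m C)"
        unfolding l(2) by (intro mult_left_mono inner_em l) auto
      also have "\<dots> = ennreal (Cd ^ 7 * sum m C)" using D1 mC by (simp add: ennreal_mult)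
      finally have mG: "measure \<mu> G \<le> Cd ^ 7 * sum m C"
        using D1 mC by (subst (asm) ennreal_le_iff) auto
      have "ennreal (sum ww C) \<le> (\<integral>\<^sup>+y\<in>G. w y \<partial>\<mu>)"
        unfolding sum_w[OF fC] WV[symmetric] using GV[of C]
        by (intro nn_integral_mono mult_left_mono) (auto simp: indicator_def)
      then have wG: "sum ww C \<le> W G" unfolding WG by (simp add: Wnn)
      have "sum ww C * measure \<mu> G \<le> W G * (Cd ^ 7 * sum m C)"
        using wG mG Wnn by (intro mult_mono) auto
      then have "sum ww C / sum m C \<le> Cd ^ 7 * av"
        using mC G0 by (simp add: av_def field_simps)
      then have "(sum ww C / sum m C) powr e \<le> (Cd ^ 7 * av) powr e"
        using wC mC e by (intro powr_mono2) auto
      also have "\<dots> \<le> 2 * av powr e"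
        using D1 D2 av0 by (simp add: powr_mult mult_right_mono)
      finally have "2 * sum ww C * (sum ww C / sum m C) powr e \<le> 2 * sum ww C * (2 * av powr e)"
        using wC by (intro mult_left_mono) auto
      then show "(\<Sum>y\<in>C. ww y * (ww y / m y) powr e) \<le> 4 * av powr e * sum ww C"
        using tree[OF l(1)] l(2) by (simp add: mult_ac)
    qed
    also have "\<dots> = 4 * av powr e * (\<Sum>C\<in>TC ` \<Lambda>. sum ww C)" by (rule sum_distrib_left[symmetric])
    also have "(\<Sum>C\<in>TC ` \<Lambda>. sum ww C) = sum ww \<Lambda>" by (rule grp[symmetric])
    also have "4 * av powr e * sum ww \<Lambda> \<le> 4 * av powr e * W G"
    proof (rule mult_left_mono)
      have "ennreal (sum ww \<Lambda>) \<le> (\<integral>\<^sup>+y\<in>G. w y \<partial>\<mu>)"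
        unfolding sum_w[OF finL] WV[symmetric] using GV[of \<Lambda>]
        by (intro nn_integral_mono mult_left_mono) (auto simp: indicator_def)
      then show "sum ww \<Lambda> \<le> W G" unfolding WG by (simp add: Wnn)
    qed simp
    finally show ?thesis by (simp add: mult_ac)
  qed
  have B0: "f 0 x \<in> \<Lambda>" if "x \<in> ball z R" for x
  proof -
    have xG: "x \<in> G" using that R by (simp add: G_def)
    have "dist x (an N x) \<le> 8 / 7 * R" using an_dist[OF xG, of N] s_N by simp
    then have "dist (an N x) z < 4 * R"
      using that R dist_triangle[of "an N x" z x] by (simp add: dist_commute)
    then show ?thesis using f(1) by (simp add: \<Lambda>_def an_def)
  qed
  have ptw: "((\<integral>\<^sup>+y\<in>V {l}. w y \<partial>\<mu>) / emeasure \<mu> (V {l})) powe (1 + e) = ennreal ((ww l / m l) powr (1 + e))"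
    if "l \<in> \<Lambda>" for l
    unfolding WV emV ww_def[symmetric] m_def[symmetric] using m0[OF that] Wnn
    by (simp add: divide_ennreal ww_def ennreal_powr_ennreal)
  have "(\<integral>\<^sup>+x\<in>ball z R. ((\<integral>\<^sup>+y\<in>{y\<in>G. f 0 y = f 0 x}. w y \<partial>\<mu>) / emeasure \<mu> {y\<in>G. f 0 y = f 0 x}) powe (1 + e) \<partial>\<mu>)
    \<le> (\<integral>\<^sup>+x. (\<Sum>l\<in>\<Lambda>. ennreal ((ww l / m l) powr (1 + e)) * indicator (V {l}) x) \<partial>\<mu>)"
  proof (rule nn_integral_mono)
    fix x
    show "((\<integral>\<^sup>+y\<in>{y\<in>G. f 0 y = f 0 x}. w y \<partial>\<mu>) / emeasure \<mu> {y\<in>G. f 0 y = f 0 x}) powe (1 + e) * indicator (ball z R) x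
      \<le> (\<Sum>l\<in>\<Lambda>. ennreal ((ww l / m l) powr (1 + e)) * indicator (V {l}) x)"
    proof (cases "x \<in> ball z R")
      case True
      have xG: "x \<in> G" using True R by (simp add: G_def)
      have "{y\<in>G. f 0 y = f 0 x} = V {f 0 x}" by (auto simp: V_def)
      then have "((\<integral>\<^sup>+y\<in>{y\<in>G. f 0 y = f 0 x}. w y \<partial>\<mu>) / emeasure \<mu> {y\<in>G. f 0 y = f 0 x}) powe (1 + e) * indicator (ball z R) x
        = ennreal ((ww (f 0 x) / m (f 0 x)) powr (1 + e)) * indicator (V {f 0 x}) x"
        using ptw[OF B0[OF True]] True xG by (simp add: V_def)
      also have "\<dots> \<le> (\<Sum>l\<in>\<Lambda>. ennreal ((ww l / m l) powr (1 + e)) * indicator (V {l}) x)"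
        using finL B0[OF True] by (intro member_le_sum) auto
      finally show ?thesis .
    qed simp
  qed
  also have "\<dots> = (\<Sum>l\<in>\<Lambda>. ennreal ((ww l / m l) powr (1 + e)) * emeasure \<mu> (V {l}))"
  proof (subst nn_integral_sum)
    show "(\<lambda>x. ennreal ((ww l / m l) powr (1 + e)) * indicator (V {l}) x) \<in> borel_measurable \<mu>" for l
      by (intro borel_measurable_times_ennreal borel_measurable_indicator borel_measurable_const V_set) simp
    show "(\<Sum>l\<in>\<Lambda>. \<integral>\<^sup>+x. ennreal ((ww l / m l) powr (1 + e)) * indicator (V {l}) x \<partial>\<mu>)
      = (\<Sum>l\<in>\<Lambda>. ennreal ((ww l / m l) powr (1 + e)) * emeasure \<mu> (V {l}))"
      by (intro sum.cong refl nn_integral_cmult_indicator V_set) simp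
  qed
  also have "\<dots> = (\<Sum>l\<in>\<Lambda>. ennreal (ww l * (ww l / m l) powr e))"
  proof (rule sum.cong)
    fix l assume l: "l \<in> \<Lambda>"
    have "ww l * (ww l / m l) powr e = (ww l / m l) powr (1 + e) * m l"
      using m0[OF l] Wnn by (cases "ww l = 0") (auto simp: powr_add ww_def less_le)
    then show "ennreal ((ww l / m l) powr (1 + e)) * emeasure \<mu> (V {l}) = ennreal (ww l * (ww l / m l) powr e)"
      unfolding emV m_def[symmetric] using m0[OF l] by (simp add: ennreal_mult)
  qed simp
  also have "\<dots> = ennreal (\<Sum>l\<in>\<Lambda>. ww l * (ww l / m l) powr e)"
    by (rule sum_ennreal) (simp add: ww_def Wnn)
  also have "\<dots> \<le> ennreal (4 * (W G * av powr e))" by (rule ennreal_leI[OF total])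
  also have "\<dots> = 4 * ((\<integral>\<^sup>+y\<in>G. w y \<partial>\<mu>) * average \<mu> G w powe e)"
    unfolding WG avG using av0 Wnn by (simp add: ennreal_powr_ennreal ennreal_mult)
  finally have main: "(\<integral>\<^sup>+x\<in>ball z R. ((\<integral>\<^sup>+y\<in>{y\<in>G. f 0 y = f 0 x}. w y \<partial>\<mu>) / emeasure \<mu> {y\<in>G. f 0 y = f 0 x}) powe (1 + e) \<partial>\<mu>)
    \<le> 4 * ((\<integral>\<^sup>+y\<in>G. w y \<partial>\<mu>) * average \<mu> G w powe e)" .
  have "dist x (f 0 x) \<le> R / 8 ^ N" if "x \<in> G" for x
    using f_near[OF that, of 0] by (simp add: s_def)
  moreover have "finite (range (f 0))"
    by (rule finite_subset[OF _ X(1)[of 0]]) (use f(1) in blast)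
  ultimately show ?thesis using main fm[of 0] by blast
qed

end

section \<open>From vanishing mesh to the reverse Hoelder inequality\<close>

text \<open>How far \<open>A\<close> is from being a union of fibres of \<open>f\<close>: a fibre \<open>V\<close> contributes
  \<open>\<nu>(V \<inter> A) \<nu>(V - A) / \<nu>(V)\<close>, which vanishes if and only if one of the two parts is null. The symmetry
  in \<open>A\<close> and its complement and the subadditivity in \<open>A\<close> suit an induction over the Borel sets.\<close>

definition splitting :: "'a measure \<Rightarrow> ('a \<Rightarrow> 'b) \<Rightarrow> 'a set \<Rightarrow> 'a set \<Rightarrow> real"
  where "splitting \<nu> f G A = (\<Sum>c\<in>range f. measure \<nu> (G \<inter> f -` {c} \<inter> A) * measure \<nu> (G \<inter> f -` {c} - A)
     / measure \<nu> (G \<inter> f -` {c}))"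

text \<open>The fibres of \<open>f n\<close> in \<open>G\<close> form a finite partition into cells of diameter at most \<open>2 \<rho> n\<close>.\<close>

context
  fixes \<nu> :: "'a::{metric_space, second_countable_topology} measure"
    and f :: "nat \<Rightarrow> 'a \<Rightarrow> 'a" and G :: "'a set" and \<rho> :: "nat \<Rightarrow> real"
  assumes sets_nu [measurable_cong]: "sets \<nu> = sets borel" and fin_nu: "emeasure \<nu> G < \<top>"
    and G: "G \<in> sets borel"
    and f: "\<And>n. f n \<in> borel_measurable borel" "\<And>n. finite (range (f n))"
    and near: "\<And>n x. x \<in> G \<Longrightarrow> dist x (f n x) \<le> \<rho> n"
    and \<rho>: "decseq \<rho>" "\<rho> \<longlonglongrightarrow> 0"
begin

lemma cell_sets: "G \<inter> f n -` {c} \<in> sets \<nu>"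
proof -
  have "f n -` {c} \<inter> space borel \<in> sets borel"
    using f(1) by (intro measurable_sets[of _ borel borel]) auto
  then show ?thesis using G sets_nu by auto
qed

lemma sub_fin: "A \<subseteq> G \<Longrightarrow> emeasure \<nu> A = ennreal (measure \<nu> A)"
  using fin_nu emeasure_mono[of A G \<nu>] G sets_nu
  by (intro emeasure_eq_ennreal_measure) (auto simp: top_unique)

lemma sub_mono: "A \<subseteq> B \<Longrightarrow> B \<subseteq> G \<Longrightarrow> B \<in> sets \<nu> \<Longrightarrow> measure \<nu> A \<le> measure \<nu> B"
  using emeasure_mono[of A B \<nu>] sub_fin[of A] sub_fin[of B] by auto

lemma splitting_nonneg: "0 \<le> splitting \<nu> (f n) G A"
  unfolding splitting_def by (intro sum_nonneg) auto

lemma splitting_term_le: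
  assumes A: "A \<in> sets borel"
  shows "measure \<nu> (G \<inter> f n -` {c} \<inter> A) * measure \<nu> (G \<inter> f n -` {c} - A) / measure \<nu> (G \<inter> f n -` {c})
    \<le> measure \<nu> (G \<inter> f n -` {c} - A)"
proof -
  have "measure \<nu> (G \<inter> f n -` {c} \<inter> A) \<le> measure \<nu> (G \<inter> f n -` {c})"
    by (rule sub_mono[OF _ _ cell_sets]) auto
  then have "measure \<nu> (G \<inter> f n -` {c} \<inter> A) / measure \<nu> (G \<inter> f n -` {c}) \<le> 1"
    by (simp add: divide_le_eq_1) (metis less_le measure_nonneg)
  then have "measure \<nu> (G \<inter> f n -` {c} \<inter> A) / measure \<nu> (G \<inter> f n -` {c}) * measure \<nu> (G \<inter> f n -` {c} - A)
    \<le> 1 * measure \<nu> (G \<inter> f n -` {c} - A)"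
    by (intro mult_right_mono) auto
  then show ?thesis by simp
qed

lemma splitting_Compl: "A \<in> sets borel \<Longrightarrow> splitting \<nu> (f n) G (- A) = splitting \<nu> (f n) G A"
  unfolding splitting_def by (intro sum.cong) (auto simp: Diff_eq mult.commute)

lemma sum_cells:
  assumes "A \<in> sets borel"
  shows "(\<Sum>c\<in>range (f n). measure \<nu> (G \<inter> f n -` {c} \<inter> A)) = measure \<nu> (G \<inter> A)"
proof -
  have "ennreal (\<Sum>c\<in>range (f n). measure \<nu> (G \<inter> f n -` {c} \<inter> A))
    = (\<Sum>c\<in>range (f n). emeasure \<nu> (G \<inter> f n -` {c} \<inter> A))"
    by (subst sub_fin) (auto simp: sum_ennreal)
  also have "\<dots> = emeasure \<nu> (\<Union>c\<in>range (f n). G \<inter> f n -` {c} \<inter> A)"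
    using f(2) cell_sets assms sets_nu by (intro sum_emeasure) (auto simp: disjoint_family_on_def)
  also have "(\<Union>c\<in>range (f n). G \<inter> f n -` {c} \<inter> A) = G \<inter> A" by auto
  finally show ?thesis
    by (subst (asm) sub_fin) (auto simp: sum_nonneg)
qed

text \<open>A fibre that meets both \<open>A\<close> and its complement has all its points within \<open>2 \<rho> n\<close> of \<open>A\<close>. The
  part of this neighbourhood outside the closed set \<open>A\<close> decreases to the empty set.\<close>

lemma splitting_closed:
  assumes A: "closed A"
  shows "(\<lambda>n. splitting \<nu> (f n) G A) \<longlonglongrightarrow> 0"
proof (cases "A = {}")
  case True
  then show ?thesis by (simp add: splitting_def)
next
  case False
  have Ab: "A \<in> sets borel" using A by simp
  define S where "S n = G \<inter> {x. x \<notin> A \<and> infdist x A \<le> 2 * \<rho> n}" for n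
  have S_sets: "S n \<in> sets \<nu>" for n
  proof -
    have "closed {x. infdist x A \<le> 2 * \<rho> n}"
      by (intro closed_Collect_le continuous_on_infdist continuous_intros)
    then have "G \<inter> ({x. infdist x A \<le> 2 * \<rho> n} - A) \<in> sets borel" using G Ab by auto
    moreover have "S n = G \<inter> ({x. infdist x A \<le> 2 * \<rho> n} - A)" by (auto simp: S_def)
    ultimately show ?thesis using sets_nu by simp
  qed
  have "decseq S" using \<rho>(1) by (force simp: decseq_def S_def)
  moreover have "(\<Inter>n. S n) = {}"
  proof -
    have False if "\<And>n. x \<in> S n" for x
    proof -
      have "infdist x A \<le> 0"
      proof (rule LIMSEQ_le_const)
        show "(\<lambda>n. 2 * \<rho> n) \<longlonglongrightarrow> 0" using tendsto_mult_right_zero[OF \<rho>(2)] by simp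
      qed (use that in \<open>auto simp: S_def\<close>)
      then have "infdist x A = 0" using infdist_nonneg[of x A] by linarith
      then have "x \<in> A" using A False in_closed_iff_infdist_zero by blast
      then show False using that by (auto simp: S_def)
    qed
    then show ?thesis by blast
  qed
  ultimately have "(\<lambda>n. emeasure \<nu> (S n)) \<longlonglongrightarrow> 0"
    using Lim_emeasure_decseq[of S \<nu>] S_sets sub_fin[of "S _"] by (auto simp: S_def image_subset_iff)
  then have lim: "(\<lambda>n. measure \<nu> (S n)) \<longlonglongrightarrow> 0"
    using tendsto_enn2real[of "\<lambda>n. emeasure \<nu> (S n)" 0 sequentially] by (simp add: measure_def)
  show ?thesis
  proof (rule tendsto_sandwich[OF _ _ tendsto_const lim])
    show "\<forall>\<^sub>F n in sequentially. 0 \<le> splitting \<nu> (f n) G A" by (simp add: splitting_nonneg)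
    have "splitting \<nu> (f n) G A \<le> measure \<nu> (S n)" for n
    proof -
      have "splitting \<nu> (f n) G A \<le> (\<Sum>c\<in>range (f n). measure \<nu> (G \<inter> f n -` {c} \<inter> S n))"
        unfolding splitting_def
      proof (rule sum_mono)
        fix c
        show "measure \<nu> (G \<inter> f n -` {c} \<inter> A) * measure \<nu> (G \<inter> f n -` {c} - A) / measure \<nu> (G \<inter> f n -` {c})
          \<le> measure \<nu> (G \<inter> f n -` {c} \<inter> S n)"
        proof (cases "G \<inter> f n -` {c} \<inter> A = {}")
          case True
          then show ?thesis by simp
        next
          case False
          then obtain y where y: "y \<in> G" "f n y = c" "y \<in> A" by blast
          have "G \<inter> f n -` {c} - A \<subseteq> G \<inter> f n -` {c} \<inter> S n"
          proof
            fix x assume x: "x \<in> G \<inter> f n -` {c} - A"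
            have "infdist x A \<le> dist x y" by (rule infdist_le[OF y(3)])
            also have "\<dots> \<le> dist x c + dist y c" by (metis dist_commute dist_triangle)
            also have "\<dots> \<le> 2 * \<rho> n" using near[of x n] near[of y n] x y by auto
            finally show "x \<in> G \<inter> f n -` {c} \<inter> S n" using x by (auto simp: S_def)
          qed
          then have "measure \<nu> (G \<inter> f n -` {c} - A) \<le> measure \<nu> (G \<inter> f n -` {c} \<inter> S n)"
            by (intro sub_mono[OF _ _ sets.Int[OF cell_sets S_sets]]) auto
          then show ?thesis using splitting_term_le[OF Ab, of n c] by simp
        qed
      qed
      also have "\<dots> = measure \<nu> (G \<inter> S n)" using S_sets sets_nu by (intro sum_cells) auto
      finally show ?thesis by (simp add: S_def Int_absorb1 Int_assoc[symmetric])
    qed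
    then show "\<forall>\<^sub>F n in sequentially. splitting \<nu> (f n) G A \<le> measure \<nu> (S n)" by simp
  qed
qed

text \<open>Up to the measure of a tail of the union, the splitting of the union is at most the sum of the
  splittings of finitely many of the sets.\<close>

lemma splitting_UN:
  fixes A :: "nat \<Rightarrow> 'a set"
  assumes A: "range A \<subseteq> sets borel" "disjoint_family A"
    and lim: "\<And>i. (\<lambda>n. splitting \<nu> (f n) G (A i)) \<longlonglongrightarrow> 0"
  shows "(\<lambda>n. splitting \<nu> (f n) G (\<Union>i. A i)) \<longlonglongrightarrow> 0"
proof -
  define U where "U = (\<Union>i. A i)"
  define T where "T k = (\<Union>i\<in>{k..}. A i)" for k
  have Ab: "A i \<in> sets borel" for i using A by auto
  have Ub: "U \<in> sets borel" "T k \<in> sets borel" for k using Ab by (auto simp: U_def T_def)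
  have tail: "(\<lambda>k. measure \<nu> (G \<inter> T k)) \<longlonglongrightarrow> 0"
  proof -
    have "decseq (\<lambda>k. G \<inter> T k)" by (force simp: decseq_def T_def)
    moreover have "(\<Inter>k. G \<inter> T k) = {}"
    proof -
      have False if xT: "\<And>k. x \<in> T k" for x
      proof -
        obtain i where i: "x \<in> A i" using xT[of 0] by (auto simp: T_def)
        obtain j where j: "j \<ge> Suc i" "x \<in> A j" using xT[of "Suc i"] by (auto simp: T_def)
        then have "A i \<inter> A j = {}" using A(2) by (auto simp: disjoint_family_on_def)
        then show False using i j by blast
      qed
      then show ?thesis by blast
    qed
    moreover have "range (\<lambda>k. G \<inter> T k) \<subseteq> sets \<nu>" using Ub G sets_nu by auto
    ultimately have "(\<lambda>k. emeasure \<nu> (G \<inter> T k)) \<longlonglongrightarrow> 0"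
      using Lim_emeasure_decseq[of "\<lambda>k. G \<inter> T k" \<nu>] sub_fin[of "G \<inter> T _"] by auto
    then show ?thesis
      using tendsto_enn2real[of "\<lambda>k. emeasure \<nu> (G \<inter> T k)" 0 sequentially] by (simp add: measure_def)
  qed
  have bound: "splitting \<nu> (f n) G U \<le> (\<Sum>i<k. splitting \<nu> (f n) G (A i)) + measure \<nu> (G \<inter> T k)" for n k
  proof -
    let ?V = "\<lambda>c. G \<inter> f n -` {c}"
    have "splitting \<nu> (f n) G U \<le> (\<Sum>c\<in>range (f n).
      (\<Sum>i<k. measure \<nu> (?V c \<inter> A i) * measure \<nu> (?V c - A i) / measure \<nu> (?V c)) + measure \<nu> (?V c \<inter> T k))"
      unfolding splitting_def
    proof (rule sum_mono)
      fix c
      have UA: "?V c \<inter> U = (\<Union>i<k. ?V c \<inter> A i) \<union> (?V c \<inter> T k)"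
        unfolding U_def T_def by (auto simp: not_less) (metis atLeast_iff not_less lessThan_iff)
      have V: "?V c \<in> sets \<nu>" by (rule cell_sets)
      have VA: "?V c \<inter> A i \<in> sets \<nu>" "?V c - A i \<in> sets \<nu>" "?V c - U \<in> sets \<nu>" "?V c \<inter> T k \<in> sets \<nu>" for i
        using V Ab Ub sets_nu by auto
      have "ennreal (measure \<nu> (?V c \<inter> U)) = emeasure \<nu> (?V c \<inter> U)" by (rule sub_fin[symmetric]) auto
      also have "\<dots> \<le> emeasure \<nu> (\<Union>i<k. ?V c \<inter> A i) + emeasure \<nu> (?V c \<inter> T k)"
        unfolding UA by (intro emeasure_subadditive sets.finite_UN VA) simp
      also have "\<dots> \<le> (\<Sum>i<k. emeasure \<nu> (?V c \<inter> A i)) + emeasure \<nu> (?V c \<inter> T k)"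
        by (intro add_right_mono emeasure_subadditive_finite) (auto intro: VA)
      also have "\<dots> = ennreal ((\<Sum>i<k. measure \<nu> (?V c \<inter> A i)) + measure \<nu> (?V c \<inter> T k))"
        by (subst (1 2) sub_fin) (auto simp: sum_ennreal sum_nonneg simp flip: ennreal_plus)
      finally have le: "measure \<nu> (?V c \<inter> U) \<le> (\<Sum>i<k. measure \<nu> (?V c \<inter> A i)) + measure \<nu> (?V c \<inter> T k)"
        by (simp add: sum_nonneg flip: ennreal_plus)
      define r where "r = measure \<nu> (?V c - U) / measure \<nu> (?V c)"
      have mUV: "measure \<nu> (?V c - U) \<le> measure \<nu> (?V c)" using V by (intro sub_mono) auto
      have r01: "0 \<le> r" "r \<le> 1"
        unfolding r_def using mUV by (auto simp: divide_le_eq_1) (metis less_le measure_nonneg)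
      have "measure \<nu> (?V c \<inter> U) * r \<le> ((\<Sum>i<k. measure \<nu> (?V c \<inter> A i)) + measure \<nu> (?V c \<inter> T k)) * r"
        using le r01 by (intro mult_right_mono)
      also have "\<dots> \<le> (\<Sum>i<k. measure \<nu> (?V c \<inter> A i) * r) + measure \<nu> (?V c \<inter> T k)"
        using r01 by (simp add: distrib_right sum_distrib_right mult_left_le)
      also have "(\<Sum>i<k. measure \<nu> (?V c \<inter> A i) * r) \<le> (\<Sum>i<k. measure \<nu> (?V c \<inter> A i) * (measure \<nu> (?V c - A i) / measure \<nu> (?V c)))"
      proof (intro sum_mono mult_left_mono)
        fix i
        have "measure \<nu> (?V c - U) \<le> measure \<nu> (?V c - A i)"
          using VA(2) by (intro sub_mono) (auto simp: U_def)
        then show "r \<le> measure \<nu> (?V c - A i) / measure \<nu> (?V c)"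
          unfolding r_def by (intro divide_right_mono) auto
      qed auto
      finally show "measure \<nu> (?V c \<inter> U) * measure \<nu> (?V c - U) / measure \<nu> (?V c)
        \<le> (\<Sum>i<k. measure \<nu> (?V c \<inter> A i) * measure \<nu> (?V c - A i) / measure \<nu> (?V c)) + measure \<nu> (?V c \<inter> T k)"
        by (simp add: r_def)
    qed
    also have "\<dots> = (\<Sum>c\<in>range (f n). \<Sum>i<k. measure \<nu> (?V c \<inter> A i) * measure \<nu> (?V c - A i) / measure \<nu> (?V c))
      + (\<Sum>c\<in>range (f n). measure \<nu> (?V c \<inter> T k))"
      by (rule sum.distrib)
    also have "(\<Sum>c\<in>range (f n). measure \<nu> (?V c \<inter> T k)) = measure \<nu> (G \<inter> T k)"
      by (rule sum_cells[OF Ub(2)])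
    also have "(\<Sum>c\<in>range (f n). \<Sum>i<k. measure \<nu> (?V c \<inter> A i) * measure \<nu> (?V c - A i) / measure \<nu> (?V c))
      = (\<Sum>i<k. splitting \<nu> (f n) G (A i))"
      unfolding splitting_def by (rule sum.swap)
    finally show ?thesis .
  qed
  show ?thesis
    unfolding U_def[symmetric]
  proof (rule LIMSEQ_I)
    fix \<epsilon> :: real assume \<epsilon>: "0 < \<epsilon>"
    obtain k where k: "measure \<nu> (G \<inter> T k) < \<epsilon> / 2"
      using LIMSEQ_D[OF tail, of "\<epsilon> / 2"] \<epsilon> by auto
    have "(\<lambda>n. \<Sum>i<k. splitting \<nu> (f n) G (A i)) \<longlonglongrightarrow> (\<Sum>i<k. 0)"
      by (intro tendsto_sum lim)
    then obtain N where N: "\<And>n. N \<le> n \<Longrightarrow> \<bar>\<Sum>i<k. splitting \<nu> (f n) G (A i)\<bar> < \<epsilon> / 2"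
      using LIMSEQ_D[of "\<lambda>n. \<Sum>i<k. splitting \<nu> (f n) G (A i)" 0 "\<epsilon> / 2"] \<epsilon> by auto
    show "\<exists>N. \<forall>n\<ge>N. norm (splitting \<nu> (f n) G U - 0) < \<epsilon>"
    proof (intro exI[of _ N] allI impI)
      fix n assume n: "N \<le> n"
      have "\<bar>splitting \<nu> (f n) G U\<bar> = splitting \<nu> (f n) G U" using splitting_nonneg by simp
      then show "norm (splitting \<nu> (f n) G U - 0) < \<epsilon>"
        using bound[of n k] k N[OF n] by simp
    qed
  qed
qed

text \<open>The partitions for different \<open>n\<close> are not nested, so that martingale convergence does not apply.
  That they nevertheless resolve every Borel set follows from the case of closed sets, because the sets
  that are resolved form a Dynkin system.\<close>

lemma splitting_tendsto_0:
  assumes "A \<in> sets borel"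
  shows "(\<lambda>n. splitting \<nu> (f n) G A) \<longlonglongrightarrow> 0"
proof -
  have "Int_stable (Collect closed :: 'a set set)" by (auto simp: Int_stable_def)
  moreover have "Collect closed \<subseteq> Pow (UNIV :: 'a set)" by simp
  moreover have "A \<in> sigma_sets UNIV (Collect closed)" using assms by (simp add: borel_eq_closed)
  ultimately show ?thesis
  proof (induction rule: sigma_sets_induct_disjoint)
    case (compl A)
    then have "A \<in> sets borel" by (simp add: borel_eq_closed)
    then show ?case using compl splitting_Compl by (simp add: Compl_eq_Diff_UNIV[symmetric])
  next
    case (union A)
    then have "range A \<subseteq> sets borel" by (auto simp: borel_eq_closed)
    then show ?case using union by (intro splitting_UN) auto
  next
    case (basic A)
    then show ?case by (intro splitting_closed) simp
  next
    case empty
    show ?case by (simp add: splitting_def)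
  qed
qed

lemma powr_bernoulli:
  fixes t q :: real
  assumes "0 \<le> t" "t \<le> 1" "1 \<le> q"
  shows "1 - q * t \<le> (1 - t) powr q"
proof (cases "t = 1")
  case False
  then have "((1 - t) powr q) powr (1 / q) * 1 powr (1 - 1 / q) \<le> 1 / q * (1 - t) powr q + (1 - 1 / q) * 1"
    using assms by (intro Youngs_inequality_0) auto
  then have "1 - t \<le> 1 / q * (1 - t) powr q + (1 - 1 / q)"
    using assms by (simp add: powr_powr)
  then have "(1 - t) * q \<le> (1 / q * (1 - t) powr q + (1 - 1 / q)) * q"
    using assms by (intro mult_right_mono) auto
  also have "\<dots> = (1 - t) powr q + q - 1" using assms by (simp add: field_simps)
  finally show ?thesis by (simp add: algebra_simps)
qed (use assms in auto)

lemma cell_average_lower_bound: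
  assumes w [measurable]: "w \<in> borel_measurable \<nu>" and A: "A \<in> sets \<nu>" and V: "V \<in> sets \<nu>" "V \<subseteq> G"
    and a: "0 \<le> a" "\<And>x. x \<in> A \<Longrightarrow> ennreal a \<le> w x"
  shows "ennreal (a * (measure \<nu> (V \<inter> A) / measure \<nu> V)) \<le> (\<integral>\<^sup>+y\<in>V. w y \<partial>\<nu>) / emeasure \<nu> V"
proof (cases "measure \<nu> V = 0")
  case False
  then have pos: "0 < measure \<nu> V" by (simp add: less_le)
  have "ennreal (a * (measure \<nu> (V \<inter> A) / measure \<nu> V)) = ennreal a * emeasure \<nu> (V \<inter> A) / emeasure \<nu> V"
    using a pos sub_fin[of V] sub_fin[of "V \<inter> A"] V
    by (simp add: le_infI1 divide_ennreal flip: ennreal_mult)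
  also have "ennreal a * emeasure \<nu> (V \<inter> A) = (\<integral>\<^sup>+y. ennreal a * indicator (V \<inter> A) y \<partial>\<nu>)"
    using A V by (simp add: nn_integral_cmult_indicator)
  also have "\<dots> / emeasure \<nu> V \<le> (\<integral>\<^sup>+y\<in>V. w y \<partial>\<nu>) / emeasure \<nu> V"
    using a by (intro divide_right_mono_ennreal nn_integral_mono) (auto simp: indicator_def)
  finally show ?thesis .
qed simp

text \<open>Fatou's lemma for averages over partitions of vanishing mesh. Let \<open>v\<close> be a value of a simple
  function below \<open>w^q\<close>, taken on \<open>A\<close>. On a cell \<open>V\<close> the average of \<open>w\<close> is at least
  \<open>v^(1/q) \<nu>(V \<inter> A)/\<nu>(V)\<close>. Integrating the \<open>q\<close>-th power over \<open>V \<inter> A\<close>, summing over \<open>V\<close> and using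
  Bernoulli's inequality gives at least \<open>v (\<nu>(A) - q splitting)\<close>, and the splitting tends to 0.\<close>

lemma cell_average_fatou:
  assumes w [measurable]: "w \<in> borel_measurable \<nu>" and B: "B \<in> sets borel" "B \<subseteq> G" and q: "1 \<le> q"
    and T: "\<And>n. (\<integral>\<^sup>+x\<in>B. ((\<integral>\<^sup>+y\<in>{y\<in>G. f n y = f n x}. w y \<partial>\<nu>)
      / emeasure \<nu> {y\<in>G. f n y = f n x}) powe q \<partial>\<nu>) \<le> T"
  shows "(\<integral>\<^sup>+x\<in>B. w x powe q \<partial>\<nu>) \<le> T"
  unfolding nn_integral_def_finite
proof (rule SUP_least, clarify)
  fix g :: "'a \<Rightarrow> ennreal"
  assume g: "simple_function \<nu> g" "g \<le> (\<lambda>x. w x powe q * indicator B x)" "\<forall>x. g x < \<top>"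
  have space: "space \<nu> = UNIV" using sets_eq_imp_space_eq[OF sets_nu] by simp
  define S where "S = range g - {0}"
  have finS: "finite S" using simple_functionD(1)[OF g(1)] by (simp add: S_def space)
  define A where "A v = g -` {v}" for v
  have A: "A v \<in> sets \<nu>" for v
    using simple_functionD(2)[OF g(1), of "{v}"] by (simp add: A_def space)
  then have Ab: "A v \<in> sets borel" for v using sets_nu by simp
  have AB: "A v \<subseteq> B" if "v \<in> S" for v
  proof
    fix x assume "x \<in> A v"
    then have "g x \<noteq> 0" using that by (auto simp: A_def S_def)
    moreover have "g x \<le> w x powe q * indicator B x" using g(2) by (simp add: le_fun_def)
    ultimately show "x \<in> B" by (cases "x \<in> B") auto
  qed
  have AG: "G \<inter> A v = A v" if "v \<in> S" for v using AB[OF that] B(2) by blast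
  define r where "r v = enn2real v" for v :: ennreal
  have r: "v = ennreal (r v)" "0 \<le> r v" if "v \<in> S" for v
    using that g(3) by (auto simp: S_def r_def)
  have lower: "ennreal (\<Sum>v\<in>S. r v * (measure \<nu> (A v) - q * splitting \<nu> (f n) G (A v))) \<le> T" for n
  proof -
    let ?V = "\<lambda>c. G \<inter> f n -` {c}"
    \<comment> \<open>A lower bound on the cell \<open>?V c\<close> for the \<open>q\<close>-th power of the average of \<open>w\<close>, coming from the part of the
      cell on which the simple function has the value \<open>v\<close>.\<close>
    define k where "k v c = r v * (measure \<nu> (?V c \<inter> A v) / measure \<nu> (?V c)) powr q" for v c
    have k0: "0 \<le> k v c" if "v \<in> S" for v c using r[OF that] by (simp add: k_def)
    have trm: "r v * (measure \<nu> (?V c \<inter> A v) - q * (measure \<nu> (?V c \<inter> A v) * measure \<nu> (?V c - A v) / measure \<nu> (?V c)))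
      \<le> k v c * measure \<nu> (?V c \<inter> A v)" if v: "v \<in> S" for v c
    proof (cases "measure \<nu> (?V c) = 0")
      case True
      have "measure \<nu> (?V c \<inter> A v) \<le> measure \<nu> (?V c)" by (intro sub_mono cell_sets) auto
      then have "measure \<nu> (?V c \<inter> A v) = 0" using True measure_nonneg[of \<nu> "?V c \<inter> A v"] by linarith
      then show ?thesis by simp
    next
      case False
      then have pos: "0 < measure \<nu> (?V c)" by (simp add: less_le)
      have "emeasure \<nu> (?V c) = emeasure \<nu> (?V c \<inter> A v) + emeasure \<nu> (?V c - A v)"
        using cell_sets A by (subst plus_emeasure) (auto intro!: arg_cong[of _ _ "emeasure \<nu>"])
      then have "ennreal (measure \<nu> (?V c)) = ennreal (measure \<nu> (?V c \<inter> A v) + measure \<nu> (?V c - A v))"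
        by (subst (asm) (1 2 3) sub_fin) auto
      then have split: "measure \<nu> (?V c) = measure \<nu> (?V c \<inter> A v) + measure \<nu> (?V c - A v)"
        by (subst (asm) ennreal_inj) auto
      define t where "t = measure \<nu> (?V c - A v) / measure \<nu> (?V c)"
      have t: "0 \<le> t" "t \<le> 1" "measure \<nu> (?V c \<inter> A v) / measure \<nu> (?V c) = 1 - t"
        using pos split measure_nonneg[of \<nu> "?V c \<inter> A v"] by (auto simp: t_def field_simps)
      have "r v * measure \<nu> (?V c \<inter> A v) * (1 - q * t) \<le> r v * measure \<nu> (?V c \<inter> A v) * (1 - t) powr q"
        using powr_bernoulli[OF t(1,2) q] r[OF v] by (intro mult_left_mono) auto
      then show ?thesis
        unfolding k_def t(3) by (simp add: t_def algebra_simps)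
    qed
    have "(\<Sum>v\<in>S. r v * (measure \<nu> (A v) - q * splitting \<nu> (f n) G (A v)))
      \<le> (\<Sum>v\<in>S. \<Sum>c\<in>range (f n). k v c * measure \<nu> (?V c \<inter> A v))"
    proof (rule sum_mono)
      fix v assume v: "v \<in> S"
      have "r v * (measure \<nu> (A v) - q * splitting \<nu> (f n) G (A v))
        = r v * ((\<Sum>c\<in>range (f n). measure \<nu> (?V c \<inter> A v)) - q * splitting \<nu> (f n) G (A v))"
        unfolding sum_cells[OF Ab] AG[OF v] ..
      also have "\<dots> = (\<Sum>c\<in>range (f n). r v * (measure \<nu> (?V c \<inter> A v) - q * (measure \<nu> (?V c \<inter> A v) * measure \<nu> (?V c - A v) / measure \<nu> (?V c))))"
        unfolding splitting_def by (simp only: sum_distrib_left sum_subtractf right_diff_distrib)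
      also have "\<dots> \<le> (\<Sum>c\<in>range (f n). k v c * measure \<nu> (?V c \<inter> A v))"
        using trm[OF v] by (intro sum_mono) auto
      finally show "r v * (measure \<nu> (A v) - q * splitting \<nu> (f n) G (A v)) \<le> \<dots>" .
    qed
    then have "ennreal (\<Sum>v\<in>S. r v * (measure \<nu> (A v) - q * splitting \<nu> (f n) G (A v)))
      \<le> ennreal (\<Sum>v\<in>S. \<Sum>c\<in>range (f n). k v c * measure \<nu> (?V c \<inter> A v))"
      by (rule ennreal_leI)
    also have "\<dots> = (\<Sum>v\<in>S. \<Sum>c\<in>range (f n). ennreal (k v c) * emeasure \<nu> (?V c \<inter> A v))"
    proof -
      have "ennreal (k v c) * emeasure \<nu> (?V c \<inter> A v) = ennreal (k v c * measure \<nu> (?V c \<inter> A v))" if "v \<in> S" for v c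
        using k0[OF that] by (subst sub_fin) (auto simp: ennreal_mult)
      then show ?thesis using k0 by (simp add: sum_nonneg)
    qed
    also have "\<dots> = (\<integral>\<^sup>+x. (\<Sum>v\<in>S. \<Sum>c\<in>range (f n). ennreal (k v c) * indicator (?V c \<inter> A v) x) \<partial>\<nu>)"
    proof -
      have VA: "?V c \<inter> A v \<in> sets \<nu>" for c v using cell_sets A by auto
      have m: "(\<lambda>x. ennreal (k v c) * indicator (?V c \<inter> A v) x) \<in> borel_measurable \<nu>" for v c
        by (intro borel_measurable_times_ennreal borel_measurable_indicator borel_measurable_const VA)
      show ?thesis
        using VA by (simp add: nn_integral_sum m borel_measurable_sum nn_integral_cmult_indicator)
    qed
    also have "\<dots> \<le> (\<integral>\<^sup>+x\<in>B. ((\<integral>\<^sup>+y\<in>{y\<in>G. f n y = f n x}. w y \<partial>\<nu>)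
      / emeasure \<nu> {y\<in>G. f n y = f n x}) powe q \<partial>\<nu>)"
    proof (rule nn_integral_mono)
      fix x
      let ?K = "\<Sum>v\<in>S. \<Sum>c\<in>range (f n). ennreal (k v c) * indicator (?V c \<inter> A v) x"
      show "?K \<le> ((\<integral>\<^sup>+y\<in>{y\<in>G. f n y = f n x}. w y \<partial>\<nu>) / emeasure \<nu> {y\<in>G. f n y = f n x}) powe q * indicator B x"
      proof (cases "g x \<in> S")
        case False
        then have "?K = 0" by (intro sum.neutral ballI) (auto simp: A_def indicator_def)
        then show ?thesis by simp
      next
        case True
        have xB: "x \<in> B" using AB[OF True] by (auto simp: A_def)
        then have xG: "x \<in> G" using B by blast
        have "?K = (\<Sum>v\<in>S. if v = g x then (\<Sum>c\<in>range (f n). if c = f n x then ennreal (k v c) else 0) else 0)"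
          using xG by (intro sum.cong refl) (auto simp: A_def indicator_def intro!: sum.cong sum.neutral)
        also have "\<dots> = ennreal (k (g x) (f n x))" using finS True f(2)[of n] by simp
        finally have K: "?K = ennreal (k (g x) (f n x))" .
        define a where "a = r (g x) powr (1 / q)"
        have aq: "a powr q = r (g x)" using q r[OF True] by (simp add: a_def powr_powr)
        have av: "ennreal a \<le> w y" if "y \<in> A (g x)" for y
        proof -
          have "y \<in> B" "g y = g x" using that AB[OF True] by (auto simp: A_def)
          then have "ennreal (r (g x)) \<le> w y powe q"
            using g(2) r(1)[OF True] by (auto simp: le_fun_def dest!: spec[of _ y])
          then have "ennreal (r (g x)) powe (1 / q) \<le> (w y powe q) powe (1 / q)"
            using q by (intro powe_mono) auto
          moreover have "ennreal (r (g x)) powe (1 / q) = ennreal a"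
            unfolding a_def by (rule ennreal_powr_ennreal[OF r(2)[OF True]])
          moreover have "(w y powe q) powe (1 / q) = w y" using q by (simp add: powe_powe)
          ultimately show ?thesis by simp
        qed
        have V: "{y\<in>G. f n y = f n x} = ?V (f n x)" by auto
        have "ennreal (k (g x) (f n x)) = ennreal (a * (measure \<nu> (?V (f n x) \<inter> A (g x)) / measure \<nu> (?V (f n x)))) powe q"
        proof (subst ennreal_powr_ennreal)
          have "0 \<le> a" by (simp add: a_def)
          then show "0 \<le> a * (measure \<nu> (?V (f n x) \<inter> A (g x)) / measure \<nu> (?V (f n x)))" by simp
          show "ennreal (k (g x) (f n x)) = ennreal ((a * (measure \<nu> (?V (f n x) \<inter> A (g x)) / measure \<nu> (?V (f n x)))) powr q)"
            unfolding k_def aq[symmetric] using \<open>0 \<le> a\<close> by (subst powr_mult) simp_all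
        qed
        also have "\<dots> \<le> ((\<integral>\<^sup>+y\<in>?V (f n x). w y \<partial>\<nu>) / emeasure \<nu> (?V (f n x))) powe q"
          using q by (intro powe_mono cell_average_lower_bound w A cell_sets av) (auto simp: a_def)
        finally show ?thesis using xB unfolding K V by simp
      qed
    qed
    also have "\<dots> \<le> T" by (rule T)
    finally show ?thesis .
  qed
  have "(\<lambda>n. \<Sum>v\<in>S. r v * (measure \<nu> (A v) - q * splitting \<nu> (f n) G (A v)))
    \<longlonglongrightarrow> (\<Sum>v\<in>S. r v * (measure \<nu> (A v) - q * 0))"
    by (intro tendsto_intros splitting_tendsto_0 Ab)
  then have "(\<lambda>n. ennreal (\<Sum>v\<in>S. r v * (measure \<nu> (A v) - q * splitting \<nu> (f n) G (A v))))
    \<longlonglongrightarrow> ennreal (\<Sum>v\<in>S. r v * measure \<nu> (A v))"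
    by (intro tendsto_ennrealI) simp
  then have "ennreal (\<Sum>v\<in>S. r v * measure \<nu> (A v)) \<le> T"
    using lower by (intro LIMSEQ_le_const2) auto
  moreover have "integral\<^sup>S \<nu> g = ennreal (\<Sum>v\<in>S. r v * measure \<nu> (A v))"
  proof -
    have "integral\<^sup>S \<nu> g = (\<Sum>v\<in>range g. v * emeasure \<nu> (A v))"
      by (simp add: simple_integral_def space A_def)
    also have "\<dots> = (\<Sum>v\<in>S. v * emeasure \<nu> (A v))"
      using simple_functionD(1)[OF g(1)] by (intro sum.mono_neutral_right) (auto simp: S_def space)
    also have "\<dots> = (\<Sum>v\<in>S. ennreal (r v * measure \<nu> (A v)))"
    proof (rule sum.cong)
      fix v assume v: "v \<in> S"
      have "A v \<subseteq> G" using AG[OF v] by blast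
      then show "v * emeasure \<nu> (A v) = ennreal (r v * measure \<nu> (A v))"
        using r[OF v] by (subst sub_fin) (simp_all add: ennreal_mult)
    qed simp
    also have "\<dots> = ennreal (\<Sum>v\<in>S. r v * measure \<nu> (A v))"
      using r by (intro sum_ennreal) auto
    finally show ?thesis .
  qed
  ultimately show "integral\<^sup>S \<nu> g \<le> T" by simp
qed

end

context doubling_measure
begin

text \<open>A weak reverse Hoelder inequality: the right-hand side involves an enlarged ball. What matters is
  that the admissible \<open>e\<close> is inversely proportional to \<open>L\<close>, see \<open>reverse_holder_exponent\<close>.\<close>

theorem reverse_holder:
  fixes z :: 'a and R e q L :: real
  assumes w: "muckenhoupt q L w" and L: "1 \<le> L" and q: "1 \<le> q" and R: "0 < R"
    and e: "0 \<le> e" "(2 * Cd ^ 7) powr e \<le> 1 + 1 / (2 * Cd ^ 3) powr q / L / 2"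
  shows "(\<integral>\<^sup>+x\<in>ball z R. w x powe (1 + e) \<partial>\<mu>)
    \<le> 4 * ((\<integral>\<^sup>+y\<in>ball z (16 * R). w y \<partial>\<mu>) * average \<mu> (ball z (16 * R)) w powe e)"
proof -
  define G where "G = ball z (16 * R)"
  have "\<forall>n. \<exists>f. f \<in> borel_measurable borel \<and> finite (range f) \<and> (\<forall>x\<in>G. dist x (f x) \<le> R / 8 ^ n) \<and>
    (\<integral>\<^sup>+x\<in>ball z R. ((\<integral>\<^sup>+y\<in>{y\<in>G. f y = f x}. w y \<partial>\<mu>) / emeasure \<mu> {y\<in>G. f y = f x}) powe (1 + e) \<partial>\<mu>)
      \<le> 4 * ((\<integral>\<^sup>+y\<in>G. w y \<partial>\<mu>) * average \<mu> G w powe e)"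
    unfolding G_def by (intro allI discrete_reverse_holder[OF w L q R e])
  from choice[OF this] obtain f where f: "\<forall>n. f n \<in> borel_measurable borel \<and> finite (range (f n)) \<and>
    (\<forall>x\<in>G. dist x (f n x) \<le> R / 8 ^ n) \<and>
    (\<integral>\<^sup>+x\<in>ball z R. ((\<integral>\<^sup>+y\<in>{y\<in>G. f n y = f n x}. w y \<partial>\<mu>) / emeasure \<mu> {y\<in>G. f n y = f n x}) powe (1 + e) \<partial>\<mu>)
      \<le> 4 * ((\<integral>\<^sup>+y\<in>G. w y \<partial>\<mu>) * average \<mu> G w powe e)" ..
  have "(\<integral>\<^sup>+x\<in>ball z R. w x powe (1 + e) \<partial>\<mu>) \<le> 4 * ((\<integral>\<^sup>+y\<in>G. w y \<partial>\<mu>) * average \<mu> G w powe e)"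
  proof (rule cell_average_fatou[where f = f and G = G and \<rho> = "\<lambda>n. R / 8 ^ n"])
    show "decseq (\<lambda>n. R / 8 ^ n)"
      using R by (auto simp: decseq_def intro!: divide_left_mono power_increasing)
    show "(\<lambda>n. R / 8 ^ n) \<longlonglongrightarrow> 0"
      by (rule LIMSEQ_divide_realpow_zero) simp
    show "emeasure \<mu> G < \<top>" unfolding G_def by (rule ball_finite)
    show "w \<in> borel_measurable \<mu>" using w by (simp add: muckenhoupt_def)
    show "ball z R \<subseteq> G" using R by (auto simp: G_def)
  qed (use f e in \<open>auto simp: G_def\<close>)
  then show ?thesis by (simp add: G_def)
qed

end

section \<open>A weighted maximal estimate, linear in the weight constant\<close>

lemma average_mono: "(\<And>x. x \<in> E \<Longrightarrow> f x \<le> g x) \<Longrightarrow> average M E f \<le> average M E g"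
  unfolding average_def by (intro divide_right_mono_ennreal nn_integral_mono) (auto simp: indicator_def)

lemma average_holder:
  assumes [measurable]: "f \<in> borel_measurable M" "g \<in> borel_measurable M" "E \<in> sets M"
    and E: "0 < emeasure M E" "emeasure M E < \<top>" and st: "0 < s" "0 < t" "s + t = 1"
  shows "average M E (\<lambda>x. f x powe s * g x powe t) \<le> average M E f powe s * average M E g powe t"
proof -
  have "(\<integral>\<^sup>+x\<in>E. f x powe s * g x powe t \<partial>M)
      = (\<integral>\<^sup>+x. (f x * indicator E x) powe s * (g x * indicator E x) powe t \<partial>M)"
    using st by (intro nn_integral_cong) (auto simp: indicator_def)
  also have "\<dots> \<le> (\<integral>\<^sup>+x\<in>E. f x \<partial>M) powe s * (\<integral>\<^sup>+x\<in>E. g x \<partial>M) powe t"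
    by (intro holder_nn_integral st) measurable
  finally have "average M E (\<lambda>x. f x powe s * g x powe t)
      \<le> (\<integral>\<^sup>+x\<in>E. f x \<partial>M) powe s * (\<integral>\<^sup>+x\<in>E. g x \<partial>M) powe t / emeasure M E powe (s + t)"
    unfolding average_def using st by (auto intro!: divide_right_mono_ennreal)
  also have "\<dots> = average M E f powe s * average M E g powe t"
    unfolding average_def unfolding powe_divide[OF E] powe_add unfolding divide_ennreal_def
    using E by (subst ennreal_inverse_mult) (auto simp: mult_ac)
  finally show ?thesis .
qed

context doubling_measure
begin

lemma average_le_ball_average:
  assumes E: "E \<subseteq> ball z R" and big: "emeasure \<mu> (ball z R) \<le> ennreal c * emeasure \<mu> E"
    and c: "0 < c" and R: "0 < R"
  shows "average \<mu> E h \<le> ennreal c * average \<mu> (ball z R) h"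
proof -
  have B: "0 < emeasure \<mu> (ball z R)" "emeasure \<mu> (ball z R) < \<top>" using R ball_pos ball_finite by auto
  have Ef: "emeasure \<mu> E < \<top>" by (rule subset_ball_finite[OF E])
  have E0: "0 < emeasure \<mu> E" using big B by (cases "emeasure \<mu> E = 0") (auto simp: zero_less_iff_neq_zero)
  have "average \<mu> E h \<le> (\<integral>\<^sup>+x\<in>ball z R. h x \<partial>\<mu>) / emeasure \<mu> E"
    unfolding average_def using E by (intro divide_right_mono_ennreal nn_integral_mono) (auto simp: indicator_def)
  also have "\<dots> \<le> (\<integral>\<^sup>+x\<in>ball z R. h x \<partial>\<mu>) * (ennreal c / emeasure \<mu> (ball z R))"
  proof -
    obtain b m where bm: "emeasure \<mu> (ball z R) = ennreal b" "emeasure \<mu> E = ennreal m" "0 < b" "0 < m"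
      using B Ef E0 by (cases "emeasure \<mu> (ball z R)"; cases "emeasure \<mu> E") auto
    have "b \<le> c * m" using big c bm by (simp flip: ennreal_mult)
    then have "1 / m \<le> c / b" using bm by (simp add: field_simps)
    then have "inverse (emeasure \<mu> E) \<le> ennreal c / emeasure \<mu> (ball z R)"
      using bm c by (simp add: inverse_ennreal divide_ennreal ennreal_leI inverse_eq_divide)
    then show ?thesis unfolding divide_ennreal_def[of "nn_integral _ _"] by (intro mult_left_mono) auto
  qed
  also have "\<dots> = ennreal c * average \<mu> (ball z R) h"
    by (simp add: average_def divide_ennreal_def mult_ac)
  finally show ?thesis .
qed

text \<open>Hoelder's inequality with the two functions \<open>w^(1+e)\<close> and \<open>H^(p/Q)\<close>: the reverse Hoelder inequality
  bounds the average of the first by a constant, as the average of \<open>w\<close> is at most 1. The integrability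
  exponent \<open>1 + e\<close>, in place of 1, is what makes \<open>p/Q\<close> smaller than \<open>p\<close>.\<close>

lemma weighted_average_bound:
  fixes z :: 'a and w H :: "'a \<Rightarrow> ennreal"
  assumes par: "0 < r" "0 < a" "0 < p" "1 / r = 1 / a + 1 / p"
    and w: "muckenhoupt q L w" and L: "1 \<le> L" and q: "1 \<le> q" and R: "0 < R"
    and e: "0 < e" "(2 * Cd ^ 7) powr e \<le> 1 + 1 / (2 * Cd ^ 3) powr q / L / 2"
    and E: "E \<in> sets \<mu>" "E \<subseteq> ball z R" "emeasure \<mu> (ball z R) \<le> ennreal (Cd ^ 2) * emeasure \<mu> E"
    and w1: "average \<mu> (ball z (16 * R)) w \<le> 1" and H [measurable]: "H \<in> borel_measurable \<mu>"
  defines "Q \<equiv> 1 + p / a * (e / (1 + e))"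
  shows "average \<mu> E (\<lambda>x. (w x powe (1 / a) * H x) powe r) powe (p / r)
    \<le> ennreal ((4 * Cd ^ 6) powr (p / a) * (Cd ^ 2) powr (1 + p / a))
      * average \<mu> (ball z R) (\<lambda>x. H x powe (p / Q)) powe Q"
proof -
  have wm [measurable]: "w \<in> borel_measurable \<mu>" using w by (simp add: muckenhoupt_def)
  have Em [measurable]: "E \<in> sets \<mu>" by (rule E)
  let ?B = "ball z R"
  have B: "0 < emeasure \<mu> ?B" using R ball_pos by auto
  have Ef: "emeasure \<mu> E < \<top>" by (rule subset_ball_finite[OF E(2)])
  have E0: "0 < emeasure \<mu> E" using E(3) B by (cases "emeasure \<mu> E = 0") (auto simp: zero_less_iff_neq_zero)
  have D1: "1 \<le> Cd ^ 6" "1 \<le> Cd ^ 2" "1 \<le> Cd ^ 4" using Cd_ge_1 by (auto simp: one_le_power)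
  have pr: "p / r = 1 + p / a" using par by (simp add: field_simps)
  \<comment> \<open>The exponents \<open>s\<close> and \<open>t\<close> for Hoelder's inequality: \<open>(1 + e) s = r/a\<close> and \<open>(p/Q) t = r\<close>.\<close>
  define s where "s = r / (a * (1 + e))"
  define t where "t = 1 - s"
  have "1 / a < 1 / r" using par by simp
  then have ra: "r < a" using par(1,2) by (simp add: field_simps)
  have s: "0 < s" "s < 1" unfolding s_def using par e ra
    by (auto simp: divide_less_eq) (smt (verit) mult_less_cancel_left2 mult_pos_pos)
  have t: "0 < t" "s + t = 1" using s by (auto simp: t_def)
  have sp: "s * (p / r) = p / a / (1 + e)" using par by (simp add: s_def)
  have tp: "t * (p / r) = Q"
  proof -
    have "t * (p / r) = p / r - s * (p / r)" unfolding t_def by (simp only: left_diff_distrib mult_1)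
    also have "\<dots> = 1 + p / a * (1 - 1 / (1 + e))" unfolding sp unfolding pr by (simp add: right_diff_distrib)
    also have "1 - 1 / (1 + e) = e / (1 + e)" using e by (simp add: field_simps)
    finally show ?thesis by (simp add: Q_def)
  qed
  have "p / a * (e / (1 + e)) \<le> p / a" by (rule mult_left_le) (use e par in auto)
  moreover have "0 \<le> p / a * (e / (1 + e))" using e par by simp
  ultimately have Q: "1 \<le> Q" "Q \<le> 1 + p / a" unfolding Q_def by linarith+
  have eq: "(w x powe (1 / a) * H x) powe r = (w x powe (1 + e)) powe s * (H x powe (p / Q)) powe t" for x
  proof -
    have "(1 + e) * s = 1 / a * r" using e by (simp add: s_def)
    moreover have "p / Q * t = r" unfolding tp[symmetric] using t par by (simp add: field_simps)
    ultimately show ?thesis by (simp only: powe_mult powe_powe)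
  qed
  have w_avg: "average \<mu> E (\<lambda>x. w x powe (1 + e)) \<le> ennreal (4 * Cd ^ 6)"
  proof -
    let ?G = "ball z (16 * R)"
    have G: "0 < emeasure \<mu> ?G" "emeasure \<mu> ?G < \<top>" using R ball_pos ball_finite by auto
    have GB: "emeasure \<mu> ?G \<le> ennreal (Cd ^ 4) * emeasure \<mu> ?B"
      using R by (intro ball_compare) auto
    have "(\<integral>\<^sup>+x\<in>?B. w x powe (1 + e) \<partial>\<mu>) \<le> 4 * ((\<integral>\<^sup>+y\<in>?G. w y \<partial>\<mu>) * average \<mu> ?G w powe e)"
      by (rule reverse_holder[OF w L q R _ e(2)]) (use e in simp)
    also have "\<dots> \<le> 4 * ((\<integral>\<^sup>+y\<in>?G. w y \<partial>\<mu>) * 1)"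
      using powe_mono[OF w1, of e] e by (intro mult_left_mono) auto
    also have "(\<integral>\<^sup>+y\<in>?G. w y \<partial>\<mu>) = average \<mu> ?G w * emeasure \<mu> ?G"
      using G by (simp add: average_def ennreal_divide_times mult_divide_eq_ennreal)
    also have "4 * (average \<mu> ?G w * emeasure \<mu> ?G * 1) \<le> 4 * (1 * (ennreal (Cd ^ 4) * emeasure \<mu> ?B) * 1)"
      using w1 GB by (intro mult_left_mono mult_right_mono mult_mono) auto
    also have "\<dots> = ennreal (4 * Cd ^ 4) * emeasure \<mu> ?B"
      by (simp add: ennreal_mult mult_ac)
    finally have "average \<mu> ?B (\<lambda>x. w x powe (1 + e)) \<le> ennreal (4 * Cd ^ 4) * emeasure \<mu> ?B / emeasure \<mu> ?B"
      unfolding average_def by (rule divide_right_mono_ennreal)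
    also have "\<dots> = ennreal (4 * Cd ^ 4)"
      using B ball_finite[of z R] by (simp add: mult_divide_eq_ennreal)
    finally have "ennreal (Cd ^ 2) * average \<mu> ?B (\<lambda>x. w x powe (1 + e)) \<le> ennreal (Cd ^ 2) * ennreal (4 * Cd ^ 4)"
      by (intro mult_left_mono) auto
    also have "\<dots> = ennreal (4 * Cd ^ 6)"
      by (subst ennreal_mult[symmetric]) (auto simp: power_add[symmetric])
    finally show ?thesis
      using average_le_ball_average[OF E(2,3) _ R, of "\<lambda>x. w x powe (1 + e)"] by (auto intro: order_trans)
  qed
  have "average \<mu> E (\<lambda>x. (w x powe (1 / a) * H x) powe r)
      \<le> average \<mu> E (\<lambda>x. w x powe (1 + e)) powe s * average \<mu> E (\<lambda>x. H x powe (p / Q)) powe t"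
    unfolding eq by (intro average_holder E0 Ef s t) measurable
  also have "\<dots> \<le> ennreal (4 * Cd ^ 6) powe s * (ennreal (Cd ^ 2) * average \<mu> ?B (\<lambda>x. H x powe (p / Q))) powe t"
    using s t by (intro mult_mono powe_mono w_avg average_le_ball_average E R) auto
  finally have "average \<mu> E (\<lambda>x. (w x powe (1 / a) * H x) powe r) powe (p / r)
    \<le> (ennreal (4 * Cd ^ 6) powe s * (ennreal (Cd ^ 2) * average \<mu> ?B (\<lambda>x. H x powe (p / Q))) powe t) powe (p / r)"
    using par by (intro powe_mono) auto
  also have "\<dots> = ennreal (4 * Cd ^ 6) powe (s * (p / r)) * (ennreal (Cd ^ 2) * average \<mu> ?B (\<lambda>x. H x powe (p / Q))) powe (t * (p / r))"
    by (simp only: powe_mult powe_powe)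
  also have "\<dots> = ennreal ((4 * Cd ^ 6) powr (p / a / (1 + e))) * (ennreal ((Cd ^ 2) powr Q) * average \<mu> ?B (\<lambda>x. H x powe (p / Q)) powe Q)"
    unfolding sp tp powe_mult by (subst (1 2) ennreal_powr_ennreal) auto
  also have "\<dots> \<le> ennreal ((4 * Cd ^ 6) powr (p / a)) * (ennreal ((Cd ^ 2) powr (1 + p / a)) * average \<mu> ?B (\<lambda>x. H x powe (p / Q)) powe Q)"
  proof (intro mult_mono ennreal_leI powr_mono order_refl)
    show "p / a / (1 + e) \<le> p / a" using par e by (simp add: divide_le_eq mult_left_mono)
  qed (use D1 Q in auto)
  also have "\<dots> = ennreal ((4 * Cd ^ 6) powr (p / a) * (Cd ^ 2) powr (1 + p / a)) * average \<mu> ?B (\<lambda>x. H x powe (p / Q)) powe Q"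
    by (simp only: mult.assoc[symmetric] ennreal_mult[symmetric] powr_ge_zero)
  finally show ?thesis .
qed

text \<open>The condition on \<open>e = c/L\<close> is of the form \<open>exp (e T) \<le> 1 + \<kappa>/(2 L)\<close>, and
  \<open>exp x \<le> 1 + 2 x\<close> on \<open>[0, 1]\<close>.\<close>

lemma reverse_holder_exponent:
  assumes q: "1 \<le> q"
  shows "\<exists>c>0. \<forall>L\<ge>1. c / L \<le> 1 \<and> (2 * Cd ^ 7) powr (c / L) \<le> 1 + 1 / (2 * Cd ^ 3) powr q / L / 2"
proof -
  define T where "T = ln (2 * Cd ^ 7)"
  define \<kappa> where "\<kappa> = 1 / (2 * Cd ^ 3) powr q"
  have D1: "1 \<le> Cd ^ 7" "1 \<le> Cd ^ 3" using Cd_ge_1 by (auto simp: one_le_power)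
  have T: "0 < T" using D1 by (simp add: T_def)
  have \<kappa>: "0 < \<kappa>" "\<kappa> \<le> 1"
    unfolding \<kappa>_def using D1 q ge_one_powr_ge_zero[of "2 * Cd ^ 3" q] by auto
  define c where "c = min 1 (\<kappa> / (4 * T))"
  have c: "0 < c" "c \<le> 1" "c * T \<le> \<kappa> / 4"
    using T \<kappa> by (auto simp: c_def min_def field_simps)
  show ?thesis
  proof (intro exI[of _ c] conjI allI impI c)
    fix L :: real assume L: "1 \<le> L"
    show "c / L \<le> 1" using c L by (simp add: divide_le_eq)
    define x where "x = c / L * T"
    have x: "0 \<le> x" "x \<le> 1" "2 * x \<le> \<kappa> / L / 2"
    proof -
      show "0 \<le> x" using c L T by (simp add: x_def)
      have "x = c * T / L" by (simp add: x_def)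
      also have "\<dots> \<le> \<kappa> / 4 / L" using c(3) L by (intro divide_right_mono) auto
      finally have "x \<le> \<kappa> / 4 / L" .
      then show "2 * x \<le> \<kappa> / L / 2" by (simp add: field_simps)
      have "\<kappa> / 4 / L \<le> 1" using \<kappa> L by (simp add: divide_le_eq)
      then show "x \<le> 1" using \<open>x \<le> \<kappa> / 4 / L\<close> by simp
    qed
    have "(2 * Cd ^ 7) powr (c / L) = exp x" using D1 by (simp add: powr_def x_def T_def)
    also have "\<dots> \<le> 1 + x + x\<^sup>2" using x by (intro exp_bound)
    also have "\<dots> \<le> 1 + 2 * x" using x by (simp add: power2_eq_square mult_left_le)
    also have "\<dots> \<le> 1 + 1 / (2 * Cd ^ 3) powr q / L / 2" using x(3) by (simp add: \<kappa>_def)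
    finally show "(2 * Cd ^ 7) powr (c / L) \<le> \<dots>" .
  qed
qed

text \<open>In the application \<open>E j\<close> is the dilate of a cube, whose measure is comparable to that of a ball
  containing it, and \<open>F j\<close> is the part of the undilated cube given by sparseness.\<close>

definition sparse_balls :: "'i set \<Rightarrow> ('i \<Rightarrow> 'a) \<Rightarrow> ('i \<Rightarrow> real) \<Rightarrow> ('i \<Rightarrow> 'a set) \<Rightarrow> ('i \<Rightarrow> 'a set) \<Rightarrow> bool"
  where "sparse_balls J z R E F \<longleftrightarrow> finite J \<and> disjoint_family_on F J \<and>
    (\<forall>j\<in>J. 0 < R j \<and> E j \<in> sets \<mu> \<and> E j \<subseteq> ball (z j) (R j) \<and>
      emeasure \<mu> (ball (z j) (R j)) \<le> ennreal (Cd ^ 2) * emeasure \<mu> (E j) \<and>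
      F j \<in> sets \<mu> \<and> F j \<subseteq> ball (z j) (R j))"

text \<open>One choice of the constant in \<open>reverse_holder_exponent\<close>, so that the constants of the later
  estimates are functions of the measure and the exponents alone.\<close>

definition rh_exponent :: "real \<Rightarrow> real"
  where "rh_exponent q = (SOME c. 0 < c \<and>
    (\<forall>L\<ge>1. c / L \<le> 1 \<and> (2 * Cd ^ 7) powr (c / L) \<le> 1 + 1 / (2 * Cd ^ 3) powr q / L / 2))"

lemma rh_exponent:
  assumes "1 \<le> q"
  shows "0 < rh_exponent q" "\<And>L. 1 \<le> L \<Longrightarrow> rh_exponent q / L \<le> 1"
    "\<And>L. 1 \<le> L \<Longrightarrow> (2 * Cd ^ 7) powr (rh_exponent q / L) \<le> 1 + 1 / (2 * Cd ^ 3) powr q / L / 2"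
  using someI_ex[OF reverse_holder_exponent[OF assms]] unfolding rh_exponent_def by auto

text \<open>The constant of \<open>weighted_average_bound\<close> times that of the maximal inequality in \<open>L^Q\<close> divided by
  \<open>L\<close>, where \<open>Q \<le> 1 + p/a\<close> and \<open>1/(Q - 1) \<le> 2 a L/(p c)\<close> with \<open>c = rh_exponent q\<close>.\<close>

definition maximal_constant :: "real \<Rightarrow> real \<Rightarrow> real \<Rightarrow> real"
  where "maximal_constant a p q = (4 * Cd ^ 6) powr (p / a) * (Cd ^ 2) powr (1 + p / a) *
    (Cd ^ 2 * 2 powr (1 + p / a) * (1 + p / a) * (2 * a / (p * rh_exponent q)))"

lemma maximal_constant_pos:
  assumes "0 < a" "0 < p" "1 \<le> q"
  shows "0 < maximal_constant a p q"
  unfolding maximal_constant_def using assms rh_exponent(1)[of q]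
  by (intro mult_pos_pos add_pos_pos divide_pos_pos) auto

text \<open>The dependence on \<open>L\<close> comes from the maximal inequality alone. The reverse Hoelder inequality allows
  averages of \<open>H^(p/Q)\<close> with \<open>Q - 1\<close> proportional to \<open>1/L\<close>, and the maximal inequality in \<open>L^Q\<close> costs
  \<open>1/(Q - 1)\<close>. A different weight for each \<open>j\<close> is allowed, because the bases into which vectors are
  decomposed depend on the ball.\<close>

theorem weighted_maximal_estimate:
  fixes z :: "'i \<Rightarrow> 'a" and H :: "'a \<Rightarrow> ennreal"
  assumes par: "0 < r" "0 < a" "0 < p" "1 / r = 1 / a + 1 / p" and q: "1 \<le> q" and L: "1 \<le> L"
    and balls: "sparse_balls J z R E F" and H [measurable]: "H \<in> borel_measurable \<mu>"
    and w: "\<And>j. j \<in> J \<Longrightarrow> muckenhoupt q L (w j)"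
    and w1: "\<And>j. j \<in> J \<Longrightarrow> average \<mu> (ball (z j) (16 * R j)) (w j) \<le> 1"
  shows "(\<Sum>j\<in>J. emeasure \<mu> (F j) * average \<mu> (E j) (\<lambda>x. (w j x powe (1 / a) * H x) powe r) powe (p / r))
      \<le> ennreal (maximal_constant a p q * L) * (\<integral>\<^sup>+x. H x powe p \<partial>\<mu>)"
proof -
  define c where "c = rh_exponent q"
  have c: "0 < c" "\<And>L. 1 \<le> L \<Longrightarrow> c / L \<le> 1"
    "\<And>L. 1 \<le> L \<Longrightarrow> (2 * Cd ^ 7) powr (c / L) \<le> 1 + 1 / (2 * Cd ^ 3) powr q / L / 2"
    using rh_exponent[OF q] by (auto simp: c_def)
  define K where "K = (4 * Cd ^ 6) powr (p / a) * (Cd ^ 2) powr (1 + p / a)"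
  define C where "C = K * (Cd ^ 2 * 2 powr (1 + p / a) * (1 + p / a) * (2 * a / (p * c)))"
  have C_eq: "maximal_constant a p q = C" by (simp add: maximal_constant_def C_def K_def c_def)
  have K: "0 < K" by (simp add: K_def)
  have pa: "0 < p / a" using par by simp
  have J: "finite J" and F: "disjoint_family_on F J"
    and all: "\<forall>j\<in>J. 0 < R j \<and> E j \<in> sets \<mu> \<and> E j \<subseteq> ball (z j) (R j) \<and>
      emeasure \<mu> (ball (z j) (R j)) \<le> ennreal (Cd ^ 2) * emeasure \<mu> (E j) \<and>
      F j \<in> sets \<mu> \<and> F j \<subseteq> ball (z j) (R j)"
    using balls by (auto simp: sparse_balls_def)
  define e where "e = c / L"
  have e: "0 < e" "e \<le> 1" "(2 * Cd ^ 7) powr e \<le> 1 + 1 / (2 * Cd ^ 3) powr q / L / 2"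
    using c L by (auto simp: e_def)
  define Q where "Q = 1 + p / a * (e / (1 + e))"
  have Q1: "p / a * (c / (2 * L)) \<le> Q - 1"
  proof -
    have "e / 2 \<le> e / (1 + e)" using e by (intro divide_left_mono) auto
    then have "p / a * (e / 2) \<le> p / a * (e / (1 + e))" using pa by (intro mult_left_mono) auto
    then show ?thesis by (simp add: Q_def e_def)
  qed
  have "0 < p / a * (c / (2 * L))" using par c L by (intro mult_pos_pos divide_pos_pos) auto
  then have Q: "1 < Q" using Q1 by linarith
  have "p / a * (e / (1 + e)) \<le> p / a" by (rule mult_left_le) (use e pa in auto)
  then have Q2: "Q \<le> 1 + p / a" unfolding Q_def by linarith
  have const: "Cd ^ 2 * 2 powr Q * Q / (Q - 1) \<le> Cd ^ 2 * 2 powr (1 + p / a) * (1 + p / a) * (2 * a / (p * c)) * L"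
  proof -
    have "Cd ^ 2 * 2 powr Q * Q / (Q - 1) \<le> Cd ^ 2 * 2 powr (1 + p / a) * (1 + p / a) / (p / a * (c / (2 * L)))"
      using Q Q1 Q2 \<open>0 < p / a * (c / (2 * L))\<close>
      by (intro frac_le mult_mono powr_mono mult_nonneg_nonneg) auto
    also have "\<dots> = Cd ^ 2 * 2 powr (1 + p / a) * (1 + p / a) * (2 * a / (p * c)) * L"
      using par c L by simp
    finally show ?thesis .
  qed
  have "(\<Sum>j\<in>J. emeasure \<mu> (F j) * average \<mu> (E j) (\<lambda>x. (w j x powe (1 / a) * H x) powe r) powe (p / r))
    \<le> (\<Sum>j\<in>J. ennreal K * (emeasure \<mu> (F j) * average \<mu> (ball (z j) (R j)) (\<lambda>x. H x powe (p / Q)) powe Q))"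
  proof (rule sum_mono)
    fix j assume "j \<in> J"
    then have "average \<mu> (E j) (\<lambda>x. (w j x powe (1 / a) * H x) powe r) powe (p / r)
      \<le> ennreal K * average \<mu> (ball (z j) (R j)) (\<lambda>x. H x powe (p / Q)) powe Q"
      unfolding K_def Q_def using all e w w1 by (intro weighted_average_bound[OF par _ L q, of "w j"] H) auto
    then have "emeasure \<mu> (F j) * average \<mu> (E j) (\<lambda>x. (w j x powe (1 / a) * H x) powe r) powe (p / r)
      \<le> emeasure \<mu> (F j) * (ennreal K * average \<mu> (ball (z j) (R j)) (\<lambda>x. H x powe (p / Q)) powe Q)"
      by (rule mult_left_mono) simp
    then show "emeasure \<mu> (F j) * average \<mu> (E j) (\<lambda>x. (w j x powe (1 / a) * H x) powe r) powe (p / r)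
      \<le> ennreal K * (emeasure \<mu> (F j) * average \<mu> (ball (z j) (R j)) (\<lambda>x. H x powe (p / Q)) powe Q)"
      by (simp only: mult.left_commute)
  qed
  also have "\<dots> = ennreal K * (\<Sum>j\<in>J. emeasure \<mu> (F j) * average \<mu> (ball (z j) (R j)) (\<lambda>x. H x powe (p / Q)) powe Q)"
    by (rule sum_distrib_left[symmetric])
  also have "\<dots> \<le> ennreal K * (ennreal (Cd ^ 2 * 2 powr Q * Q / (Q - 1)) * (\<integral>\<^sup>+x. (H x powe (p / Q)) powe Q \<partial>\<mu>))"
    using all by (intro mult_left_mono maximal_inequality_finite J F Q) auto
  also have "(\<lambda>x. (H x powe (p / Q)) powe Q) = (\<lambda>x. H x powe p)"
    using Q by (simp add: powe_powe)
  also have "ennreal K * (ennreal (Cd ^ 2 * 2 powr Q * Q / (Q - 1)) * (\<integral>\<^sup>+x. H x powe p \<partial>\<mu>))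
    \<le> ennreal K * (ennreal (Cd ^ 2 * 2 powr (1 + p / a) * (1 + p / a) * (2 * a / (p * c)) * L) * (\<integral>\<^sup>+x. H x powe p \<partial>\<mu>))"
    by (intro mult_left_mono mult_right_mono ennreal_leI const) auto
  also have "\<dots> = ennreal (C * L) * (\<integral>\<^sup>+x. H x powe p \<partial>\<mu>)"
  proof -
    have "ennreal (C * L) = ennreal K * ennreal (Cd ^ 2 * 2 powr (1 + p / a) * (1 + p / a) * (2 * a / (p * c)) * L)"
      using K pa par c L by (subst ennreal_mult[symmetric]) (auto simp: C_def mult_ac intro!: mult_nonneg_nonneg)
    then show ?thesis by (simp only: mult.assoc)
  qed
  finally show ?thesis unfolding C_eq .
qed

end

section \<open>The Hermitian inner product and the spectral theorem\<close>

lemma cdot_add_left: "cdot (u + v) w = cdot u w + cdot v w"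
  by (simp add: cdot_def distrib_right sum.distrib)

lemma cdot_diff_left: "cdot (u - v) w = cdot u w - cdot v w"
  by (simp add: cdot_def left_diff_distrib sum_subtractf)

lemma cdot_scale_left: "cdot (c *s u) w = c * cdot u w"
  by (simp add: cdot_def sum_distrib_left mult.assoc)

lemma cdot_scaleR_left: "cdot (r *\<^sub>R u) w = r *\<^sub>R cdot u w"
  by (simp add: cdot_def scaleR_sum_right)

lemma cdot_scaleR_right: "cdot u (r *\<^sub>R w) = r *\<^sub>R cdot u w"
  by (simp add: cdot_def scaleR_sum_right)

lemma cdot_zero [simp]: "cdot 0 w = 0" "cdot w 0 = 0"
  by (simp_all add: cdot_def)

lemma cdot_sum_left: "cdot (\<Sum>i\<in>I. f i) w = (\<Sum>i\<in>I. cdot (f i) w)"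
  by (induction I rule: infinite_finite_induct) (auto simp: cdot_add_left)

lemma cdot_commute: "cdot v u = cnj (cdot u v)"
  by (simp add: cdot_def cnj_sum mult.commute)

lemma Re_cdot: "Re (cdot u v) = inner u v"
  by (simp add: cdot_def inner_vec_def inner_complex_def)

lemma cdot_self: "cdot u u = complex_of_real ((norm u)\<^sup>2)"
proof -
  have "Im (cdot u u) = 0" by (simp add: cdot_def mult.commute)
  moreover have "Re (cdot u u) = (norm u)\<^sup>2" by (simp add: Re_cdot power2_norm_eq_inner)
  ultimately show ?thesis by (simp add: complex_eq_iff)
qed

lemma cdot_matrix_adjoint: "cdot (A *v u) v = cdot u (adjoint_matrix A *v v)"
proof -
  have "cdot (A *v u) v = (\<Sum>i\<in>UNIV. \<Sum>j\<in>UNIV. A $ i $ j * u $ j * cnj (v $ i))"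
    by (simp add: cdot_def matrix_vector_mult_def sum_distrib_right)
  also have "\<dots> = (\<Sum>j\<in>UNIV. \<Sum>i\<in>UNIV. A $ i $ j * u $ j * cnj (v $ i))" by (rule sum.swap)
  also have "\<dots> = cdot u (adjoint_matrix A *v v)"
    by (simp add: cdot_def matrix_vector_mult_def adjoint_matrix_def sum_distrib_left cnj_sum mult_ac)
  finally show ?thesis .
qed

lemma cdot_cauchy_schwarz: "norm (cdot u v) \<le> norm u * norm v"
proof -
  obtain c where c: "norm c = 1" "c * cdot u v = of_real (norm (cdot u v))"
  proof (cases "cdot u v = 0")
    case False
    then show ?thesis
      by (intro that[of "of_real (norm (cdot u v)) / cdot u v"]) (auto simp: norm_divide)
  qed (auto intro: that[of 1])
  have nc: "norm (c *s u) = norm u"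
    using c(1) by (simp add: norm_vec_def norm_mult)
  have "norm (cdot u v) = Re (cdot (c *s u) v)" using c by (simp add: cdot_scale_left)
  also have "\<dots> = inner (c *s u) v" by (rule Re_cdot)
  also have "\<dots> \<le> norm (c *s u) * norm v" by (rule norm_cauchy_schwarz)
  finally show ?thesis using nc by simp
qed

lemma adjoint_matrix_mult: "adjoint_matrix (A ** B) = adjoint_matrix B ** adjoint_matrix A"
  by (simp add: adjoint_matrix_def matrix_matrix_mult_def vec_eq_iff cnj_sum mult.commute)

lemma adjoint_adjoint [simp]: "adjoint_matrix (adjoint_matrix A) = A"
  by (simp add: adjoint_matrix_def vec_eq_iff)

lemma adjoint_diag [simp]: "adjoint_matrix (diag_matrix l) = diag_matrix l"
  by (auto simp: adjoint_matrix_def diag_matrix_def vec_eq_iff)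

lemma diag_matrix_mult_component: "(diag_matrix l ** A) $ i $ j = l i * A $ i $ j"
  by (simp add: diag_matrix_def matrix_matrix_mult_def if_distrib if_distribR cong: if_cong)

lemma mult_diag_matrix_component: "(A ** diag_matrix l) $ i $ j = A $ i $ j * l j"
  by (simp add: diag_matrix_def matrix_matrix_mult_def if_distrib if_distribR cong: if_cong)

lemma diag_matrix_mult: "diag_matrix k ** diag_matrix l = diag_matrix (\<lambda>i. k i * l i)"
  by (simp only: vec_eq_iff diag_matrix_mult_component) (simp add: diag_matrix_def)

text \<open>A maximizer of the Rayleigh quotient over the unit sphere of \<open>V\<close> is an eigenvector: otherwise a small
  step in the direction \<open>A v - m v\<close> would increase it.\<close>

lemma hermitian_eigenvector_in_subspace:
  fixes A :: "complex ^ 'n ^ 'n"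
  assumes A: "adjoint_matrix A = A"
    and V: "subspace V" "\<And>c v. v \<in> V \<Longrightarrow> c *s v \<in> V" "\<And>v. v \<in> V \<Longrightarrow> A *v v \<in> V" "\<exists>v\<in>V. v \<noteq> 0"
  shows "\<exists>v\<in>V. norm v = 1 \<and> (\<exists>m::real. A *v v = m *\<^sub>R v)"
proof -
  define S where "S = V \<inter> sphere 0 1"
  have "compact S" unfolding S_def
    using closed_subspace[OF V(1)] by (intro closed_Int_compact) auto
  moreover obtain u where u: "u \<in> V" "u \<noteq> 0" using V(4) by blast
  have "(1 / norm u) *\<^sub>R u \<in> S" using u V(1) by (auto simp: S_def subspace_scale)
  then have "S \<noteq> {}" by blast
  moreover have "continuous_on S (\<lambda>v. inner (A *v v) v)"
    by (intro continuous_intros matrix_vector_mult_linear_continuous_on)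
  ultimately obtain v where v: "v \<in> S" "\<And>y. y \<in> S \<Longrightarrow> inner (A *v y) y \<le> inner (A *v v) v"
    using continuous_attains_sup[of S "\<lambda>v. inner (A *v v) v"] by auto
  define m where "m = inner (A *v v) v"
  have vV: "v \<in> V" "norm v = 1" using v(1) by (auto simp: S_def)
  have le: "inner (A *v y) y \<le> m * inner y y" if "y \<in> V" for y
  proof (cases "y = 0")
    case False
    have Ay: "A *v (k *\<^sub>R y) = k *\<^sub>R (A *v y)" for k :: real
      by (simp add: matrix_vector_mult_def vec_eq_iff scaleR_sum_right)
    have "(1 / norm y) *\<^sub>R y \<in> S" using that False V(1) by (auto simp: S_def subspace_scale)
    from v(2)[OF this] have "inner (A *v y) y / (norm y)\<^sup>2 \<le> m"
      by (simp add: Ay m_def power2_eq_square)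
    then show ?thesis using False by (simp add: divide_le_eq power2_norm_eq_inner)
  qed simp
  define w where "w = m *\<^sub>R v - A *v v"
  have wV: "w \<in> V" unfolding w_def using vV V by (intro subspace_diff subspace_scale) auto
  have self: "inner (A *v x) y = inner x (A *v y)" for x y
    unfolding Re_cdot[symmetric] cdot_matrix_adjoint A ..
  have Ak: "A *v (k *\<^sub>R y) = k *\<^sub>R (A *v y)" for y and k :: real
    by (simp add: matrix_vector_mult_def vec_eq_iff scaleR_sum_right)
  have lin: "A *v (x + k *\<^sub>R y) = A *v x + k *\<^sub>R (A *v y)" for x y and k :: real
    by (simp add: matrix_vector_mult_def vec_eq_iff scaleR_sum_right sum.distrib distrib_left)
  have quad: "0 \<le> 2 * k * inner w w + k\<^sup>2 * (m * inner w w - inner (A *v w) w)" for k :: real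
  proof -
    have "v + k *\<^sub>R w \<in> V" using vV wV V(1) by (intro subspace_add subspace_scale)
    from le[OF this] have "0 \<le> m * inner (v + k *\<^sub>R w) (v + k *\<^sub>R w) - inner (A *v (v + k *\<^sub>R w)) (v + k *\<^sub>R w)"
      by simp
    also have "\<dots> = (m * inner v v - inner (A *v v) v) + 2 * k * inner w w + k\<^sup>2 * (m * inner w w - inner (A *v w) w)"
    proof -
      have ww: "inner w w = m * inner v w - inner (A *v v) w" by (simp add: w_def inner_diff_left)
      have "inner (A *v w) v = inner (A *v v) w" using self[of w v] by (simp add: inner_commute)
      from ww have e: "m * inner v w = inner w w + inner (A *v v) w" by linarith
      have "m * inner (v + k *\<^sub>R w) (v + k *\<^sub>R w) - inner (A *v (v + k *\<^sub>R w)) (v + k *\<^sub>R w)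
        = m * inner v v + 2 * k * (m * inner v w) + k\<^sup>2 * (m * inner w w)
          - (inner (A *v v) v + k * inner (A *v v) w + k * inner (A *v w) v + k\<^sup>2 * inner (A *v w) w)"
        unfolding lin by (simp add: inner_add_left inner_add_right power2_eq_square algebra_simps inner_commute)
      then show ?thesis
        unfolding e \<open>inner (A *v w) v = inner (A *v v) w\<close> by (simp add: algebra_simps)
    qed
    also have "m * inner v v = inner (A *v v) v" using vV by (simp add: m_def norm_eq_1)
    finally show ?thesis by simp
  qed
  have "inner w w = 0"
  proof (rule ccontr)
    assume "inner w w \<noteq> 0"
    then have pos: "0 < inner w w" by (simp add: less_le)
    define c where "c = m * inner w w - inner (A *v w) w"
    have c: "0 \<le> c" using le[OF wV] by (simp add: c_def)
    \<comment> \<open>A negative step, small compared with the coefficient of the quadratic term, contradicts \<open>quad\<close>.\<close>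
    define k where "k = - (inner w w / (c + 1))"
    have "2 * k * inner w w + k\<^sup>2 * c < 0"
    proof -
      have "k\<^sup>2 * c \<le> k\<^sup>2 * (c + 1)" by (intro mult_left_mono) auto
      also have "\<dots> = - k * inner w w" using c by (simp add: k_def power2_eq_square)
      finally have "2 * k * inner w w + k\<^sup>2 * c \<le> k * inner w w" by simp
      also have "\<dots> < 0" using pos c by (simp add: k_def mult_neg_pos)
      finally show ?thesis .
    qed
    then show False using quad[of k] by (simp add: c_def)
  qed
  then have "A *v v = m *\<^sub>R v" by (simp add: w_def)
  then show ?thesis using vV by blast
qed

text \<open>The orthogonal complement of the eigenvectors already found is invariant and, for dimension reasons,
  not zero, so it contains a further one.\<close>

lemma hermitian_orthonormal_eigenvectors:
  fixes A :: "complex ^ 'n ^ 'n" and I :: "'n set"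
  assumes A: "adjoint_matrix A = A"
  shows "\<exists>u l. (\<forall>i\<in>I. \<forall>j\<in>I. cdot (u i) (u j) = (if i = j then 1 else 0)) \<and>
    (\<forall>i\<in>I. A *v u i = (l i :: real) *\<^sub>R u i)"
proof -
  have "finite I" by simp
  then show ?thesis
  proof (induction I rule: finite_induct)
    case (insert k I)
    then obtain u l where ul: "\<And>i j. i \<in> I \<Longrightarrow> j \<in> I \<Longrightarrow> cdot (u i) (u j) = (if i = j then 1 else 0)"
      "\<And>i. i \<in> I \<Longrightarrow> A *v u i = (l i :: real) *\<^sub>R u i" by blast
    define V where "V = {v. \<forall>i\<in>I. cdot v (u i) = 0}"
    have "subspace V" by (auto simp: V_def subspace_def cdot_add_left cdot_scaleR_left)
    moreover have "c *s v \<in> V" if "v \<in> V" for c v using that by (simp add: V_def cdot_scale_left)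
    moreover have "A *v v \<in> V" if "v \<in> V" for v
      using that ul(2) by (simp add: V_def cdot_matrix_adjoint A cdot_scaleR_right)
    moreover have "\<exists>v\<in>V. v \<noteq> 0"
    proof -
      have "vec.dim (u ` I) \<le> card (u ` I)" by (simp add: vec.dim_le_card')
      also have "\<dots> \<le> card I" by (rule card_image_le) (use insert in simp)
      also have "\<dots> < CARD('n)" using insert by (intro psubset_card_mono) auto
      finally have less: "vec.dim (u ` I) < CARD('n)" .
      have "vec.span (u ` I) \<noteq> UNIV"
      proof
        assume eq: "vec.span (u ` I) = UNIV"
        show False using vec.dim_span[of "u ` I"] less unfolding eq vec_dim_card by simp
      qed
      then obtain x where x: "x \<notin> vec.span (u ` I)" by blast
      define y where "y = x - (\<Sum>i\<in>I. cdot x (u i) *s u i)"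
      have "(\<Sum>i\<in>I. cdot x (u i) *s u i) \<in> vec.span (u ` I)"
        by (intro vec.span_sum vec.span_scale vec.span_base) auto
      then have "y \<noteq> 0" using x by (auto simp: y_def)
      moreover have "y \<in> V"
        unfolding V_def
      proof (intro CollectI ballI)
        fix j assume j: "j \<in> I"
        have "(\<Sum>i\<in>I. cdot x (u i) * cdot (u i) (u j)) = (\<Sum>i\<in>I. if i = j then cdot x (u j) else 0)"
          using ul(1) j by (intro sum.cong) auto
        then show "cdot y (u j) = 0"
          using j insert(1) by (simp add: y_def cdot_diff_left cdot_sum_left cdot_scale_left)
      qed
      ultimately show ?thesis by blast
    qed
    ultimately obtain v m where v: "v \<in> V" "norm v = 1" "A *v v = (m::real) *\<^sub>R v"
      using hermitian_eigenvector_in_subspace[OF A, of V] by blast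
    have vu: "cdot v (u i) = 0" "cdot (u i) v = 0" if "i \<in> I" for i
      using v(1) that cdot_commute[of "u i" v] by (auto simp: V_def)
    have vv: "cdot v v = 1" using v(2) by (simp add: cdot_self)
    show ?case
      using ul v(3) vu vv insert(2)
      by (intro exI[of _ "u(k := v)"] exI[of _ "l(k := m)"]) auto
  qed auto
qed

definition diagonalizes :: "complex ^ 'n ^ 'n \<Rightarrow> ('n \<Rightarrow> real) \<Rightarrow> complex ^ 'n ^ 'n \<Rightarrow> bool"
  where "diagonalizes U l A \<longleftrightarrow> unitary_matrix U \<and> (\<forall>i. 0 < l i) \<and> A = U ** diag_matrix l ** adjoint_matrix U"

lemma unitary_matrix_cancel:
  assumes "unitary_matrix U"
  shows "U ** (adjoint_matrix U ** A) = A" "adjoint_matrix U ** (U ** A) = A"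
  using assms by (simp_all add: unitary_matrix_def matrix_mul_assoc)

lemma pos_def_diagonalizable:
  fixes A :: "complex ^ 'n ^ 'n"
  assumes "pos_def A"
  shows "\<exists>U l. diagonalizes U l A"
proof -
  have A: "adjoint_matrix A = A" using assms by (simp add: pos_def_def)
  obtain u l where u: "\<And>i j :: 'n. cdot (u i) (u j) = (if i = j then 1 else 0)" "\<And>i. A *v u i = (l i :: real) *\<^sub>R u i"
    using hermitian_orthonormal_eigenvectors[OF A, of UNIV] by auto
  define U :: "complex ^ 'n ^ 'n" where "U = (\<chi> i j. u j $ i)"
  have "(adjoint_matrix U ** U) $ i $ j = (mat 1 :: complex ^ 'n ^ 'n) $ i $ j" for i j
  proof -
    have "(adjoint_matrix U ** U) $ i $ j = cdot (u j) (u i)"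
      by (simp add: adjoint_matrix_def matrix_matrix_mult_def U_def cdot_def mult.commute)
    then show ?thesis using u(1)[of j i] by (simp add: mat_def)
  qed
  then have UU: "adjoint_matrix U ** U = mat 1" by (simp add: vec_eq_iff)
  then have UU': "U ** adjoint_matrix U = mat 1" by (simp add: matrix_left_right_inverse)
  have unit: "unitary_matrix U" using UU UU' by (simp add: unitary_matrix_def)
  have "(A ** U) $ i $ j = (U ** diag_matrix l) $ i $ j" for i j
  proof -
    have "(A ** U) $ i $ j = (A *v u j) $ i"
      by (simp add: matrix_matrix_mult_def matrix_vector_mult_def U_def)
    also have "\<dots> = (U ** diag_matrix l) $ i $ j"
      unfolding mult_diag_matrix_component u(2) by (simp add: U_def scaleR_conv_of_real[where 'a = complex])
    finally show ?thesis .
  qed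
  then have "A ** U = U ** diag_matrix l" by (simp add: vec_eq_iff)
  then have "A ** U ** adjoint_matrix U = U ** diag_matrix l ** adjoint_matrix U" by simp
  then have "A = U ** diag_matrix l ** adjoint_matrix U"
    by (simp add: matrix_mul_assoc[symmetric] UU')
  moreover have "0 < l i" for i
  proof -
    have "u i \<noteq> 0" using u(1)[of i i] by auto
    then have "0 < Re (cdot (A *v u i) (u i))" using assms by (simp add: pos_def_def)
    then show ?thesis by (simp add: u cdot_scaleR_left)
  qed
  ultimately show ?thesis using unit by (auto simp: diagonalizes_def)
qed

text \<open>A function of a matrix does not depend on the diagonalization: \<open>Z = U'\<^sup>* U\<close> intertwines the two
  diagonal matrices, \<open>Z\<^bsub>ij\<^esub> l\<^sub>j = l'\<^sub>i Z\<^bsub>ij\<^esub>\<close>, so that an entry of \<open>Z\<close> can differ from 0 only where the two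
  eigenvalues agree, and then \<open>h\<close> takes the same value on both.\<close>

lemma diagonalizes_function_unique:
  assumes "diagonalizes U l A" "diagonalizes U' l' A"
  shows "U ** diag_matrix (\<lambda>i. h (l i)) ** adjoint_matrix U = U' ** diag_matrix (\<lambda>i. h (l' i)) ** adjoint_matrix U'"
proof -
  have U: "unitary_matrix U" "unitary_matrix U'" using assms by (auto simp: diagonalizes_def)
  have eq: "U ** diag_matrix l ** adjoint_matrix U = U' ** diag_matrix l' ** adjoint_matrix U'"
    using assms by (auto simp: diagonalizes_def)
  define Z where "Z = adjoint_matrix U' ** U"
  have "adjoint_matrix U' ** (U ** diag_matrix l ** adjoint_matrix U) ** U = adjoint_matrix U' ** (U' ** diag_matrix l' ** adjoint_matrix U') ** U"
    by (simp add: eq)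
  then have Z: "Z ** diag_matrix l = diag_matrix l' ** Z"
    using U by (simp add: Z_def matrix_mul_assoc[symmetric] unitary_matrix_cancel unitary_matrix_def)
  have "Z ** diag_matrix (\<lambda>i. h (l i)) = diag_matrix (\<lambda>i. h (l' i)) ** Z"
  proof (simp only: vec_eq_iff mult_diag_matrix_component diag_matrix_mult_component, intro allI)
    fix i j
    have "Z $ i $ j * l j = l' i * Z $ i $ j"
      using Z by (metis mult_diag_matrix_component diag_matrix_mult_component)
    then have "Z $ i $ j = 0 \<or> l j = l' i"
      by (metis mult.commute mult_cancel_left of_real_eq_iff)
    then show "Z $ i $ j * h (l j) = h (l' i) * Z $ i $ j" by auto
  qed
  then have "U' ** (Z ** diag_matrix (\<lambda>i. h (l i))) ** adjoint_matrix U = U' ** (diag_matrix (\<lambda>i. h (l' i)) ** Z) ** adjoint_matrix U"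
    by simp
  then show ?thesis
    using U by (simp add: Z_def matrix_mul_assoc[symmetric] unitary_matrix_cancel unitary_matrix_def)
qed

lemma mat_powr_eq:
  assumes "diagonalizes U l A"
  shows "mat_powr A r = U ** diag_matrix (\<lambda>i. l i powr r) ** adjoint_matrix U"
  unfolding mat_powr_def
proof (rule the_equality)
  show "\<exists>U' l'. unitary_matrix U' \<and> (\<forall>i. 0 < l' i) \<and> A = U' ** diag_matrix l' ** adjoint_matrix U' \<and>
    U ** diag_matrix (\<lambda>i. l i powr r) ** adjoint_matrix U = U' ** diag_matrix (\<lambda>i. l' i powr r) ** adjoint_matrix U'"
    using assms unfolding diagonalizes_def by blast
next
  fix B assume "\<exists>U' l'. unitary_matrix U' \<and> (\<forall>i. 0 < l' i) \<and> A = U' ** diag_matrix l' ** adjoint_matrix U' \<and>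
    B = U' ** diag_matrix (\<lambda>i. l' i powr r) ** adjoint_matrix U'"
  then obtain U' l' where "diagonalizes U' l' A" "B = U' ** diag_matrix (\<lambda>i. l' i powr r) ** adjoint_matrix U'"
    unfolding diagonalizes_def by blast
  then show "B = U ** diag_matrix (\<lambda>i. l i powr r) ** adjoint_matrix U"
    using diagonalizes_function_unique[OF _ assms, of U' l' "\<lambda>x. x powr r"] by simp
qed

lemma diagonalizes_mat_powr:
  assumes d: "diagonalizes U l A"
  shows "diagonalizes U (\<lambda>i. l i powr r) (mat_powr A r)"
proof -
  have "l i \<noteq> 0" for i using d by (auto simp: diagonalizes_def dest: spec[of _ i])
  then show ?thesis unfolding mat_powr_eq[OF d] using d by (simp add: diagonalizes_def)
qed

lemma mat_powr_mat_powr: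
  assumes "pos_def A"
  shows "mat_powr (mat_powr A r) s = mat_powr A (r * s)"
proof -
  obtain U l where d: "diagonalizes U l A" using pos_def_diagonalizable[OF assms] by blast
  show ?thesis
    unfolding mat_powr_eq[OF diagonalizes_mat_powr[OF d]] unfolding mat_powr_eq[OF d] by (simp add: powr_powr)
qed

lemma mat_powr_inverse:
  assumes "pos_def A"
  shows "mat_powr A r ** mat_powr A (- r) = mat 1"
proof -
  obtain U l where d: "diagonalizes U l A" using pos_def_diagonalizable[OF assms] by blast
  then have U: "unitary_matrix U" and l: "\<And>i. l i > 0" by (auto simp: diagonalizes_def)
  have one: "diag_matrix (\<lambda>i. l i powr r * l i powr (- r)) = mat 1"
    using l by (auto simp: diag_matrix_def mat_def vec_eq_iff powr_minus less_imp_neq[symmetric])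
  have "mat_powr A r ** mat_powr A (- r) = U ** (diag_matrix (\<lambda>i. l i powr r) ** diag_matrix (\<lambda>i. l i powr (- r))) ** adjoint_matrix U"
    unfolding mat_powr_eq[OF d] by (simp add: matrix_mul_assoc[symmetric] unitary_matrix_cancel[OF U])
  then show ?thesis using U by (simp add: diag_matrix_mult one unitary_matrix_def)
qed

lemma mat_powr_adjoint:
  assumes "pos_def A"
  shows "adjoint_matrix (mat_powr A r) = mat_powr A r"
proof -
  obtain U l where d: "diagonalizes U l A" using pos_def_diagonalizable[OF assms] by blast
  show ?thesis unfolding mat_powr_eq[OF d] by (simp add: adjoint_matrix_mult matrix_mul_assoc)
qed

section \<open>Measurability of matrix powers and of the spectral norm\<close>

primrec mat_pow :: "complex ^ 'n ^ 'n \<Rightarrow> nat \<Rightarrow> complex ^ 'n ^ 'n" where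
  "mat_pow A 0 = mat 1"
| "mat_pow A (Suc k) = A ** mat_pow A k"

text \<open>The spectrum of \<open>A / tr A\<close> lies in \<open>(0, 1]\<close> for positive definite \<open>A\<close>, so the binomial series of
  \<open>(1 + X)^r\<close> with \<open>X = A / tr A - 1\<close> converges to \<open>(A / tr A)^r\<close>. This exhibits \<open>A^r\<close> as a limit of
  measurable functions of \<open>A\<close> without a measurable choice of a diagonalization.\<close>

definition binomial_partial_sum :: "real \<Rightarrow> nat \<Rightarrow> complex ^ 'n ^ 'n \<Rightarrow> complex ^ 'n ^ 'n"
  where "binomial_partial_sum r N A =
    (\<Sum>k<N. (r gchoose k) *\<^sub>R mat_pow ((1 / Re (trace A)) *\<^sub>R A - mat 1) k)"

lemma scaleR_matrix_mult: "(c *\<^sub>R A) ** B = c *\<^sub>R (A ** B)" "A ** (c *\<^sub>R B) = c *\<^sub>R (A ** B)"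
  for A :: "complex ^ 'n ^ 'm" and B :: "complex ^ 'k ^ 'n"
  by (simp_all add: matrix_matrix_mult_def vec_eq_iff scaleR_sum_right)

lemma matrix_mult_distribs:
  fixes A A' :: "complex ^ 'n ^ 'm" and B B' :: "complex ^ 'k ^ 'n"
  shows "(A + A') ** B = A ** B + A' ** B" "(A - A') ** B = A ** B - A' ** B"
    "A ** (B + B') = A ** B + A ** B'" "A ** (B - B') = A ** B - A ** B'" "0 ** B = 0" "A ** 0 = 0"
  by (simp_all add: matrix_matrix_mult_def vec_eq_iff sum.distrib sum_subtractf algebra_simps)

lemma sum_matrix_mult: "(\<Sum>k\<in>I. f k) ** B = (\<Sum>k\<in>I. f k ** B)" "A ** (\<Sum>k\<in>I. g k) = (\<Sum>k\<in>I. A ** g k)"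
  for f :: "_ \<Rightarrow> complex ^ 'n ^ 'm" and B :: "complex ^ 'k ^ 'n" and A :: "complex ^ 'n ^ 'm" and g :: "_ \<Rightarrow> complex ^ 'k ^ 'n"
  by (induction I rule: infinite_finite_induct) (auto simp: matrix_mult_distribs)

lemma binomial_partial_sum_diag:
  assumes d: "diagonalizes U l A"
  shows "binomial_partial_sum r N A =
    U ** diag_matrix (\<lambda>i. \<Sum>k<N. (r gchoose k) * (l i / sum l UNIV - 1) ^ k) ** adjoint_matrix U"
proof -
  have U: "unitary_matrix U" and A: "A = U ** diag_matrix l ** adjoint_matrix U" using d by (auto simp: diagonalizes_def)
  have "trace A = trace (adjoint_matrix U ** (U ** diag_matrix l))"
    unfolding A by (rule trace_mul_sym)
  also have "\<dots> = trace (diag_matrix l)" by (simp add: unitary_matrix_cancel[OF U])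
  also have "\<dots> = of_real (sum l UNIV)" by (simp add: trace_def diag_matrix_def)
  finally have tr: "Re (trace A) = sum l UNIV" by simp
  have base: "(1 / sum l UNIV) *\<^sub>R A - mat 1 = U ** diag_matrix (\<lambda>i. l i / sum l UNIV - 1) ** adjoint_matrix U"
  proof -
    have dg: "diag_matrix (\<lambda>i. l i / sum l UNIV - 1) = (1 / sum l UNIV) *\<^sub>R diag_matrix l - mat 1"
      by (auto simp: diag_matrix_def mat_def vec_eq_iff scaleR_conv_of_real[where 'a = complex])
    show ?thesis
      unfolding dg A using U
      by (simp add: matrix_mult_distribs scaleR_matrix_mult unitary_matrix_def)
  qed
  have pw: "mat_pow (U ** diag_matrix k ** adjoint_matrix U) n = U ** diag_matrix (\<lambda>i. k i ^ n) ** adjoint_matrix U" for k n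
  proof (induction n)
    case 0
    have "diag_matrix (\<lambda>i. 1) = (mat 1 :: complex ^ 'a ^ 'a)" by (auto simp: diag_matrix_def mat_def vec_eq_iff)
    then show ?case using U by (simp add: unitary_matrix_def)
  next
    case (Suc n)
    have "mat_pow (U ** diag_matrix k ** adjoint_matrix U) (Suc n)
      = U ** (diag_matrix k ** diag_matrix (\<lambda>i. k i ^ n)) ** adjoint_matrix U"
      unfolding mat_pow.simps Suc by (simp add: matrix_mul_assoc[symmetric] unitary_matrix_cancel[OF U])
    then show ?case by (simp add: diag_matrix_mult)
  qed
  have sm: "diag_matrix (\<lambda>i. \<Sum>k<N. (r gchoose k) * (l i / sum l UNIV - 1) ^ k)
    = (\<Sum>k<N. (r gchoose k) *\<^sub>R diag_matrix (\<lambda>i. (l i / sum l UNIV - 1) ^ k))"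
    by (auto simp: diag_matrix_def vec_eq_iff scaleR_conv_of_real[where 'a = complex] sum_component)
  show ?thesis
    unfolding binomial_partial_sum_def tr base pw sm
    by (simp add: sum_matrix_mult scaleR_matrix_mult)
qed

lemma binomial_partial_sum_tendsto:
  assumes "pos_def A"
  shows "(\<lambda>N. (Re (trace A) powr r) *\<^sub>R binomial_partial_sum r N A) \<longlonglongrightarrow> mat_powr A r"
proof -
  obtain U l where d: "diagonalizes U l A" using pos_def_diagonalizable[OF assms] by blast
  then have U: "unitary_matrix U" and l: "\<And>i. l i > 0" and A: "A = U ** diag_matrix l ** adjoint_matrix U"
    by (auto simp: diagonalizes_def)
  have "trace A = trace (adjoint_matrix U ** (U ** diag_matrix l))"
    unfolding A by (rule trace_mul_sym)
  also have "\<dots> = trace (diag_matrix l)" by (simp add: unitary_matrix_cancel[OF U])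
  also have "\<dots> = of_real (sum l UNIV)" by (simp add: trace_def diag_matrix_def)
  finally have tr: "Re (trace A) = sum l UNIV" by simp
  have T: "0 < sum l UNIV" using l by (intro sum_pos) auto
  have le: "l i \<le> sum l UNIV" for i using l by (intro member_le_sum) (auto intro: less_imp_le)
  have conv: "(\<lambda>N. \<Sum>k<N. (r gchoose k) * (l i / sum l UNIV - 1) ^ k) \<longlonglongrightarrow> (l i / sum l UNIV) powr r" for i
  proof -
    have "\<bar>l i / sum l UNIV - 1\<bar> < 1" using T l[of i] le[of i] by (simp add: abs_less_iff divide_le_eq)
    from gen_binomial_real[OF this, of r] show ?thesis by (simp add: sums_def)
  qed
  have "(\<lambda>N. (sum l UNIV powr r) *\<^sub>R (U ** diag_matrix (\<lambda>i. \<Sum>k<N. (r gchoose k) * (l i / sum l UNIV - 1) ^ k) ** adjoint_matrix U))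
    \<longlonglongrightarrow> (sum l UNIV powr r) *\<^sub>R (U ** diag_matrix (\<lambda>i. (l i / sum l UNIV) powr r) ** adjoint_matrix U)"
  proof (intro tendsto_scaleR tendsto_const vec_tendstoI)
    fix i j
    have eq: "(U ** diag_matrix k ** adjoint_matrix U) $ i $ j = (\<Sum>n\<in>UNIV. U $ i $ n * k n * adjoint_matrix U $ n $ j)" for k
      by (simp add: matrix_matrix_mult_def[of "U ** diag_matrix k"] mult_diag_matrix_component)
    show "(\<lambda>N. (U ** diag_matrix (\<lambda>i. \<Sum>k<N. (r gchoose k) * (l i / sum l UNIV - 1) ^ k) ** adjoint_matrix U) $ i $ j)
      \<longlonglongrightarrow> (U ** diag_matrix (\<lambda>i. (l i / sum l UNIV) powr r) ** adjoint_matrix U) $ i $ j"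
      unfolding eq by (intro tendsto_intros conv)
  qed
  moreover have "(sum l UNIV powr r) *\<^sub>R (U ** diag_matrix (\<lambda>i. (l i / sum l UNIV) powr r) ** adjoint_matrix U) = mat_powr A r"
  proof -
    have "diag_matrix (\<lambda>i. l i powr r) = (sum l UNIV powr r) *\<^sub>R diag_matrix (\<lambda>i. (l i / sum l UNIV) powr r)"
    proof -
      have "sum l UNIV powr r * (l i / sum l UNIV) powr r = l i powr r" for i
        using T l[of i] by (simp add: powr_mult[symmetric])
      then show ?thesis
        by (auto simp: diag_matrix_def vec_eq_iff scaleR_conv_of_real[where 'a = complex] simp flip: of_real_mult)
    qed
    then show ?thesis unfolding mat_powr_eq[OF d] by (simp add: scaleR_matrix_mult)
  qed
  ultimately show ?thesis unfolding tr binomial_partial_sum_diag[OF d] by simp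
qed

lemma measurable_matrix_mult [measurable]:
  fixes f :: "'a \<Rightarrow> complex ^ 'n ^ 'm" and g :: "'a \<Rightarrow> complex ^ 'k ^ 'n"
  assumes "f \<in> borel_measurable M" "g \<in> borel_measurable M"
  shows "(\<lambda>x. f x ** g x) \<in> borel_measurable M"
proof -
  have "continuous_on UNIV (\<lambda>p :: (complex ^ 'n ^ 'm) \<times> (complex ^ 'k ^ 'n). fst p ** snd p)"
    unfolding matrix_matrix_mult_def by (intro continuous_intros)
  from borel_measurable_continuous_Pair[OF assms, of "\<lambda>x y. x ** y"] this show ?thesis by simp
qed

lemma measurable_matrix_vector_mult [measurable]:
  fixes f :: "'a \<Rightarrow> complex ^ 'n ^ 'm" and g :: "'a \<Rightarrow> complex ^ 'n"
  assumes "f \<in> borel_measurable M" "g \<in> borel_measurable M"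
  shows "(\<lambda>x. f x *v g x) \<in> borel_measurable M"
proof -
  have "continuous_on UNIV (\<lambda>p :: (complex ^ 'n ^ 'm) \<times> (complex ^ 'n). fst p *v snd p)"
    unfolding matrix_vector_mult_def by (intro continuous_intros)
  from borel_measurable_continuous_Pair[OF assms, of "\<lambda>x y. x *v y"] this show ?thesis by simp
qed

lemma measurable_mat_powr:
  assumes W [measurable]: "W \<in> borel_measurable M" and pd: "\<And>x. pos_def (W x)"
  shows "(\<lambda>x. mat_powr (W x) r) \<in> borel_measurable M"
proof (rule borel_measurable_LIMSEQ_metric)
  show "(\<lambda>N. (Re (trace (W x)) powr r) *\<^sub>R binomial_partial_sum r N (W x)) \<longlonglongrightarrow> mat_powr (W x) r" for x
    by (rule binomial_partial_sum_tendsto[OF pd])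
  have tr [measurable]: "(\<lambda>x. Re (trace (W x))) \<in> borel_measurable M"
  proof -
    have "continuous_on UNIV (\<lambda>A :: complex ^ 'b ^ 'b. Re (trace A))"
      unfolding trace_def by (intro continuous_intros)
    then show ?thesis by (rule borel_measurable_continuous_on[OF _ W])
  qed
  have pow [measurable]: "(\<lambda>x. mat_pow ((1 / Re (trace (W x))) *\<^sub>R W x - mat 1) k) \<in> borel_measurable M" for k
    by (induction k) (auto intro!: measurable_matrix_mult)
  show "(\<lambda>x. (Re (trace (W x)) powr r) *\<^sub>R binomial_partial_sum r N (W x)) \<in> borel_measurable M" for N
    unfolding binomial_partial_sum_def by measurable
qed

lemma bounded_linear_matrix_vector_mult: "bounded_linear ((*v) A)" for A :: "complex ^ 'n ^ 'm"
  by (rule linear_conv_bounded_linear[THEN iffD1], rule linearI)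
    (simp_all add: matrix_vector_mult_def vec_eq_iff distrib_left sum.distrib scaleR_sum_right)

lemma norm_matrix_vector_le: "norm (A *v v) \<le> spectral_norm A * norm v"
  unfolding spectral_norm_def by (rule onorm[OF bounded_linear_matrix_vector_mult])

lemma spectral_norm_nonneg: "0 \<le> spectral_norm A"
  unfolding spectral_norm_def by (rule onorm_pos_le[OF bounded_linear_matrix_vector_mult])

lemma spectral_norm_leI: "0 \<le> c \<Longrightarrow> (\<And>v. norm (A *v v) \<le> c * norm v) \<Longrightarrow> spectral_norm A \<le> c"
  unfolding spectral_norm_def by (auto intro: onorm_bound)

lemma spectral_norm_adjoint: "spectral_norm (adjoint_matrix A) = spectral_norm A"
proof -
  have le: "spectral_norm (adjoint_matrix A) \<le> spectral_norm A" for A :: "complex ^ 'n ^ 'n"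
  proof (rule spectral_norm_leI[OF spectral_norm_nonneg])
    fix v
    let ?w = "adjoint_matrix A *v v"
    have "(norm ?w)\<^sup>2 = Re (cdot ?w ?w)" by (simp add: cdot_self)
    also have "\<dots> = Re (cdot v (A *v ?w))" unfolding cdot_matrix_adjoint[of "adjoint_matrix A"] by simp
    also have "\<dots> \<le> norm v * norm (A *v ?w)"
      using cdot_cauchy_schwarz[of v "A *v ?w"] complex_Re_le_cmod[of "cdot v (A *v ?w)"] by linarith
    also have "\<dots> \<le> norm v * (spectral_norm A * norm ?w)"
      by (intro mult_left_mono norm_matrix_vector_le) simp
    finally have *: "norm ?w * norm ?w \<le> (spectral_norm A * norm v) * norm ?w"
      by (simp add: power2_eq_square mult_ac)
    show "norm ?w \<le> spectral_norm A * norm v"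
    proof (cases "norm ?w = 0")
      case True
      then show ?thesis using spectral_norm_nonneg[of A] by simp
    next
      case False
      then show ?thesis using * by (simp add: mult_le_cancel_right)
    qed
  qed
  show ?thesis using le[of A] le[of "adjoint_matrix A"] by simp
qed

lemma continuous_spectral_norm: "continuous_on UNIV (spectral_norm :: complex ^ 'n ^ 'n \<Rightarrow> real)"
proof -
  have frob: "norm (A *v v) \<le> norm A * norm v" for A :: "complex ^ 'n ^ 'n" and v
  proof -
    have "norm (A *v v) = L2_set (\<lambda>i. norm ((A *v v) $ i)) UNIV" by (simp add: norm_vec_def)
    also have "\<dots> \<le> L2_set (\<lambda>i. norm (A $ i) * norm v) UNIV"
    proof (rule L2_set_mono)
      fix i
      have "norm ((A *v v) $ i) \<le> (\<Sum>j\<in>UNIV. norm (A $ i $ j) * norm (v $ j))"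
        unfolding matrix_vector_mult_def using norm_sum[of "\<lambda>j. A $ i $ j * v $ j" UNIV] by (simp add: norm_mult)
      also have "\<dots> \<le> norm (A $ i) * norm v"
        unfolding norm_vec_def[of "A $ i"] norm_vec_def[of v]
        using L2_set_mult_ineq[of "\<lambda>j. norm (A $ i $ j)" "\<lambda>j. norm (v $ j)" UNIV] by simp
      finally show "norm ((A *v v) $ i) \<le> norm (A $ i) * norm v" .
    qed simp
    also have "\<dots> = norm A * norm v" by (simp add: L2_set_left_distrib norm_vec_def[of A])
    finally show ?thesis .
  qed
  have lip: "spectral_norm A \<le> spectral_norm B + norm (A - B)" for A B :: "complex ^ 'n ^ 'n"
  proof (rule spectral_norm_leI)
    fix v
    have "A *v v = B *v v + (A - B) *v v" by (simp add: matrix_vector_mult_diff_rdistrib)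
    then have "norm (A *v v) \<le> norm (B *v v) + norm ((A - B) *v v)" by (metis norm_triangle_ineq)
    also have "\<dots> \<le> spectral_norm B * norm v + norm (A - B) * norm v"
      by (intro add_mono norm_matrix_vector_le frob)
    finally show "norm (A *v v) \<le> (spectral_norm B + norm (A - B)) * norm v" by (simp add: distrib_right)
  qed (simp add: spectral_norm_nonneg)
  have "dist (spectral_norm A) (spectral_norm B) \<le> 1 * dist A B" for A B :: "complex ^ 'n ^ 'n"
    using lip[of A B] lip[of B A] by (simp add: dist_norm norm_minus_commute abs_le_iff)
  then have "1-lipschitz_on UNIV (spectral_norm :: complex ^ 'n ^ 'n \<Rightarrow> real)"
    by (intro lipschitz_onI) auto
  then show ?thesis by (rule lipschitz_on_continuous_on)
qed

lemma measurable_spectral_norm [measurable]: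
  fixes f :: "'a \<Rightarrow> complex ^ 'n ^ 'n"
  shows "f \<in> borel_measurable M \<Longrightarrow> (\<lambda>x. spectral_norm (f x)) \<in> borel_measurable M"
  by (rule borel_measurable_continuous_on[OF continuous_spectral_norm])

section \<open>Scalar weights bounded by a kernel with a mixed-norm estimate\<close>

lemma borel_ball [measurable]: "ball (x :: 'a :: metric_space) r \<in> sets borel"
  by simp

lemma ennreal_mult_divide_cancel: "0 < m \<Longrightarrow> m < \<top> \<Longrightarrow> m * (x / m) = (x :: ennreal)"
  by (simp add: ennreal_times_divide mult.commute[of m] mult_divide_eq_ennreal)

context doubling_measure
begin

lemma integral_ball_eq_average:
  "0 < r \<Longrightarrow> (\<integral>\<^sup>+y\<in>ball x r. h y \<partial>\<mu>) = emeasure \<mu> (ball x r) * average \<mu> (ball x r) h"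
  unfolding average_def using ball_pos[of r x] ball_finite[of x r] by (simp only: ennreal_mult_divide_cancel)

text \<open>Choose for \<open>A\<close> a sublevel set of \<open>u\<close> in the ball with positive measure: the right-hand side of the
  growth condition is then finite.\<close>

lemma locally_integrable_of_growth:
  fixes u :: "'a \<Rightarrow> real"
  assumes [measurable]: "u \<in> borel_measurable \<mu>" and b: "0 < b"
    and growth: "\<And>x r A. 0 < r \<Longrightarrow> A \<in> sets \<mu> \<Longrightarrow> A \<subseteq> ball x r \<Longrightarrow>
      (\<integral>\<^sup>+y\<in>ball x r. ennreal (u y) powe b \<partial>\<mu>) * emeasure \<mu> A powe q
        \<le> ennreal L * emeasure \<mu> (ball x r) powe q * (\<integral>\<^sup>+y\<in>A. ennreal (u y) powe b \<partial>\<mu>)"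
  shows "(\<integral>\<^sup>+y\<in>ball x r. ennreal (u y) powe b \<partial>\<mu>) < \<top>"
proof (cases "0 < r")
  case r: True
  define A where "A n = {y\<in>ball x r. u y \<le> real n}" for n
  have A_sets: "A n \<in> sets \<mu>" for n
  proof -
    have "{y \<in> space \<mu>. u y \<le> real n} \<in> sets \<mu>" by measurable
    then have "ball x r \<inter> {y. u y \<le> real n} \<in> sets borel" by simp
    moreover have "A n = ball x r \<inter> {y. u y \<le> real n}" by (auto simp: A_def)
    ultimately show ?thesis by simp
  qed
  have "incseq A" by (auto simp: incseq_def A_def)
  moreover have "(\<Union>n. A n) = ball x r" by (auto simp: A_def real_arch_simple)
  ultimately have lim: "(\<lambda>n. emeasure \<mu> (A n)) \<longlonglongrightarrow> emeasure \<mu> (ball x r)"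
    using Lim_emeasure_incseq[of A \<mu>] A_sets by (auto simp: image_subset_iff)
  have "eventually (\<lambda>n. 0 < emeasure \<mu> (A n)) sequentially"
    by (rule order_tendstoD(1)[OF lim ball_pos[OF r]])
  have sub: "A n \<subseteq> ball x r" for n by (auto simp: A_def)
  from \<open>eventually (\<lambda>n. 0 < emeasure \<mu> (A n)) sequentially\<close> obtain n where n: "0 < emeasure \<mu> (A n)" by (auto simp: eventually_sequentially)
  have "(\<integral>\<^sup>+y\<in>A n. ennreal (u y) powe b \<partial>\<mu>) \<le> (\<integral>\<^sup>+y\<in>A n. ennreal (real n) powe b \<partial>\<mu>)"
    using b by (intro nn_integral_mono) (auto simp: indicator_def A_def intro!: powe_mono ennreal_leI)
  also have "\<dots> = ennreal (real n) powe b * emeasure \<mu> (A n)"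
    by (rule nn_integral_cmult_indicator[OF A_sets])
  also have "\<dots> < \<top>"
    using subset_ball_finite[OF sub] by (auto simp: ennreal_mult_less_top)
  finally have "ennreal L * emeasure \<mu> (ball x r) powe q * (\<integral>\<^sup>+y\<in>A n. ennreal (u y) powe b \<partial>\<mu>) < \<top>"
    using ball_finite[of x r] by (auto simp: ennreal_mult_less_top)
  with growth[OF r A_sets sub, of n] have "(\<integral>\<^sup>+y\<in>ball x r. ennreal (u y) powe b \<partial>\<mu>) * emeasure \<mu> (A n) powe q < \<top>"
    by (rule le_less_trans)
  then show ?thesis using n by (auto simp: ennreal_mult_less_top)
qed (simp add: not_less ball_empty)

text \<open>A scalar function \<open>u\<close> whose values at any two points are compared by a kernel \<open>k\<close> inherits a
  Muckenhoupt condition from a bound on the mixed norm of \<open>k\<close>. For \<open>k x y = |P(x) M(y)|\<close>, this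
  applies to \<open>|P e|\<close> in the first variable and to \<open>|M \<xi>|\<close> in the second.\<close>

context
  fixes k :: "'a \<Rightarrow> 'a \<Rightarrow> real" and K a b :: real
  assumes k_meas [measurable]: "case_prod k \<in> borel_measurable (\<mu> \<Otimes>\<^sub>M \<mu>)" and k_nn: "\<And>x y. 0 \<le> k x y"
    and ab: "0 < a" "0 < b" and K: "0 \<le> K"
    and mixed: "\<And>x r. 0 < r \<Longrightarrow> average \<mu> (ball x r) (\<lambda>x'. average \<mu> (ball x r) (\<lambda>y. ennreal (k x' y) powe a) powe (b / a)) \<le> ennreal K"
begin

lemma kernel_section [measurable]: "k x \<in> borel_measurable \<mu>"
  using measurable_Pair2[OF k_meas, of x] by simp

lemma integral_kernel_measurable [measurable]:
  "(\<lambda>x'. \<integral>\<^sup>+y\<in>ball x r. ennreal (k x' y) powe a \<partial>\<mu>) \<in> borel_measurable \<mu>"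
  by measurable

lemma average_kernel_measurable:
  "(\<lambda>x'. average \<mu> (ball x r) (\<lambda>y. ennreal (k x' y) powe a)) \<in> borel_measurable \<mu>"
  unfolding average_def divide_ennreal_def
  by (intro borel_measurable_times_ennreal integral_kernel_measurable borel_measurable_const)

lemma mixed_integral:
  assumes r: "0 < r"
  shows "(\<integral>\<^sup>+x'\<in>ball x r. (\<integral>\<^sup>+y\<in>ball x r. ennreal (k x' y) powe a \<partial>\<mu>) powe (b / a) \<partial>\<mu>)
    \<le> ennreal K * emeasure \<mu> (ball x r) powe (1 + b / a)"
proof -
  let ?B = "ball x r"
  have B: "0 < emeasure \<mu> ?B" "emeasure \<mu> ?B < \<top>" using r ball_pos ball_finite by auto
  have Bp: "0 < emeasure \<mu> ?B powe (b / a)" "emeasure \<mu> ?B powe (b / a) < \<top>"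
    using B by (auto simp: zero_less_iff_neq_zero)
  have "(\<integral>\<^sup>+x'\<in>?B. (\<integral>\<^sup>+y\<in>?B. ennreal (k x' y) powe a \<partial>\<mu>) powe (b / a) \<partial>\<mu>)
    = (\<integral>\<^sup>+x'. emeasure \<mu> ?B powe (b / a) * (average \<mu> ?B (\<lambda>y. ennreal (k x' y) powe a) powe (b / a) * indicator ?B x') \<partial>\<mu>)"
  proof (rule nn_integral_cong)
    fix x'
    show "(\<integral>\<^sup>+y\<in>?B. ennreal (k x' y) powe a \<partial>\<mu>) powe (b / a) * indicator ?B x'
      = emeasure \<mu> ?B powe (b / a) * (average \<mu> ?B (\<lambda>y. ennreal (k x' y) powe a) powe (b / a) * indicator ?B x')"
      by (simp only: integral_ball_eq_average[OF r] powe_mult mult.assoc)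
  qed
  also have "\<dots> = emeasure \<mu> ?B powe (b / a) * (\<integral>\<^sup>+x'\<in>?B. average \<mu> ?B (\<lambda>y. ennreal (k x' y) powe a) powe (b / a) \<partial>\<mu>)"
    by (intro nn_integral_cmult borel_measurable_times_ennreal measurable_powe average_kernel_measurable borel_measurable_indicator) simp
  also have "\<dots> = emeasure \<mu> ?B powe (b / a) * (emeasure \<mu> ?B * average \<mu> ?B (\<lambda>x'. average \<mu> ?B (\<lambda>y. ennreal (k x' y) powe a) powe (b / a)))"
    by (simp only: integral_ball_eq_average[OF r])
  also have "\<dots> \<le> emeasure \<mu> ?B powe (b / a) * (emeasure \<mu> ?B * ennreal K)"
    by (intro mult_left_mono mixed r) auto
  also have "\<dots> = ennreal K * emeasure \<mu> ?B powe (1 + b / a)"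
    by (simp add: powe_add mult_ac)
  finally show ?thesis .
qed

text \<open>Integrate \<open>u(x)^s \<le> k(x,y)^s u(y)^s\<close> over \<open>y \<in> A\<close>, where \<open>1/s = 1/a + 1/b\<close>, and apply Hoelder's
  inequality to separate \<open>k(x,\<cdot>)\<close> in \<open>L^a\<close> from \<open>u\<close> in \<open>L^b(A)\<close>. Then raise to the power \<open>b/s = 1 + b/a\<close>
  and integrate over \<open>x\<close> in the ball, which produces exactly the mixed norm of \<open>k\<close>.\<close>

lemma muckenhoupt_left:
  fixes u :: "'a \<Rightarrow> real"
  assumes u [measurable]: "u \<in> borel_measurable \<mu>" and nn: "\<And>x. 0 \<le> u x"
    and le: "\<And>x y. u x \<le> k x y * u y"
  shows "muckenhoupt (1 + b / a) K (\<lambda>x. ennreal (u x) powe b)"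
proof -
  define s where "s = a * b / (a + b)"
  have "s / a = b / (a + b)" "s / b = a / (a + b)" using ab by (auto simp: s_def)
  then have s: "0 < s" "s / a + s / b = 1" "b / s = 1 + b / a"
    using ab by (auto simp: s_def add_divide_distrib[symmetric]) (auto simp: field_simps)
  have growth: "(\<integral>\<^sup>+x'\<in>ball x r. ennreal (u x') powe b \<partial>\<mu>) * emeasure \<mu> A powe (1 + b / a)
      \<le> ennreal K * emeasure \<mu> (ball x r) powe (1 + b / a) * (\<integral>\<^sup>+y\<in>A. ennreal (u y) powe b \<partial>\<mu>)"
    if r: "0 < r" and A [measurable]: "A \<in> sets \<mu>" and sub: "A \<subseteq> ball x r" for x r A
  proof -
    let ?B = "ball x r"
    define wA where "wA = (\<integral>\<^sup>+y\<in>A. ennreal (u y) powe b \<partial>\<mu>)"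
    define \<kappa> where "\<kappa> x' = (\<integral>\<^sup>+y\<in>?B. ennreal (k x' y) powe a \<partial>\<mu>)" for x'
    have [measurable]: "\<kappa> \<in> borel_measurable \<mu>" unfolding \<kappa>_def by (rule integral_kernel_measurable)
    have pt: "ennreal (u x') powe b * emeasure \<mu> A powe (1 + b / a) \<le> wA * \<kappa> x' powe (b / a)" for x'
    proof -
      have "ennreal (u x') powe s * emeasure \<mu> A = (\<integral>\<^sup>+y. ennreal (u x') powe s * indicator A y \<partial>\<mu>)"
        using A by (simp add: nn_integral_cmult_indicator)
      also have "\<dots> \<le> (\<integral>\<^sup>+y. (ennreal (k x' y) powe a * indicator ?B y) powe (s / a) * (ennreal (u y) powe b * indicator A y) powe (s / b) \<partial>\<mu>)"
      proof (rule nn_integral_mono)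
        fix y
        show "ennreal (u x') powe s * indicator A y
          \<le> (ennreal (k x' y) powe a * indicator ?B y) powe (s / a) * (ennreal (u y) powe b * indicator A y) powe (s / b)"
        proof (cases "y \<in> A")
          case True
          have "ennreal (u x') \<le> ennreal (k x' y) * ennreal (u y)"
            using le[of x' y] k_nn nn by (simp add: ennreal_leI flip: ennreal_mult)
          then have "ennreal (u x') powe s \<le> (ennreal (k x' y) * ennreal (u y)) powe s"
            using s by (intro powe_mono) auto
          also have "\<dots> = (ennreal (k x' y) powe a) powe (s / a) * (ennreal (u y) powe b) powe (s / b)"
            using ab by (simp add: powe_mult powe_powe)
          finally show ?thesis using True sub by (auto simp: indicator_def)
        qed simp
      qed
      also have "\<dots> \<le> \<kappa> x' powe (s / a) * wA powe (s / b)"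
        unfolding \<kappa>_def wA_def using s ab by (intro holder_nn_integral) auto
      finally have "(ennreal (u x') powe s * emeasure \<mu> A) powe (b / s) \<le> (\<kappa> x' powe (s / a) * wA powe (s / b)) powe (b / s)"
        using s ab by (intro powe_mono) auto
      then have "ennreal (u x') powe (s * (b / s)) * emeasure \<mu> A powe (b / s)
          \<le> \<kappa> x' powe (s / a * (b / s)) * wA powe (s / b * (b / s))"
        by (simp only: powe_mult powe_powe)
      moreover have "s * (b / s) = b" "s / a * (b / s) = b / a" "s / b * (b / s) = 1" using s(1) ab by auto
      ultimately show ?thesis unfolding s(3) by (simp only: powe_one mult.commute)
    qed
    have "(\<integral>\<^sup>+x'\<in>?B. ennreal (u x') powe b \<partial>\<mu>) * emeasure \<mu> A powe (1 + b / a)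
      = (\<integral>\<^sup>+x'. (ennreal (u x') powe b * indicator ?B x') * emeasure \<mu> A powe (1 + b / a) \<partial>\<mu>)"
      by (intro nn_integral_multc[symmetric]) measurable
    also have "\<dots> \<le> (\<integral>\<^sup>+x'. wA * (\<kappa> x' powe (b / a) * indicator ?B x') \<partial>\<mu>)"
    proof (rule nn_integral_mono)
      fix x'
      show "(ennreal (u x') powe b * indicator ?B x') * emeasure \<mu> A powe (1 + b / a) \<le> wA * (\<kappa> x' powe (b / a) * indicator ?B x')"
        using pt[of x'] by (cases "x' \<in> ?B") auto
    qed
    also have "\<dots> = wA * (\<integral>\<^sup>+x'\<in>?B. \<kappa> x' powe (b / a) \<partial>\<mu>)"
      by (intro nn_integral_cmult) measurable
    also have "\<dots> \<le> wA * (ennreal K * emeasure \<mu> ?B powe (1 + b / a))"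
      unfolding \<kappa>_def by (intro mult_left_mono mixed_integral r) auto
    finally show ?thesis by (simp add: wA_def mult_ac)
  qed
  show ?thesis
    unfolding muckenhoupt_def using growth locally_integrable_of_growth[OF u ab(2) growth] by simp
qed

text \<open>The dual computation: integrate \<open>u(y)^a \<le> k(x,y)^a u(x)^a\<close> over \<open>y\<close> in the ball first, then a
  fractional power of the result over \<open>x \<in> A\<close>, and separate \<open>u\<close> from \<open>k\<close> by Hoelder's inequality. The
  mixed norm enters with the power \<open>a/b\<close>.\<close>

lemma muckenhoupt_right:
  fixes u :: "'a \<Rightarrow> real"
  assumes u [measurable]: "u \<in> borel_measurable \<mu>" and nn: "\<And>x. 0 \<le> u x"
    and le: "\<And>x y. u y \<le> k x y * u x"
  shows "muckenhoupt (1 + a / b) (K powr (a / b)) (\<lambda>x. ennreal (u x) powe a)"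
proof -
  define s where "s = a * b / (a + b)"
  have "s / a = b / (a + b)" "s / b = a / (a + b)" using ab by (auto simp: s_def)
  then have s: "0 < s" "s / a + s / b = 1" "a / s = 1 + a / b"
    using ab by (auto simp: s_def add_divide_distrib[symmetric]) (auto simp: field_simps)
  have growth: "(\<integral>\<^sup>+x'\<in>ball x r. ennreal (u x') powe a \<partial>\<mu>) * emeasure \<mu> A powe (1 + a / b)
      \<le> ennreal (K powr (a / b)) * emeasure \<mu> (ball x r) powe (1 + a / b) * (\<integral>\<^sup>+y\<in>A. ennreal (u y) powe a \<partial>\<mu>)"
    if r: "0 < r" and A [measurable]: "A \<in> sets \<mu>" and sub: "A \<subseteq> ball x r" for x r A
  proof -
    let ?B = "ball x r"
    define wA where "wA = (\<integral>\<^sup>+y\<in>A. ennreal (u y) powe a \<partial>\<mu>)"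
    define wB where "wB = (\<integral>\<^sup>+y\<in>?B. ennreal (u y) powe a \<partial>\<mu>)"
    define \<kappa> where "\<kappa> x' = (\<integral>\<^sup>+y\<in>?B. ennreal (k x' y) powe a \<partial>\<mu>)" for x'
    have [measurable]: "\<kappa> \<in> borel_measurable \<mu>" unfolding \<kappa>_def by (rule integral_kernel_measurable)
    have pt: "wB \<le> ennreal (u x') powe a * \<kappa> x'" for x'
    proof -
      have "wB \<le> (\<integral>\<^sup>+y. ennreal (u x') powe a * (ennreal (k x' y) powe a * indicator ?B y) \<partial>\<mu>)"
        unfolding wB_def
      proof (rule nn_integral_mono)
        fix y
        have "ennreal (u y) \<le> ennreal (u x') * ennreal (k x' y)"
          using le[of y x'] k_nn nn by (simp add: ennreal_leI mult.commute flip: ennreal_mult)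
        then have "ennreal (u y) powe a \<le> (ennreal (u x') * ennreal (k x' y)) powe a"
          using ab by (intro powe_mono) auto
        then show "ennreal (u y) powe a * indicator ?B y \<le> ennreal (u x') powe a * (ennreal (k x' y) powe a * indicator ?B y)"
          by (auto simp: powe_mult indicator_def)
      qed
      also have "\<dots> = ennreal (u x') powe a * \<kappa> x'"
        unfolding \<kappa>_def by (intro nn_integral_cmult) measurable
      finally show ?thesis .
    qed
    have "wB powe (s / a) * emeasure \<mu> A = (\<integral>\<^sup>+x'. wB powe (s / a) * indicator A x' \<partial>\<mu>)"
      using A by (simp add: nn_integral_cmult_indicator)
    also have "\<dots> \<le> (\<integral>\<^sup>+x'. (ennreal (u x') powe a * indicator A x') powe (s / a) * (\<kappa> x' powe (b / a) * indicator ?B x') powe (s / b) \<partial>\<mu>)"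
    proof (rule nn_integral_mono)
      fix x'
      show "wB powe (s / a) * indicator A x'
        \<le> (ennreal (u x') powe a * indicator A x') powe (s / a) * (\<kappa> x' powe (b / a) * indicator ?B x') powe (s / b)"
      proof (cases "x' \<in> A")
        case True
        have "wB powe (s / a) \<le> (ennreal (u x') powe a * \<kappa> x') powe (s / a)"
          using s ab by (intro powe_mono pt) auto
        also have "\<dots> = (ennreal (u x') powe a) powe (s / a) * (\<kappa> x' powe (b / a)) powe (s / b)"
          using ab by (simp add: powe_mult powe_powe)
        finally show ?thesis using True sub by (auto simp: indicator_def)
      qed simp
    qed
    also have "\<dots> \<le> wA powe (s / a) * (\<integral>\<^sup>+x'\<in>?B. \<kappa> x' powe (b / a) \<partial>\<mu>) powe (s / b)"
      unfolding wA_def using s ab by (intro holder_nn_integral) auto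
    also have "\<dots> \<le> wA powe (s / a) * (ennreal K * emeasure \<mu> ?B powe (1 + b / a)) powe (s / b)"
      unfolding \<kappa>_def using s ab by (intro mult_left_mono powe_mono mixed_integral r) auto
    finally have "(wB powe (s / a) * emeasure \<mu> A) powe (a / s)
        \<le> (wA powe (s / a) * (ennreal K * emeasure \<mu> ?B powe (1 + b / a)) powe (s / b)) powe (a / s)"
      using s ab by (intro powe_mono) auto
    then have raw: "wB powe (s / a * (a / s)) * emeasure \<mu> A powe (a / s)
        \<le> wA powe (s / a * (a / s)) * (ennreal K powe (s / b * (a / s)) * emeasure \<mu> ?B powe ((1 + b / a) * (s / b * (a / s))))"
      by (simp only: powe_mult powe_powe mult.assoc)
    have e: "s / a * (a / s) = 1" "s / b * (a / s) = a / b" "(1 + b / a) * (a / b) = 1 + a / b"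
      using s(1) ab by (auto simp: field_simps)
    have "wB * emeasure \<mu> A powe (1 + a / b)
        \<le> wA * (ennreal K powe (a / b) * emeasure \<mu> ?B powe (1 + a / b))"
      using raw[unfolded e powe_one, unfolded s(3)] .
    also have "ennreal K powe (a / b) = ennreal (K powr (a / b))"
      by (rule ennreal_powr_ennreal[OF K])
    finally show ?thesis
      unfolding wA_def wB_def by (simp only: mult_ac)
  qed
  show ?thesis
    unfolding muckenhoupt_def using growth locally_integrable_of_growth[OF u ab(1) growth] by simp
qed

text \<open>For \<open>A = B\<close> the Muckenhoupt condition reads \<open>w(B) \<le> K w(B)\<close>.\<close>

lemma constant_ge_1:
  fixes u :: "'a \<Rightarrow> real" and z :: 'a
  assumes u [measurable]: "u \<in> borel_measurable \<mu>" and pos: "\<And>x. 0 < u x" and le: "\<And>x y. u x \<le> k x y * u y"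
  shows "1 \<le> K"
proof -
  let ?B = "ball z 1"
  have mh: "muckenhoupt (1 + b / a) K (\<lambda>x. ennreal (u x) powe b)"
    using pos by (intro muckenhoupt_left le) (auto intro: less_imp_le)
  define w where "w = (\<integral>\<^sup>+x\<in>?B. ennreal (u x) powe b \<partial>\<mu>)"
  have "w \<noteq> 0"
  proof
    assume "w = 0"
    then have "AE x in \<mu>. ennreal (u x) powe b * indicator ?B x = 0"
      unfolding w_def by (subst (asm) nn_integral_0_iff_AE) auto
    moreover have "ennreal (u x) \<noteq> 0" for x using pos[of x] by simp
    ultimately have "AE x in \<mu>. x \<notin> ?B"
      by (auto simp: indicator_def elim!: eventually_mono split: if_splits)
    then have "emeasure \<mu> ?B = 0" by (subst (asm) AE_iff_measurable[OF _ refl]) (auto simp: ball_def)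
    then show False using ball_pos[of 1 z] by simp
  qed
  moreover have "w < \<top>" using mh by (simp add: muckenhoupt_def w_def)
  moreover have "w * emeasure \<mu> ?B powe (1 + b / a) \<le> ennreal K * emeasure \<mu> ?B powe (1 + b / a) * w"
    using mh by (simp add: muckenhoupt_def w_def)
  moreover have "emeasure \<mu> ?B powe (1 + b / a) \<noteq> 0" "emeasure \<mu> ?B powe (1 + b / a) < \<top>"
    using ball_pos[of 1 z] ball_finite[of z 1] by auto
  ultimately obtain v m where "w = ennreal v" "emeasure \<mu> ?B powe (1 + b / a) = ennreal m" "0 < v" "0 < m" "ennreal v * ennreal m \<le> ennreal K * ennreal m * ennreal v"
    by (cases w; cases "emeasure \<mu> ?B powe (1 + b / a)") (auto simp: less_le)
  then have "v * m \<le> K * m * v" using K by (simp flip: ennreal_mult)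
  then have "1 * (m * v) \<le> K * (m * v)" by (simp add: mult_ac)
  then show ?thesis using \<open>0 < v\<close> \<open>0 < m\<close> by (simp add: mult_le_cancel_right)
qed

end

end

section \<open>Almost Auerbach bases\<close>

lemma det_norm_le:
  fixes X :: "complex ^ 'n ^ 'n"
  assumes "\<And>i j. norm (X $ i $ j) \<le> c" "0 \<le> c"
  shows "norm (det X) \<le> fact CARD('n) * c ^ CARD('n)"
proof -
  have "norm (det X) \<le> (\<Sum>p | p permutes (UNIV :: 'n set). c ^ CARD('n))"
    unfolding det_def
  proof (rule sum_norm_le)
    fix p assume "p \<in> {p. p permutes (UNIV :: 'n set)}"
    have "norm (of_int (sign p) * (\<Prod>i\<in>UNIV. X $ i $ p i)) = (\<Prod>i\<in>UNIV. norm (X $ i $ p i))"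
      by (simp add: norm_mult prod_norm sign_def)
    also have "\<dots> \<le> (\<Prod>i\<in>(UNIV :: 'n set). c)" using assms by (intro prod_mono) auto
    finally show "norm (of_int (sign p) * (\<Prod>i\<in>UNIV. X $ i $ p i)) \<le> c ^ CARD('n)" by simp
  qed
  also have "\<dots> = fact CARD('n) * c ^ CARD('n)" by (simp add: card_permutations)
  finally show ?thesis .
qed

text \<open>Among the matrices whose columns \<open>\<xi>\<^sub>i\<close> satisfy \<open>N \<xi>\<^sub>i \<le> 1\<close>, take one whose determinant is at least half of
  the supremum. By Cramer's rule, the coordinates of \<open>w\<close> with respect to the columns are quotients
  of determinants, where one column is replaced by \<open>w\<close>; for \<open>N w \<le> 1\<close> they are at most 2. Neither the
  triangle inequality nor continuity of \<open>N\<close> is assumed, so the supremum need not be attained.\<close>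

lemma auerbach_basis:
  fixes N :: "complex ^ 'n \<Rightarrow> real"
  assumes hom: "\<And>c v. N (c *s v) = norm c * N v" and low: "\<And>v. c0 * norm v \<le> N v" and c0: "0 < c0"
  shows "\<exists>\<xi> e :: 'n \<Rightarrow> complex ^ 'n. (\<forall>i. N (\<xi> i) \<le> 1) \<and> (\<forall>w. w = (\<Sum>i\<in>UNIV. cdot w (e i) *s \<xi> i)) \<and>
    (\<forall>w i. norm (cdot w (e i)) \<le> 2 * N w)"
proof -
  define \<X> where "\<X> = {X :: complex ^ 'n ^ 'n. \<forall>i. N (column i X) \<le> 1}"
  have Npos: "0 < N v" if "v \<noteq> 0" for v
    using low[of v] that c0 by (meson less_le_trans mult_pos_pos zero_less_norm_iff)
  have N0: "N 0 = 0" using hom[of 0 0] by simp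
  have bound: "norm (det X) \<le> fact CARD('n) * (1 / c0) ^ CARD('n)" if "X \<in> \<X>" for X
  proof (rule det_norm_le)
    fix i j
    have "norm (X $ i $ j) = norm (column j X $ i)" by (simp add: column_def)
    also have "\<dots> \<le> norm (column j X)" by (rule Finite_Cartesian_Product.norm_nth_le)
    also have "\<dots> \<le> 1 / c0"
    proof -
      have "c0 * norm (column j X) \<le> 1" using low[of "column j X"] that by (auto simp: \<X>_def intro: order_trans)
      then show ?thesis using c0 by (simp add: field_simps)
    qed
    finally show "norm (X $ i $ j) \<le> 1 / c0" .
  qed (use c0 in simp)
  have bdd: "bdd_above ((\<lambda>X. norm (det X)) ` \<X>)" by (intro bdd_aboveI2[where M = "fact CARD('n) * (1 / c0) ^ CARD('n)"] bound)
  define D where "D = (SUP X\<in>\<X>. norm (det X))"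
  \<comment> \<open>The normalized standard basis shows that the supremum is positive.\<close>
  define X0 :: "complex ^ 'n ^ 'n" where "X0 = diag_matrix (\<lambda>i. 1 / N (axis i 1))"
  have X0: "X0 \<in> \<X>"
  proof -
    have "column i X0 = complex_of_real (1 / N (axis i 1)) *s axis i 1" for i
      by (auto simp: column_def X0_def diag_matrix_def vec_eq_iff axis_def)
    then have "N (column i X0) \<le> 1" for i
      using Npos[of "axis i 1"] by (simp add: hom norm_divide axis_eq_0_iff)
    then show ?thesis by (simp add: \<X>_def)
  qed
  have "det X0 = (\<Prod>i\<in>UNIV. complex_of_real (1 / N (axis i 1)))"
    unfolding X0_def by (subst det_diagonal) (auto simp: diag_matrix_def)
  moreover have "N (axis i 1) \<noteq> 0" for i using Npos[of "axis i 1"] by (simp add: axis_eq_0_iff)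
  ultimately have "0 < norm (det X0)" by auto
  also have "norm (det X0) \<le> D" unfolding D_def using bdd X0 by (rule cSUP_upper2) simp
  finally have D: "0 < D" .
  have "\<X> \<noteq> {}" using X0 by blast
  then obtain X where X: "X \<in> \<X>" "D / 2 < norm (det X)"
    using less_cSUP_iff[OF _ bdd, of "D / 2"] D unfolding D_def[symmetric] by auto
  have dX: "det X \<noteq> 0" using X(2) D by auto
  then obtain Y where Y: "X ** Y = mat 1" "Y ** X = mat 1"
    unfolding invertible_det_nz[symmetric] invertible_def by blast
  define \<xi> where "\<xi> i = column i X" for i
  define e :: "'n \<Rightarrow> complex ^ 'n" where "e i = (\<chi> j. cnj (Y $ i $ j))" for i
  have ce: "cdot w (e i) = (Y *v w) $ i" for w i
    by (simp add: cdot_def e_def matrix_vector_mult_def mult.commute)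
  have rep: "w = (\<Sum>i\<in>UNIV. cdot w (e i) *s \<xi> i)" for w
  proof -
    have "w = X *v (Y *v w)" by (simp add: matrix_vector_mul_assoc Y)
    also have "\<dots> = (\<Sum>i\<in>UNIV. (Y *v w) $ i *s column i X)" by (rule matrix_mult_sum)
    finally show ?thesis by (simp add: ce \<xi>_def)
  qed
  have unit: "norm (cdot w (e i)) \<le> 2" if w: "N w \<le> 1" for w i
  proof -
    define Z where "Z = (\<chi> k j. if j = i then w $ k else X $ k $ j)"
    have XYw: "X *v (Y *v w) = w" by (simp add: matrix_vector_mul_assoc Y)
    have detZ: "det Z = (Y *v w) $ i * det X"
      using cramer_lemma[of i X "Y *v w"] unfolding XYw Z_def .
    have "Z \<in> \<X>"
    proof -
      have "column j Z = (if j = i then w else column j X)" for j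
        by (auto simp: column_def Z_def vec_eq_iff)
      then show ?thesis using w X(1) by (auto simp: \<X>_def)
    qed
    then have "norm (det Z) \<le> D" unfolding D_def by (rule cSUP_upper[OF _ bdd])
    then have "norm (cdot w (e i)) * norm (det X) \<le> D" by (simp add: detZ ce norm_mult)
    also have "D \<le> 2 * norm (det X)" using X(2) by simp
    finally show ?thesis using dX by simp
  qed
  have "norm (cdot w (e i)) \<le> 2 * N w" for w i
  proof (cases "w = 0")
    case False
    then have n: "0 < N w" by (rule Npos)
    have "N (complex_of_real (1 / N w) *s w) \<le> 1" unfolding hom using n by (simp add: norm_divide)
    from unit[OF this, of i] show ?thesis
      using n unfolding cdot_scale_left by (simp add: norm_mult norm_divide field_simps)
  qed (simp add: N0)
  then show ?thesis using rep X(1) by (intro exI[of _ \<xi>] exI[of _ e]) (auto simp: \<X>_def \<xi>_def)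
qed

section \<open>Pairings with convex body averages\<close>

lemma powe_le_one_iff: "0 < r \<Longrightarrow> x powe r \<le> 1 \<longleftrightarrow> x \<le> 1"
  using powe_le_iff[of r x 1] by simp

lemma norm_smult_vec: "norm (c *s v) = norm c * norm v" for v :: "complex ^ 'n"
  by (simp add: norm_vec_def norm_mult L2_set_right_distrib)

lemma matrix_vector_smult: "A *v (c *s v) = c *s (A *v v)" for A :: "complex ^ 'n ^ 'm"
  by (simp add: matrix_vector_mult_def vec_eq_iff sum_distrib_left mult.left_commute)

lemma bounded_linear_cdot_left: "bounded_linear (\<lambda>v. cdot v w)"
  by (rule bounded_linear_intro[where K = "norm w"])
    (simp_all add: cdot_add_left cdot_scaleR_left cdot_cauchy_schwarz)

lemma measurable_cdot [measurable]:
  assumes "f \<in> borel_measurable M"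
  shows "(\<lambda>x. cdot (f x) w) \<in> borel_measurable M"
  by (rule borel_measurable_continuous_on[OF _ assms])
    (rule linear_continuous_on[OF bounded_linear_cdot_left])

lemma average_cmult:
  assumes [measurable]: "h \<in> borel_measurable M" "E \<in> sets M"
  shows "average M E (\<lambda>x. c * h x) = c * average M E h"
proof -
  have "(\<integral>\<^sup>+x\<in>E. c * h x \<partial>M) = c * (\<integral>\<^sup>+x\<in>E. h x \<partial>M)"
    by (simp add: mult.assoc nn_integral_cmult)
  then show ?thesis by (simp add: average_def ennreal_times_divide)
qed

text \<open>Hoelder's inequality between the multiplier \<open>\<phi>\<close> and the scalar function \<open>f \<sqdot> \<xi>\<close>.\<close>

lemma convex_body_average_cdot_le:
  fixes f :: "'a \<Rightarrow> complex ^ 'n"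
  assumes E [measurable]: "E \<in> sets M" and E0: "0 < emeasure M E" "emeasure M E < \<top>" and r: "1 \<le> r"
    and f [measurable]: "f \<in> borel_measurable M" and v: "v \<in> convex_body_average M r E f"
  shows "ennreal (norm (cdot v \<xi>)) \<le> average M E (\<lambda>x. ennreal (norm (cdot (f x) \<xi>)) powe r) powe (1 / r)"
proof -
  obtain \<phi> where v: "v = (1 / measure M E) *\<^sub>R (LINT x:E|M. \<phi> x *s f x)"
    and [measurable]: "\<phi> \<in> borel_measurable M"
    and \<phi>: "Lp_norm (holder_conj (ereal r)) (uniform_measure M E) \<phi> \<le> 1"
    using v unfolding convex_body_average_def by blast
  have em1: "emeasure M E = ennreal (measure M E)"
    using E0 by (intro emeasure_eq_ennreal_measure) auto
  have em2: "0 < measure M E" using E0(1) unfolding em1 by simp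
  note em = em1 em2
  define h where "h x = indicator E x *\<^sub>R (\<phi> x *s f x)" for x
  define \<Phi> where "\<Phi> x = ennreal (norm (\<phi> x))" for x
  define c where "c x = ennreal (norm (cdot (f x) \<xi>))" for x
  have [measurable]: "\<Phi> \<in> borel_measurable M" "c \<in> borel_measurable M" unfolding \<Phi>_def c_def by measurable
  have "ennreal (norm (cdot (integral\<^sup>L M h) \<xi>)) \<le> (\<integral>\<^sup>+x\<in>E. \<Phi> x * c x \<partial>M)"
  proof (cases "integrable M h")
    case True
    have "cdot (integral\<^sup>L M h) \<xi> = (\<integral>x. cdot (h x) \<xi> \<partial>M)"
      by (rule integral_bounded_linear[OF bounded_linear_cdot_left True, symmetric])
    then have "ennreal (norm (cdot (integral\<^sup>L M h) \<xi>)) \<le> (\<integral>\<^sup>+x. ennreal (norm (cdot (h x) \<xi>)) \<partial>M)"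
      using integral_norm_bound_ennreal[OF integrable_bounded_linear[OF bounded_linear_cdot_left True, of \<xi>]] by simp
    also have "\<dots> = (\<integral>\<^sup>+x\<in>E. \<Phi> x * c x \<partial>M)"
      by (intro nn_integral_cong)
        (auto simp: h_def \<Phi>_def c_def indicator_def cdot_scale_left norm_mult ennreal_mult)
    finally show ?thesis .
  qed (simp add: not_integrable_integral_eq)
  then have "ennreal (norm (cdot (integral\<^sup>L M h) \<xi>)) / emeasure M E \<le> average M E (\<lambda>x. \<Phi> x * c x)"
    unfolding average_def by (rule divide_right_mono_ennreal)
  moreover have "ennreal (norm (cdot v \<xi>)) = ennreal (norm (cdot (integral\<^sup>L M h) \<xi>)) / emeasure M E"
    unfolding em(1) v h_def[symmetric] set_lebesgue_integral_def using em(2)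
    by (simp add: cdot_scaleR_left divide_ennreal)
  ultimately have step: "ennreal (norm (cdot v \<xi>)) \<le> average M E (\<lambda>x. \<Phi> x * c x)" by simp
  show ?thesis
  proof (cases "r = 1")
    case True
    have "holder_conj (ereal r) = \<infinity>" by (simp add: True holder_conj_def one_ereal_def)
    then have "esssup (uniform_measure M E) \<Phi> \<le> 1" using \<phi> by (simp add: Lp_norm_def \<Phi>_def[abs_def])
    moreover have "AE x in uniform_measure M E. \<Phi> x \<le> esssup (uniform_measure M E) \<Phi>" by (rule esssup_AE)
    ultimately have "AE x in uniform_measure M E. \<Phi> x \<le> 1" by (auto elim!: eventually_mono)
    then have "AE x in M. x \<in> E \<longrightarrow> \<Phi> x \<le> 1"
      using E0 by (subst (asm) AE_uniform_measure) auto
    moreover have "\<Phi> x * c x \<le> c x" if "\<Phi> x \<le> 1" for x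
      using mult_right_mono[OF that, of "c x"] by simp
    ultimately have "(\<integral>\<^sup>+x\<in>E. \<Phi> x * c x \<partial>M) \<le> (\<integral>\<^sup>+x\<in>E. c x \<partial>M)"
      by (intro nn_integral_mono_AE) (auto simp: indicator_def elim!: eventually_mono)
    then have "average M E (\<lambda>x. \<Phi> x * c x) \<le> average M E c"
      unfolding average_def by (rule divide_right_mono_ennreal)
    then show ?thesis using step True by (simp add: c_def[abs_def])
  next
    case False
    then have r1: "1 < r" using r by simp
    define r' where "r' = 1 / (1 - 1 / r)"
    have r': "0 < r'" "1 / r' + 1 / r = 1" using r1 by (auto simp: r'_def)
    have "holder_conj (ereal r) = ereal r'"
      using r1 by (simp add: holder_conj_def r'_def inverse_eq_divide one_ereal_def)
    then have "(\<integral>\<^sup>+x. ennreal (norm (\<phi> x) powr r') \<partial>uniform_measure M E) powe (1 / r') \<le> 1"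
      using \<phi> by (simp add: Lp_norm_def)
    then have "(\<integral>\<^sup>+x. \<Phi> x powe r' \<partial>uniform_measure M E) powe (1 / r') \<le> 1 powe (1 / r')"
      by (simp add: \<Phi>_def ennreal_powr_ennreal)
    then have "(\<integral>\<^sup>+x. \<Phi> x powe r' \<partial>uniform_measure M E) \<le> 1"
      using r' by (simp add: powe_le_one_iff)
    then have \<Phi>1: "average M E (\<lambda>x. \<Phi> x powe r') \<le> 1"
      by (subst (asm) nn_integral_uniform_measure) (auto simp: average_def)
    have "average M E (\<lambda>x. \<Phi> x * c x) = average M E (\<lambda>x. (\<Phi> x powe r') powe (1 / r') * (c x powe r) powe (1 / r))"
      using r' r1 by (simp add: powe_powe)
    also have "\<dots> \<le> average M E (\<lambda>x. \<Phi> x powe r') powe (1 / r') * average M E (\<lambda>x. c x powe r) powe (1 / r)"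
      using r' r1 by (intro average_holder E0) auto
    also have "\<dots> \<le> 1 powe (1 / r') * average M E (\<lambda>x. c x powe r) powe (1 / r)"
      using r' by (intro mult_right_mono powe_mono \<Phi>1) auto
    finally show ?thesis using step by (simp add: c_def)
  qed
qed

text \<open>The pairing of two convex bodies is bounded coordinate by coordinate in a pair of dual bases, which may
  be adapted to the set \<open>E\<close>.\<close>

lemma set_abs_cdot_set_le:
  fixes f g :: "'a \<Rightarrow> complex ^ 'n" and \<xi> e :: "'n \<Rightarrow> complex ^ 'n"
  assumes E: "E \<in> sets M" "0 < emeasure M E" "emeasure M E < \<top>" and r: "1 \<le> r1" "1 \<le> r2"
    and fg: "f \<in> borel_measurable M" "g \<in> borel_measurable M"
    and rep: "\<And>w. w = (\<Sum>i\<in>UNIV. cdot w (e i) *s \<xi> i)"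
  shows "set_abs (cdot_set (convex_body_average M r1 E f) (convex_body_average M r2 E g))
    \<le> (\<Sum>i\<in>UNIV. average M E (\<lambda>x. ennreal (norm (cdot (f x) (\<xi> i))) powe r1) powe (1 / r1)
      * average M E (\<lambda>x. ennreal (norm (cdot (g x) (e i))) powe r2) powe (1 / r2))"
  unfolding set_abs_def
proof (rule SUP_least)
  fix s assume "s \<in> cdot_set (convex_body_average M r1 E f) (convex_body_average M r2 E g)"
  then obtain v w where s: "s = cdot v w" and v: "v \<in> convex_body_average M r1 E f" and w: "w \<in> convex_body_average M r2 E g"
    unfolding cdot_set_def by blast
  have "s = cnj (cdot w v)" unfolding s by (rule cdot_commute)
  also have "cdot w v = (\<Sum>i\<in>UNIV. cdot w (e i) * cdot (\<xi> i) v)"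
    by (subst rep[of w]) (simp only: cdot_sum_left cdot_scale_left)
  finally have "norm s = norm (\<Sum>i\<in>UNIV. cdot w (e i) * cdot (\<xi> i) v)"
    by (simp only: complex_mod_cnj)
  also have "\<dots> \<le> (\<Sum>i\<in>UNIV. norm (cdot w (e i)) * norm (cdot (\<xi> i) v))"
    by (rule sum_norm_le) (simp add: norm_mult)
  also have "\<dots> = (\<Sum>i\<in>UNIV. norm (cdot v (\<xi> i)) * norm (cdot w (e i)))"
    by (intro sum.cong refl) (metis cdot_commute complex_mod_cnj mult.commute)
  finally have "ennreal (norm s) \<le> ennreal (\<Sum>i\<in>UNIV. norm (cdot v (\<xi> i)) * norm (cdot w (e i)))"
    by (rule ennreal_leI)
  also have "\<dots> = (\<Sum>i\<in>UNIV. ennreal (norm (cdot v (\<xi> i))) * ennreal (norm (cdot w (e i))))"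
    by (simp add: ennreal_mult flip: sum_ennreal)
  also have "\<dots> \<le> (\<Sum>i\<in>UNIV. average M E (\<lambda>x. ennreal (norm (cdot (f x) (\<xi> i))) powe r1) powe (1 / r1)
      * average M E (\<lambda>x. ennreal (norm (cdot (g x) (e i))) powe r2) powe (1 / r2))"
    by (intro sum_mono mult_mono convex_body_average_cdot_le E r fg v w) auto
  finally show "ennreal (norm s) \<le> \<dots>" .
qed

lemma holder_sum_ennreal:
  fixes X Y m :: "'i \<Rightarrow> ennreal"
  assumes J: "finite J" and p: "0 < p" "0 < p'" "1 / p + 1 / p' = 1"
  shows "(\<Sum>j\<in>J. m j * (X j * Y j)) \<le> (\<Sum>j\<in>J. m j * X j powe p) powe (1 / p) * (\<Sum>j\<in>J. m j * Y j powe p') powe (1 / p')"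
proof -
  have "(\<Sum>j\<in>J. m j * (X j * Y j)) = (\<Sum>j\<in>J. (m j * X j powe p) powe (1 / p) * (m j * Y j powe p') powe (1 / p'))"
  proof (rule sum.cong)
    fix j
    have "m j = m j powe (1 / p) * m j powe (1 / p')" using p by (simp flip: powe_add)
    then have "m j * (X j * Y j) = (m j powe (1 / p) * m j powe (1 / p')) * (X j * Y j)" by simp
    then show "m j * (X j * Y j) = (m j * X j powe p) powe (1 / p) * (m j * Y j powe p') powe (1 / p')"
      using p by (simp add: powe_mult powe_powe mult_ac)
  qed simp
  also have "\<dots> = (\<integral>\<^sup>+j. (m j * X j powe p) powe (1 / p) * (m j * Y j powe p') powe (1 / p') \<partial>count_space J)"
    using J by (simp add: nn_integral_count_space_finite)
  also have "\<dots> \<le> (\<integral>\<^sup>+j. m j * X j powe p \<partial>count_space J) powe (1 / p) * (\<integral>\<^sup>+j. m j * Y j powe p' \<partial>count_space J) powe (1 / p')"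
    using p by (intro holder_nn_integral) auto
  finally show ?thesis using J by (simp add: nn_integral_count_space_finite)
qed

context doubling_measure
begin

text \<open>With \<open>B\<close> self-adjoint and inverse to \<open>A\<close> one has \<open>f \<sqdot> v = A f \<sqdot> B v\<close>, so one coordinate of \<open>f\<close> is
  bounded by the scalar weight \<open>|B v|\<close> times \<open>|A f|\<close>.\<close>

lemma component_estimate:
  fixes z :: "'i \<Rightarrow> 'a" and v :: "'i \<Rightarrow> complex ^ 'n"
  assumes par: "0 < r" "0 < a" "0 < p" "1 / r = 1 / a + 1 / p" and q: "1 \<le> q" and L: "1 \<le> L"
    and balls: "sparse_balls J z R E F"
    and [measurable]: "A \<in> borel_measurable \<mu>" "B \<in> borel_measurable \<mu>" "f \<in> borel_measurable \<mu>"
    and BA: "\<And>x. B x ** A x = mat 1" and adj: "\<And>x. adjoint_matrix (B x) = B x"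
    and mh: "\<And>j. j \<in> J \<Longrightarrow> muckenhoupt q L (\<lambda>x. ennreal (norm (B x *v v j)) powe a)"
    and av: "\<And>j. j \<in> J \<Longrightarrow> average \<mu> (ball (z j) (16 * R j)) (\<lambda>x. ennreal (norm (B x *v v j)) powe a) \<le> 1"
  shows "(\<Sum>j\<in>J. emeasure \<mu> (F j) * (average \<mu> (E j) (\<lambda>x. ennreal (norm (cdot (f x) (v j))) powe r) powe (1 / r)) powe p)
      \<le> ennreal (maximal_constant a p q * L) * (\<integral>\<^sup>+x. ennreal (norm (A x *v f x)) powe p \<partial>\<mu>)"
proof -
  have pt: "ennreal (norm (cdot (f x) (v j))) \<le> (ennreal (norm (B x *v v j)) powe a) powe (1 / a) * ennreal (norm (A x *v f x))" for x j
  proof -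
    have "f x = B x *v (A x *v f x)" using BA by (simp add: matrix_vector_mul_assoc)
    then have "cdot (f x) (v j) = cdot (B x *v (A x *v f x)) (v j)" by simp
    also have "\<dots> = cdot (A x *v f x) (B x *v v j)"
      unfolding cdot_matrix_adjoint using adj by simp
    finally have "norm (cdot (f x) (v j)) \<le> norm (B x *v v j) * norm (A x *v f x)"
      using cdot_cauchy_schwarz[of "A x *v f x" "B x *v v j"] by (simp add: mult.commute)
    then show ?thesis
      using par by (simp add: powe_powe ennreal_leI flip: ennreal_mult)
  qed
  have root: "(X powe (1 / r)) powe p = X powe (p / r)" for X by (simp add: powe_powe)
  have "(\<Sum>j\<in>J. emeasure \<mu> (F j) * (average \<mu> (E j) (\<lambda>x. ennreal (norm (cdot (f x) (v j))) powe r) powe (1 / r)) powe p)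
    \<le> (\<Sum>j\<in>J. emeasure \<mu> (F j) * average \<mu> (E j) (\<lambda>x. ((ennreal (norm (B x *v v j)) powe a) powe (1 / a)
      * ennreal (norm (A x *v f x))) powe r) powe (p / r))"
    unfolding root using par by (intro sum_mono mult_left_mono powe_mono average_mono pt) auto
  also have "\<dots> \<le> ennreal (maximal_constant a p q * L) * (\<integral>\<^sup>+x. ennreal (norm (A x *v f x)) powe p \<partial>\<mu>)"
    by (rule weighted_maximal_estimate[OF par q L balls _ mh av]) measurable
  finally show ?thesis .
qed

end

section \<open>Matrix weights with a mixed-norm bound\<close>

text \<open>The situation \<open>P = W^(1/p)\<close>, \<open>M = W^(-1/p)\<close>, with every property holding at all points and not only
  almost everywhere.\<close>

locale matrix_weight_pair = doubling_measure \<mu> Cd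
  for \<mu> :: "'a::{metric_space, second_countable_topology} measure" and Cd +
  fixes P M :: "'a \<Rightarrow> complex ^ 'n ^ 'n" and K a b :: real
  assumes P_meas [measurable]: "P \<in> borel_measurable \<mu>" and M_meas [measurable]: "M \<in> borel_measurable \<mu>"
    and PM: "P x ** M x = mat 1" and P_adj: "adjoint_matrix (P x) = P x" and M_adj: "adjoint_matrix (M x) = M x"
    and a_pos: "0 < a" and b_pos: "0 < b" and K_nonneg: "0 \<le> K"
    and mixed_bound: "0 < r \<Longrightarrow> average \<mu> (ball x r) (\<lambda>x'. average \<mu> (ball x r)
      (\<lambda>y. ennreal (spectral_norm (P x' ** M y)) powe a) powe (b / a)) \<le> ennreal K"
begin

definition kernel :: "'a \<Rightarrow> 'a \<Rightarrow> real"
  where "kernel x y = spectral_norm (P x ** M y)"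

lemma MP: "M x ** P x = mat 1"
  using PM[of x] by (simp add: matrix_left_right_inverse)

lemma kernel_measurable: "case_prod kernel \<in> borel_measurable (\<mu> \<Otimes>\<^sub>M \<mu>)"
  unfolding kernel_def case_prod_beta by measurable

lemma kernel_nonneg: "0 \<le> kernel x y"
  by (simp add: kernel_def spectral_norm_nonneg)

lemma kernel_mixed:
  "0 < r \<Longrightarrow> average \<mu> (ball x r) (\<lambda>x'. average \<mu> (ball x r) (\<lambda>y. ennreal (kernel x' y) powe a) powe (b / a)) \<le> ennreal K"
  using mixed_bound by (simp add: kernel_def)

lemmas kernel_facts = kernel_measurable kernel_nonneg a_pos b_pos K_nonneg kernel_mixed

lemma norm_P_le: "norm (P x *v e) \<le> kernel x y * norm (P y *v e)"
proof -
  have "P x *v e = (P x ** M y) *v (P y *v e)"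
    by (simp add: matrix_vector_mul_assoc matrix_mul_assoc[symmetric] MP)
  then show ?thesis unfolding kernel_def using norm_matrix_vector_le[of "P x ** M y" "P y *v e"] by simp
qed

lemma norm_MP_le: "norm (M y *v (P x *v v)) \<le> kernel x y * norm v"
proof -
  have "adjoint_matrix (P x ** M y) = M y ** P x" by (simp add: adjoint_matrix_mult P_adj M_adj)
  then have "spectral_norm (M y ** P x) = kernel x y"
    unfolding kernel_def by (metis spectral_norm_adjoint)
  then show ?thesis using norm_matrix_vector_le[of "M y ** P x" v] by (simp add: matrix_vector_mul_assoc)
qed

lemma norm_M_le: "norm (M y *v \<xi>) \<le> kernel x y * norm (M x *v \<xi>)"
  using norm_MP_le[of y x "M x *v \<xi>"] by (simp add: matrix_vector_mul_assoc PM)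

lemma muckenhoupt_P: "muckenhoupt (1 + b / a) K (\<lambda>x. ennreal (norm (P x *v e)) powe b)"
  by (rule muckenhoupt_left[OF kernel_facts]) (auto intro: norm_P_le)

lemma muckenhoupt_M: "muckenhoupt (1 + a / b) (K powr (a / b)) (\<lambda>x. ennreal (norm (M x *v \<xi>)) powe a)"
  by (rule muckenhoupt_right[OF kernel_facts]) (auto intro: norm_M_le)

lemma P_nonzero: "v \<noteq> 0 \<Longrightarrow> P x *v v \<noteq> 0"
  by (metis MP matrix_vector_mul_assoc matrix_vector_mul_lid matrix_vector_mult_0_right)

lemma K_ge_1: "1 \<le> K"
proof (rule constant_ge_1[OF kernel_facts])
  show "0 < norm (P x *v axis undefined 1)" for x
    using P_nonzero[of "axis undefined 1" x] by (simp add: axis_eq_0_iff)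
qed (auto intro: norm_P_le)

text \<open>An almost Auerbach basis for \<open>N(v) = (avg |M v|^a)^(1/a)\<close> and its dual basis. By construction
  \<open>|w \<sqdot> e\<^sub>i| \<le> 2 N(w)\<close>. For \<open>u = P(y) e\<^sub>i\<close> and \<open>w = P(y) u\<close> this reads
  \<open>|u|^2 \<le> 2 N(P(y) u) \<le> 2 |u| (avg\<^sub>x |M(x) P(y)|^a)^(1/a)\<close>; dividing by \<open>|u|\<close> and averaging the
  \<open>b\<close>-th power over \<open>y\<close> gives the mixed norm.\<close>

lemma dual_vectors:
  assumes R: "0 < R"
  shows "\<exists>\<xi> e :: 'n \<Rightarrow> complex ^ 'n. (\<forall>i. average \<mu> (ball z R) (\<lambda>x. ennreal (norm (M x *v \<xi> i)) powe a) \<le> 1) \<and>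
    (\<forall>w. w = (\<Sum>i\<in>UNIV. cdot w (e i) *s \<xi> i)) \<and>
    (\<forall>i. average \<mu> (ball z R) (\<lambda>x. ennreal (norm (P x *v e i)) powe b) \<le> ennreal (2 powr b * K))"
proof -
  let ?B = "ball z R"
  have B: "0 < emeasure \<mu> ?B" "emeasure \<mu> ?B < \<top>" using R ball_pos ball_finite by auto
  define S where "S v = average \<mu> ?B (\<lambda>x. ennreal (norm (M x *v v)) powe a)" for v
  define N where "N v = enn2real (S v powe (1 / a))" for v
  have S_fin: "S v < \<top>" for v
  proof -
    have "(\<integral>\<^sup>+x\<in>?B. ennreal (norm (M x *v v)) powe a \<partial>\<mu>) < \<top>"
      using muckenhoupt_M[of v] by (simp add: muckenhoupt_def)
    then show ?thesis unfolding S_def average_def using B by (auto simp: ennreal_divide_eq_top_iff less_top[symmetric])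
  qed
  have N: "ennreal (N v) = S v powe (1 / a)" for v using S_fin[of v] by (simp add: N_def)
  have Nnn: "0 \<le> N v" for v by (simp add: N_def)
  have S_hom: "S (c *s v) = ennreal (norm c) powe a * S v" for c v
  proof -
    have "S (c *s v) = average \<mu> ?B (\<lambda>x. ennreal (norm c) powe a * ennreal (norm (M x *v v)) powe a)"
      unfolding S_def by (simp add: matrix_vector_smult norm_smult_vec ennreal_mult powe_mult)
    also have "\<dots> = ennreal (norm c) powe a * S v"
      unfolding S_def by (intro average_cmult) auto
    finally show ?thesis .
  qed
  have hom: "N (c *s v) = norm c * N v" for c v
  proof -
    have "ennreal (N (c *s v)) = ennreal (norm c) * ennreal (N v)"
      unfolding N S_hom using a_pos by (simp add: powe_mult powe_powe)
    then have "ennreal (N (c *s v)) = ennreal (norm c * N v)" using Nnn by (simp add: ennreal_mult)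
    then show ?thesis using Nnn by (subst (asm) ennreal_inj) auto
  qed
  \<comment> \<open>The lower bound for \<open>N\<close> that an Auerbach basis requires: \<open>|v| \<le> |P(x)| |M(x) v|\<close>, so \<open>N(v)^a\<close> is at least
    \<open>|v|^a\<close> times the average of \<open>|P|^(-a)\<close>, which is positive.\<close>
  define \<theta> where "\<theta> = average \<mu> ?B (\<lambda>x. ennreal (spectral_norm (P x) powr (- a)))"
  have sp_pos: "0 < spectral_norm (P x)" for x
  proof (rule ccontr)
    assume "\<not> 0 < spectral_norm (P x)"
    then have "spectral_norm (P x) = 0" using spectral_norm_nonneg[of "P x"] by simp
    then have "P x *v axis undefined 1 = 0" using norm_matrix_vector_le[of "P x" "axis undefined 1"] by simp
    then show False using P_nonzero[of "axis undefined 1" x] by (simp add: axis_eq_0_iff)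
  qed
  have "\<theta> \<noteq> 0"
  proof
    assume "\<theta> = 0"
    then have "(\<integral>\<^sup>+x\<in>?B. ennreal (spectral_norm (P x) powr (- a)) \<partial>\<mu>) = 0"
      using B by (simp add: \<theta>_def average_def ennreal_divide_eq_0_iff)
    then have "AE x in \<mu>. ennreal (spectral_norm (P x) powr (- a)) * indicator ?B x = 0"
      by (subst (asm) nn_integral_0_iff_AE) auto
    moreover have "ennreal (spectral_norm (P x) powr (- a)) \<noteq> 0" for x using sp_pos[of x] by simp
    ultimately have "AE x in \<mu>. x \<notin> ?B"
      by (auto simp: indicator_def elim!: eventually_mono split: if_splits)
    then have "emeasure \<mu> ?B = 0" by (subst (asm) AE_iff_measurable[OF _ refl]) (auto simp: ball_def)
    then show False using B by simp
  qed
  then obtain t where t: "0 < t" "ennreal t \<le> \<theta>"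
    by (cases \<theta>) (auto intro: that[of 1] simp: less_le)
  have low: "t powr (1 / a) * norm v \<le> N v" for v
  proof -
    have pt: "ennreal (norm v) powe a * ennreal (spectral_norm (P x) powr (- a)) \<le> ennreal (norm (M x *v v)) powe a" for x
    proof -
      have "norm v = norm (P x *v (M x *v v))" by (simp add: matrix_vector_mul_assoc PM)
      also have "\<dots> \<le> spectral_norm (P x) * norm (M x *v v)" by (rule norm_matrix_vector_le)
      finally have "norm v powr a \<le> (spectral_norm (P x) * norm (M x *v v)) powr a"
        using a_pos by (intro powr_mono2) auto
      also have "\<dots> = spectral_norm (P x) powr a * norm (M x *v v) powr a"
        using sp_pos[of x] by (simp add: powr_mult)
      finally have "norm v powr a * spectral_norm (P x) powr (- a) \<le> norm (M x *v v) powr a"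
        using sp_pos[of x] by (simp add: powr_minus field_simps)
      then show ?thesis by (simp add: ennreal_powr_ennreal ennreal_leI flip: ennreal_mult)
    qed
    have "ennreal (norm v) powe a * ennreal t \<le> ennreal (norm v) powe a * \<theta>"
      by (intro mult_left_mono t) simp
    also have "\<dots> = average \<mu> ?B (\<lambda>x. ennreal (norm v) powe a * ennreal (spectral_norm (P x) powr (- a)))"
      unfolding \<theta>_def by (intro average_cmult[symmetric]) auto
    also have "\<dots> \<le> S v" unfolding S_def by (intro average_mono pt)
    finally have "(ennreal (norm v) powe a * ennreal t) powe (1 / a) \<le> S v powe (1 / a)"
      using a_pos by (intro powe_mono) auto
    then have "ennreal (norm v) * ennreal (t powr (1 / a)) \<le> ennreal (N v)"
      unfolding N using a_pos t by (simp add: powe_mult powe_powe ennreal_powr_ennreal powr_powr)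
    then show ?thesis using Nnn by (simp add: mult.commute flip: ennreal_mult)
  qed
  obtain \<xi> e :: "'n \<Rightarrow> complex ^ 'n" where \<xi>: "\<And>i. N (\<xi> i) \<le> 1" and rep: "\<And>w. w = (\<Sum>i\<in>UNIV. cdot w (e i) *s \<xi> i)"
    and e: "\<And>w i. norm (cdot w (e i)) \<le> 2 * N w"
    using auerbach_basis[of N "t powr (1 / a)", OF hom low] t by auto
  have "S (\<xi> i) \<le> 1" for i
  proof -
    have "S (\<xi> i) powe (1 / a) \<le> 1 powe (1 / a)" unfolding N[symmetric] using \<xi>[of i] by simp
    then show ?thesis using a_pos by (simp add: powe_le_one_iff)
  qed
  moreover have "average \<mu> ?B (\<lambda>y. ennreal (norm (P y *v e i)) powe b) \<le> ennreal (2 powr b * K)" for i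
  proof -
    define \<kappa> where "\<kappa> y = average \<mu> ?B (\<lambda>x. ennreal (kernel y x) powe a)" for y
    have [measurable]: "\<kappa> \<in> borel_measurable \<mu>"
      unfolding \<kappa>_def by (rule average_kernel_measurable[OF kernel_facts])
    have pt: "ennreal (norm (P y *v e i)) \<le> 2 * \<kappa> y powe (1 / a)" for y
    proof -
      define u where "u = P y *v e i"
      have "S (P y *v u) \<le> average \<mu> ?B (\<lambda>x. ennreal (norm u) powe a * ennreal (kernel y x) powe a)"
        unfolding S_def
      proof (rule average_mono)
        fix x
        have "ennreal (norm (M x *v (P y *v u))) \<le> ennreal (norm u) * ennreal (kernel y x)"
          using norm_MP_le[of x y u] kernel_nonneg by (simp add: mult.commute ennreal_leI flip: ennreal_mult)
        then have "ennreal (norm (M x *v (P y *v u))) powe a \<le> (ennreal (norm u) * ennreal (kernel y x)) powe a"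
          using a_pos by (intro powe_mono) auto
        then show "ennreal (norm (M x *v (P y *v u))) powe a \<le> ennreal (norm u) powe a * ennreal (kernel y x) powe a"
          by (simp only: powe_mult)
      qed
      also have "\<dots> = ennreal (norm u) powe a * \<kappa> y"
        unfolding \<kappa>_def
        by (intro average_cmult measurable_powe measurable_compose[OF kernel_section[OF kernel_facts] measurable_ennreal]) simp_all
      finally have "S (P y *v u) powe (1 / a) \<le> (ennreal (norm u) powe a * \<kappa> y) powe (1 / a)"
        using a_pos by (intro powe_mono) auto
      then have NP: "ennreal (N (P y *v u)) \<le> ennreal (norm u) * \<kappa> y powe (1 / a)"
        unfolding N using a_pos by (simp add: powe_mult powe_powe)
      have "cdot (P y *v u) (e i) = cdot u u" unfolding cdot_matrix_adjoint P_adj u_def ..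
      then have "norm u * norm u \<le> 2 * N (P y *v u)"
        using e[of "P y *v u" i] by (simp add: cdot_self power2_eq_square norm_mult)
      then have "ennreal (norm u * norm u) \<le> ennreal (2 * N (P y *v u))" by (rule ennreal_leI)
      also have "\<dots> = 2 * ennreal (N (P y *v u))" using Nnn by (simp add: ennreal_mult)
      also have "\<dots> \<le> 2 * (ennreal (norm u) * \<kappa> y powe (1 / a))" by (intro mult_left_mono NP) simp
      finally have le: "ennreal (norm u) * ennreal (norm u) \<le> ennreal (norm u) * (2 * \<kappa> y powe (1 / a))"
        by (simp add: ennreal_mult mult_ac)
      show ?thesis
      proof (cases "u = 0")
        case False
        then show ?thesis using le unfolding u_def[symmetric] by (subst (asm) ennreal_mult_le_mult_iff) auto
      qed (simp add: u_def)
    qed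
    have "average \<mu> ?B (\<lambda>y. ennreal (norm (P y *v e i)) powe b) \<le> average \<mu> ?B (\<lambda>y. ennreal (2 powr b) * \<kappa> y powe (b / a))"
    proof (rule average_mono)
      fix y
      have "ennreal (norm (P y *v e i)) powe b \<le> (ennreal 2 * \<kappa> y powe (1 / a)) powe b"
        using b_pos pt[of y] by (intro powe_mono) auto
      also have "\<dots> = ennreal (2 powr b) * \<kappa> y powe (b / a)"
        unfolding powe_mult powe_powe by (subst ennreal_powr_ennreal) auto
      finally show "ennreal (norm (P y *v e i)) powe b \<le> \<dots>" .
    qed
    also have "\<dots> = ennreal (2 powr b) * average \<mu> ?B (\<lambda>y. \<kappa> y powe (b / a))"
      by (intro average_cmult) auto
    also have "\<dots> \<le> ennreal (2 powr b) * ennreal K"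
      unfolding \<kappa>_def by (intro mult_left_mono kernel_mixed R) simp
    finally show ?thesis using K_nonneg by (simp add: ennreal_mult)
  qed
  ultimately show ?thesis
    using rep unfolding S_def by (intro exI[of _ \<xi>] exI[of _ e]) auto
qed

end

context doubling_measure
begin

text \<open>The factor \<open>d\<close> counts the coordinates, the factor 2 is the loss of the almost Auerbach basis, and the
  other factors bound the two functions separately.\<close>

definition sparse_form_constant :: "nat \<Rightarrow> real \<Rightarrow> real \<Rightarrow> real \<Rightarrow> real \<Rightarrow> real"
  where "sparse_form_constant d p p' a b = real d * 2 *
    maximal_constant a p (1 + a / b) powr (1 / p) * maximal_constant b p' (1 + b / a) powr (1 / p')"

lemma sparse_form_constant_pos:
  "0 < d \<Longrightarrow> 0 < p \<Longrightarrow> 0 < p' \<Longrightarrow> 0 < a \<Longrightarrow> 0 < b \<Longrightarrow> 0 < sparse_form_constant d p p' a b"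
  unfolding sparse_form_constant_def
  using maximal_constant_pos[of a p "1 + a / b"] maximal_constant_pos[of b p' "1 + b / a"]
  by (intro mult_pos_pos) auto

text \<open>The three summands in the exponent of \<open>K\<close> come from the normalization of the vectors \<open>e\<^sub>i\<close>, from the
  weight \<open>|M \<xi>\<^sub>i|^a\<close> with constant \<open>K^(a/b)\<close> in \<open>L^p\<close>, and from the weight \<open>|P e\<^sub>i|^b\<close> with constant \<open>K\<close>
  in \<open>L^(p')\<close>.\<close>

theorem sparse_form_bound:
  fixes P M :: "'a \<Rightarrow> complex ^ 'n ^ 'n" and z :: "'i \<Rightarrow> 'a"
  assumes par: "1 \<le> r1" "1 \<le> r2" "0 < p" "0 < p'" "0 < a" "0 < b"
      "1 / r1 = 1 / a + 1 / p" "1 / r2 = 1 / b + 1 / p'" "1 / p + 1 / p' = 1"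
    and pair: "matrix_weight_pair \<mu> Cd P M K a b" and balls: "sparse_balls J z R E F"
    and f [measurable]: "f \<in> borel_measurable \<mu>" and g [measurable]: "g \<in> borel_measurable \<mu>"
  shows "(\<Sum>j\<in>J. emeasure \<mu> (F j) * set_abs (cdot_set (convex_body_average \<mu> r1 (E j) f) (convex_body_average \<mu> r2 (E j) g)))
      \<le> ennreal (sparse_form_constant CARD('n) p p' a b * K powr (1 / b + a / (b * p) + 1 / p')) *
        ((\<integral>\<^sup>+x. ennreal (norm (P x *v f x)) powe p \<partial>\<mu>) powe (1 / p) *
         (\<integral>\<^sup>+x. ennreal (norm (M x *v g x)) powe p' \<partial>\<mu>) powe (1 / p'))"
proof -
  have q: "1 \<le> 1 + a / b" "1 \<le> 1 + b / a" using par by auto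
  have r0: "0 < r1" "0 < r2" using par by auto
  define C1 where "C1 = maximal_constant a p (1 + a / b)"
  define C2 where "C2 = maximal_constant b p' (1 + b / a)"
  have C1: "0 < C1" and C2: "0 < C2" using par by (auto simp: C1_def C2_def intro!: maximal_constant_pos)
  define C where "C = real CARD('n) * 2 * C1 powr (1 / p) * C2 powr (1 / p')"
  have C_eq: "sparse_form_constant CARD('n) p p' a b = C"
    by (simp add: sparse_form_constant_def C_def C1_def C2_def)
  interpret matrix_weight_pair \<mu> Cd P M K a b by (rule pair)
  have J: "finite J"
    and all: "\<forall>j\<in>J. 0 < R j \<and> E j \<in> sets \<mu> \<and> E j \<subseteq> ball (z j) (R j) \<and>
      emeasure \<mu> (ball (z j) (R j)) \<le> ennreal (Cd ^ 2) * emeasure \<mu> (E j) \<and>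
      F j \<in> sets \<mu> \<and> F j \<subseteq> ball (z j) (R j)"
    using balls by (auto simp: sparse_balls_def)
  have "\<forall>j\<in>J. \<exists>\<xi>e :: ('n \<Rightarrow> complex ^ 'n) \<times> ('n \<Rightarrow> complex ^ 'n).
    (\<forall>i. average \<mu> (ball (z j) (16 * R j)) (\<lambda>x. ennreal (norm (M x *v fst \<xi>e i)) powe a) \<le> 1) \<and>
    (\<forall>w. w = (\<Sum>i\<in>UNIV. cdot w (snd \<xi>e i) *s fst \<xi>e i)) \<and>
    (\<forall>i. average \<mu> (ball (z j) (16 * R j)) (\<lambda>x. ennreal (norm (P x *v snd \<xi>e i)) powe b) \<le> ennreal (2 powr b * K))"
    using dual_vectors[of "16 * R _" "z _"] all by (auto simp: split_paired_Ex)
  from bchoice[OF this] obtain h :: "'i \<Rightarrow> ('n \<Rightarrow> complex ^ 'n) \<times> ('n \<Rightarrow> complex ^ 'n)" where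
    h: "\<forall>j\<in>J. (\<forall>i. average \<mu> (ball (z j) (16 * R j)) (\<lambda>x. ennreal (norm (M x *v fst (h j) i)) powe a) \<le> 1) \<and>
    (\<forall>w. w = (\<Sum>i\<in>UNIV. cdot w (snd (h j) i) *s fst (h j) i)) \<and>
    (\<forall>i. average \<mu> (ball (z j) (16 * R j)) (\<lambda>x. ennreal (norm (P x *v snd (h j) i)) powe b) \<le> ennreal (2 powr b * K))" ..
  define \<xi> where "\<xi> j = fst (h j)" for j
  define e where "e j = snd (h j)" for j
  define c where "c = 2 * K powr (1 / b)"
  have c: "0 < c" using K_ge_1 by (simp add: c_def)
  have cb: "c powr b = 2 powr b * K" using K_ge_1 b_pos by (simp add: c_def powr_mult powr_powr)
  define e' where "e' j i = (1 / c) *\<^sub>R e j i" for j i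
  define X where "X i j = average \<mu> (E j) (\<lambda>x. ennreal (norm (cdot (f x) (\<xi> j i))) powe r1) powe (1 / r1)" for i j
  define Y where "Y i j = average \<mu> (E j) (\<lambda>x. ennreal (norm (cdot (g x) (e' j i))) powe r2) powe (1 / r2)" for i j
  define If where "If = (\<integral>\<^sup>+x. ennreal (norm (P x *v f x)) powe p \<partial>\<mu>)"
  define Ig where "Ig = (\<integral>\<^sup>+x. ennreal (norm (M x *v g x)) powe p' \<partial>\<mu>)"
  have E: "E j \<in> sets \<mu>" "0 < emeasure \<mu> (E j)" "emeasure \<mu> (E j) < \<top>" if "j \<in> J" for j
  proof -
    have *: "0 < R j" "E j \<subseteq> ball (z j) (R j)" "emeasure \<mu> (ball (z j) (R j)) \<le> ennreal (Cd ^ 2) * emeasure \<mu> (E j)"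
      using all that by auto
    show "E j \<in> sets \<mu>" using all that by auto
    show "emeasure \<mu> (E j) < \<top>" by (rule subset_ball_finite[OF *(2)])
    have "0 < ennreal (Cd ^ 2) * emeasure \<mu> (E j)" using ball_pos[OF *(1)] *(3) by (rule less_le_trans)
    then show "0 < emeasure \<mu> (E j)" by (auto simp: zero_less_iff_neq_zero)
  qed
  have X_sum: "(\<Sum>j\<in>J. emeasure \<mu> (F j) * X i j powe p) \<le> ennreal (C1 * K powr (a / b)) * If" for i
  proof -
    have K1: "1 \<le> K powr (a / b)" using K_ge_1 par by (intro ge_one_powr_ge_zero) auto
    have av: "average \<mu> (ball (z j) (16 * R j)) (\<lambda>x. ennreal (norm (M x *v \<xi> j i)) powe a) \<le> 1" if "j \<in> J" for j
      using h that by (simp add: \<xi>_def)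
    show ?thesis
      unfolding X_def If_def unfolding C1_def
        by (rule component_estimate[OF r0(1) par(5) par(3) par(7) q(1) K1 balls P_meas M_meas f MP M_adj muckenhoupt_M av])
  qed
  have Y_sum: "(\<Sum>j\<in>J. emeasure \<mu> (F j) * Y i j powe p') \<le> ennreal (C2 * K) * Ig" for i
  proof -
    have av: "average \<mu> (ball (z j) (16 * R j)) (\<lambda>x. ennreal (norm (P x *v e' j i)) powe b) \<le> 1" if j: "j \<in> J" for j
    proof -
      have n: "norm (P x *v e' j i) = 1 / c * norm (P x *v e j i)" for x
      proof -
        have "P x *v e' j i = (1 / c) *\<^sub>R (P x *v e j i)"
          by (simp add: e'_def matrix_vector_mult_def vec_eq_iff scaleR_sum_right)
        then show ?thesis using c by simp
      qed
      have "average \<mu> (ball (z j) (16 * R j)) (\<lambda>x. ennreal (norm (P x *v e' j i)) powe b)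
        = average \<mu> (ball (z j) (16 * R j)) (\<lambda>x. ennreal (1 / c) powe b * ennreal (norm (P x *v e j i)) powe b)"
        unfolding n using c by (subst ennreal_mult) (auto simp: powe_mult)
      also have "\<dots> = ennreal (1 / c) powe b * average \<mu> (ball (z j) (16 * R j)) (\<lambda>x. ennreal (norm (P x *v e j i)) powe b)"
        by (intro average_cmult) auto
      also have "\<dots> \<le> ennreal (1 / c) powe b * ennreal (2 powr b * K)"
        using h j by (intro mult_left_mono) (auto simp: e_def)
      also have "ennreal (1 / c) powe b = ennreal ((1 / c) powr b)"
        using c by (intro ennreal_powr_ennreal) simp
      also have "ennreal ((1 / c) powr b) * ennreal (2 powr b * K) = ennreal ((1 / c) powr b * c powr b)"
        unfolding cb using K_nonneg by (intro ennreal_mult[symmetric]) auto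
      also have "(1 / c) powr b * c powr b = 1"
        using c by (simp add: powr_divide)
      finally show ?thesis by simp
    qed
    show ?thesis
      unfolding Y_def Ig_def unfolding C2_def
        by (rule component_estimate[OF r0(2) par(6) par(4) par(8) q(2) K_ge_1 balls M_meas P_meas g PM P_adj muckenhoupt_P av])
  qed
  have term_le: "set_abs (cdot_set (convex_body_average \<mu> r1 (E j) f) (convex_body_average \<mu> r2 (E j) g))
    \<le> (\<Sum>i\<in>UNIV. ennreal c * (X i j * Y i j))" if j: "j \<in> J" for j
  proof -
    have rep: "w = (\<Sum>i\<in>UNIV. cdot w (e j i) *s \<xi> j i)" for w using h j by (auto simp: e_def \<xi>_def)
    have Yc: "average \<mu> (E j) (\<lambda>x. ennreal (norm (cdot (g x) (e j i))) powe r2) powe (1 / r2) = ennreal c * Y i j" for i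
    proof -
      have n: "ennreal (norm (cdot (g x) (e j i))) = ennreal c * ennreal (norm (cdot (g x) (e' j i)))" for x
        using c by (simp add: e'_def cdot_scaleR_right flip: ennreal_mult)
      have "average \<mu> (E j) (\<lambda>x. ennreal (norm (cdot (g x) (e j i))) powe r2)
        = ennreal c powe r2 * average \<mu> (E j) (\<lambda>x. ennreal (norm (cdot (g x) (e' j i))) powe r2)"
        unfolding n powe_mult using E(1)[OF j] by (intro average_cmult) auto
      then show ?thesis using r0 by (simp add: Y_def powe_mult powe_powe)
    qed
    have "set_abs (cdot_set (convex_body_average \<mu> r1 (E j) f) (convex_body_average \<mu> r2 (E j) g))
      \<le> (\<Sum>i\<in>UNIV. X i j * (ennreal c * Y i j))"
      unfolding X_def Yc[symmetric] by (intro set_abs_cdot_set_le E j par f g rep)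
    then show ?thesis by (simp only: mult.left_commute)
  qed
  have "(\<Sum>j\<in>J. emeasure \<mu> (F j) * set_abs (cdot_set (convex_body_average \<mu> r1 (E j) f) (convex_body_average \<mu> r2 (E j) g)))
    \<le> (\<Sum>j\<in>J. emeasure \<mu> (F j) * (\<Sum>i\<in>UNIV. ennreal c * (X i j * Y i j)))"
    by (intro sum_mono mult_left_mono term_le) auto
  also have "\<dots> = (\<Sum>i\<in>UNIV. ennreal c * (\<Sum>j\<in>J. emeasure \<mu> (F j) * (X i j * Y i j)))"
    by (simp only: sum_distrib_left mult.left_commute) (rule sum.swap)
  also have "\<dots> \<le> (\<Sum>i\<in>(UNIV :: 'n set). ennreal c * ((ennreal (C1 * K powr (a / b)) * If) powe (1 / p) * (ennreal (C2 * K) * Ig) powe (1 / p')))"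
  proof (intro sum_mono mult_left_mono)
    fix i
    have "(\<Sum>j\<in>J. emeasure \<mu> (F j) * (X i j * Y i j))
      \<le> (\<Sum>j\<in>J. emeasure \<mu> (F j) * X i j powe p) powe (1 / p) * (\<Sum>j\<in>J. emeasure \<mu> (F j) * Y i j powe p') powe (1 / p')"
      by (rule holder_sum_ennreal[OF J par(3,4,9)])
    also have "\<dots> \<le> (ennreal (C1 * K powr (a / b)) * If) powe (1 / p) * (ennreal (C2 * K) * Ig) powe (1 / p')"
      using par by (intro mult_mono powe_mono X_sum Y_sum) auto
    finally show "(\<Sum>j\<in>J. emeasure \<mu> (F j) * (X i j * Y i j)) \<le> \<dots>" .
  qed simp
  also have "\<dots> = ennreal (real CARD('n)) * (ennreal c * ((ennreal (C1 * K powr (a / b)) * If) powe (1 / p) * (ennreal (C2 * K) * Ig) powe (1 / p')))"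
    by (simp add: ennreal_of_nat_eq_real_of_nat)
  also have "\<dots> = ennreal (real CARD('n)) * (ennreal c * (ennreal ((C1 * K powr (a / b)) powr (1 / p)) * ennreal ((C2 * K) powr (1 / p')))) * (If powe (1 / p) * Ig powe (1 / p'))"
  proof -
    have "ennreal (C1 * K powr (a / b)) powe (1 / p) = ennreal ((C1 * K powr (a / b)) powr (1 / p))"
      using C1 by (intro ennreal_powr_ennreal) simp
    moreover have "ennreal (C2 * K) powe (1 / p') = ennreal ((C2 * K) powr (1 / p'))"
      using C2 K_nonneg by (intro ennreal_powr_ennreal) simp
    ultimately show ?thesis by (simp only: powe_mult mult_ac)
  qed
  also have "ennreal (real CARD('n)) * (ennreal c * (ennreal ((C1 * K powr (a / b)) powr (1 / p)) * ennreal ((C2 * K) powr (1 / p'))))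
    = ennreal (C * K powr (1 / b + a / (b * p) + 1 / p'))"
  proof -
    have "real CARD('n) * (c * ((C1 * K powr (a / b)) powr (1 / p) * (C2 * K) powr (1 / p'))) = C * K powr (1 / b + a / (b * p) + 1 / p')"
      using C1 C2 K_ge_1 by (simp add: C_def c_def powr_mult powr_powr powr_add mult_ac)
    then show ?thesis using c by (simp flip: ennreal_mult)
  qed
  finally show ?thesis unfolding If_def Ig_def C_eq .
qed

end

section \<open>The estimate for dyadic cubes\<close>

lemma average_cong_AE: "(AE x in M. f x = g x) \<Longrightarrow> average M E f = average M E g"
  unfolding average_def
  by (intro arg_cong2[where f = "(/)"] nn_integral_cong_AE refl) (auto elim!: eventually_mono)

lemma holder_conj_real_ereal: "1 < x \<Longrightarrow> holder_conj_real (ereal x) = 1 / (1 - 1 / x)"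
  by (simp add: holder_conj_real_def holder_conj_def one_ereal_def inverse_eq_divide)

lemma exponent_relations:
  fixes p0 p p' q0' t s' a a' b \<alpha> :: real and q0 s :: ereal
  assumes "1 \<le> p0" and "ereal p0 < q0" and "p0 < p" and "ereal p < q0"
    and "p' = holder_conj_real (ereal p)" and "q0' = holder_conj_real q0"
    and "t = p / p0" and "s = q0 / ereal p" and "s' = holder_conj_real s"
    and "a = p / (t - 1)" and "a' = holder_conj_real (ereal a)" and "b = s' * p"
    and "\<alpha> = 1 / (s' * (p - p0)) + 1 / p'"
  shows "1 \<le> q0'" "0 < p'" "0 < a" "0 < b" "0 < s'" "1 / p0 = 1 / a + 1 / p" "1 / q0' = 1 / b + 1 / p'" "1 / p + 1 / p' = 1"
    "holder_conj_real (ereal a') = a" "\<alpha> = 1 / b + a / (b * p) + 1 / p'"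
proof -
  have p: "1 < p" using assms by simp
  have p': "p' = 1 / (1 - 1 / p)" using p by (simp add: assms holder_conj_real_ereal)
  \<comment> \<open>With \<open>u = 1/q\<^sub>0\<close>, read as 0 for \<open>q\<^sub>0 = \<infinity>\<close>, finite and infinite \<open>q\<^sub>0\<close> are treated together.\<close>
  obtain u where u: "0 \<le> u" "u < 1 / p" "q0' = 1 / (1 - u)" "s' = 1 / (1 - p * u)"
  proof (cases q0)
    case (real Q)
    then have Q: "p < Q" using assms by simp
    have "s = ereal (Q / p)" using p by (simp add: assms(8) real)
    moreover have "1 < Q / p" using Q p by simp
    ultimately have "s' = 1 / (1 - p * (1 / Q))" by (simp add: assms(9) holder_conj_real_ereal)
    moreover have "q0' = 1 / (1 - 1 / Q)" using Q p by (simp add: assms(6) real holder_conj_real_ereal)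
    moreover have "0 \<le> 1 / Q" "1 / Q < 1 / p" using Q p by (auto simp: field_simps)
    ultimately show ?thesis using that[of "1 / Q"] by blast
  next
    case PInf
    then have "s = \<infinity>" using p by (simp add: assms(8))
    then have "s' = 1" by (simp add: assms(9) holder_conj_real_def holder_conj_def one_ereal_def)
    moreover have "q0' = 1" by (simp add: assms(6) PInf holder_conj_real_def holder_conj_def one_ereal_def)
    ultimately show ?thesis using p by (intro that[of 0]) auto
  next
    case MInf
    then show ?thesis using assms by simp
  qed
  have pu: "p * u < 1" using u(2) p by (simp add: field_simps)
  have u1: "u < 1"
  proof -
    have "1 / p < 1" using p by simp
    then show ?thesis using u(2) by linarith
  qed
  show "1 \<le> q0'" using u(1) u1 by (simp add: u(3))
  show "0 < p'" using p by (simp add: p')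
  show s': "0 < s'" using pu by (simp add: u(4))
  show b: "0 < b" using s' p by (simp add: assms)
  show pp: "1 / p + 1 / p' = 1" using p by (simp add: p')
  have a_eq: "a = p * p0 / (p - p0)" using assms(1,3) by (simp add: assms(7,10) field_simps)
  show a: "0 < a" using assms(1,3) by (simp add: a_eq)
  show inv_a: "1 / p0 = 1 / a + 1 / p" using assms(1,3) by (simp add: a_eq field_simps)
  have "1 / b = 1 / p - u" using pu p by (simp add: assms(12) u(4) field_simps)
  moreover have "1 / q0' = 1 - u" using u by simp
  ultimately show "1 / q0' = 1 / b + 1 / p'" using pp by linarith
  have "1 / p0 \<le> 1" "0 < 1 / p" using assms(1) p by auto
  then have "1 / a < 1" using inv_a by linarith
  then have a1: "1 < a" using a by (simp add: field_simps)
  have a': "a' = 1 / (1 - 1 / a)" by (simp add: assms(11) holder_conj_real_ereal[OF a1])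
  have "1 < a'" using a1 by (simp add: a' field_simps)
  then show "holder_conj_real (ereal a') = a" using a1 by (simp add: holder_conj_real_ereal) (simp add: a')
  have "1 / (s' * (p - p0)) = 1 / b + a / (b * p)"
    using s' p assms(1,3) by (simp add: assms(12) a_eq field_simps)
  then show "\<alpha> = 1 / b + a / (b * p) + 1 / p'" by (simp add: assms(13))
qed

lemma pos_def_mat_1: "pos_def (mat 1 :: complex ^ 'n ^ 'n)"
proof -
  have "adjoint_matrix (mat 1) = (mat 1 :: complex ^ 'n ^ 'n)"
    by (auto simp: adjoint_matrix_def mat_def vec_eq_iff)
  moreover have "0 < Re (cdot (mat 1 *v v) v)" if "v \<noteq> 0" for v :: "complex ^ 'n"
    using that by (simp add: cdot_self)
  ultimately show ?thesis by (simp add: pos_def_def)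
qed

lemma weighted_norm_eq:
  assumes "AE x in \<mu>. mat_powr (W x) (1 / p) = P x"
  shows "weighted_norm \<mu> p W f = (\<integral>\<^sup>+x. ennreal (norm (P x *v f x)) powe p \<partial>\<mu>) powe (1 / p)"
proof -
  have "(\<integral>\<^sup>+x. ennreal (norm (mat_powr (W x) (1 / p) *v f x) powr p) \<partial>\<mu>) = (\<integral>\<^sup>+x. ennreal (norm (P x *v f x)) powe p \<partial>\<mu>)"
    using assms by (intro nn_integral_cong_AE) (auto simp: ennreal_powr_ennreal elim!: eventually_mono)
  then show ?thesis by (simp add: weighted_norm_def Lp_norm_def)
qed

context doubling_measure
begin

text \<open>Replacing \<open>W\<close> by the identity matrix on a null set changes none of the integrals and makes it
  positive definite everywhere.\<close>

lemma matrix_weight_pair_of_weight: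
  fixes W :: "'a \<Rightarrow> complex ^ 'n ^ 'n"
  assumes W: "matrix_weight \<mu> W" and fin: "A_const \<mu> a' b (\<lambda>x. mat_powr (W x) s') < \<infinity>"
    and par: "0 < a" "0 < b" "0 < p" "0 < s'" "b = s' * p" "holder_conj_real (ereal a') = a"
  shows "\<exists>P M. matrix_weight_pair \<mu> Cd P M (enn2real (A_const \<mu> a' b (\<lambda>x. mat_powr (W x) s'))) a b \<and>
    (AE x in \<mu>. pos_def (W x) \<and> mat_powr (W x) (1 / p) = P x \<and> mat_powr (W x) (- 1 / p) = M x)"
proof -
  have "AE x in \<mu>. pos_def (W x)" using W by (simp add: matrix_weight_def)
  then obtain N where "{x \<in> space \<mu>. \<not> pos_def (W x)} \<subseteq> N" "emeasure \<mu> N = 0" "N \<in> sets \<mu>" by (rule AE_E)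
  then have N: "{x \<in> space \<mu>. \<not> pos_def (W x)} \<subseteq> N" "N \<in> null_sets \<mu>" by (auto simp: null_sets_def)
  define W1 where "W1 x = (if x \<in> N then mat 1 else W x)" for x
  have pd: "pos_def (W1 x)" for x using N(1) pos_def_mat_1 by (auto simp: W1_def)
  have [measurable]: "W \<in> borel_measurable \<mu>" using W by (simp add: matrix_weight_def)
  have [measurable]: "W1 \<in> borel_measurable \<mu>"
    unfolding W1_def using N(2) by (intro measurable_If_set) (auto simp: null_sets_def)
  have AE: "AE x in \<mu>. W x = W1 x"
    by (rule AE_I'[OF N(2)]) (auto simp: W1_def)
  define P where "P x = mat_powr (W1 x) (1 / p)" for x
  define M where "M x = mat_powr (W1 x) (- 1 / p)" for x
  define AA where "AA = A_const \<mu> a' b (\<lambda>x. mat_powr (W x) s')"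
  have P1: "mat_powr (mat_powr (W1 x) s') (1 / b) = P x" for x
    using par by (simp add: mat_powr_mat_powr[OF pd] P_def)
  have M1: "mat_powr (mat_powr (W1 x) s') (- 1 / b) = M x" for x
    using par by (simp add: mat_powr_mat_powr[OF pd] M_def)
  have "matrix_weight_pair \<mu> Cd P M (enn2real AA) a b"
  proof
    show "P \<in> borel_measurable \<mu>" "M \<in> borel_measurable \<mu>"
      unfolding P_def M_def by (intro measurable_mat_powr pd; measurable)+
    show "P x ** M x = mat 1" for x using mat_powr_inverse[OF pd, of x "1 / p"] by (simp add: P_def M_def)
    show "adjoint_matrix (P x) = P x" "adjoint_matrix (M x) = M x" for x
      by (simp_all add: P_def M_def mat_powr_adjoint[OF pd])
    fix x :: 'a and r :: real assume r: "0 < r"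
    let ?B = "ball x r"
    have "average \<mu> ?B (\<lambda>x'. average \<mu> ?B (\<lambda>y. ennreal (spectral_norm (P x' ** M y)) powe a) powe (b / a))
      = average \<mu> ?B (\<lambda>x'. average \<mu> ?B (\<lambda>y. ennreal
            (spectral_norm (mat_powr (mat_powr (W x') s') (1 / b) ** mat_powr (mat_powr (W y) s') (- 1 / b))
               powr holder_conj_real (ereal a'))) powe (b / holder_conj_real (ereal a')))"
    proof (rule average_cong_AE)
      show "AE x' in \<mu>. average \<mu> ?B (\<lambda>y. ennreal (spectral_norm (P x' ** M y)) powe a) powe (b / a)
        = average \<mu> ?B (\<lambda>y. ennreal
            (spectral_norm (mat_powr (mat_powr (W x') s') (1 / b) ** mat_powr (mat_powr (W y) s') (- 1 / b))
               powr holder_conj_real (ereal a'))) powe (b / holder_conj_real (ereal a'))"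
        using AE
      proof eventually_elim
        case (elim x')
        have "average \<mu> ?B (\<lambda>y. ennreal (spectral_norm (P x' ** M y)) powe a)
          = average \<mu> ?B (\<lambda>y. ennreal
            (spectral_norm (mat_powr (mat_powr (W x') s') (1 / b) ** mat_powr (mat_powr (W y) s') (- 1 / b))
               powr holder_conj_real (ereal a')))"
        proof (rule average_cong_AE)
          show "AE y in \<mu>. ennreal (spectral_norm (P x' ** M y)) powe a = ennreal
            (spectral_norm (mat_powr (mat_powr (W x') s') (1 / b) ** mat_powr (mat_powr (W y) s') (- 1 / b))
               powr holder_conj_real (ereal a'))"
            using AE
          proof eventually_elim
            case (elim y)
            show ?case
              unfolding elim \<open>W x' = W1 x'\<close> P1 M1 par(6) by (rule ennreal_powr_ennreal[OF spectral_norm_nonneg])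
          qed
        qed
        then show ?case by (simp add: par(6))
      qed
    qed
    also have "\<dots> \<le> AA"
      unfolding AA_def A_const_def using r by (intro SUP_upper) auto
    also have "AA = ennreal (enn2real AA)" using fin by (simp add: AA_def)
    finally show "average \<mu> ?B (\<lambda>x'. average \<mu> ?B (\<lambda>y. ennreal (spectral_norm (P x' ** M y)) powe a) powe (b / a)) \<le> ennreal (enn2real AA)" .
  qed (use par in auto)
  moreover have "AE x in \<mu>. pos_def (W x) \<and> mat_powr (W x) (1 / p) = P x \<and> mat_powr (W x) (- 1 / p) = M x"
    using AE
  proof eventually_elim
    case (elim x)
    show ?case using pd[of x] unfolding elim P_def M_def by simp
  qed
  ultimately show ?thesis unfolding AA_def by blast
qed

text \<open>With \<open>l\<close> the side length, \<open>ball z (\<lambda> l / 2) \<subseteq> \<lambda> Q \<subseteq> ball z (2 \<lambda> l)\<close>; the first inclusion uses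
  \<open>\<lambda> \<ge> 2\<close>. The ratio of the radii is 4, so the comparability constant depends neither on \<open>\<lambda>\<close>
  nor on the parameters of the dyadic system.\<close>

lemma dilate_geometry:
  assumes D: "dyadic_system \<mu> c0 C0 \<delta> D" and lam: "2 \<le> lam" and Q: "Q \<in> dyadic_cubes D"
  shows "\<exists>z R. 0 < R \<and> dilate C0 \<delta> lam Q \<in> sets \<mu> \<and> dilate C0 \<delta> lam Q \<subseteq> ball z R \<and>
    emeasure \<mu> (ball z R) \<le> ennreal (Cd ^ 2) * emeasure \<mu> (dilate C0 \<delta> lam Q) \<and> snd Q \<subseteq> ball z R"
proof -
  obtain k S where QS: "Q = (k, S)" "S \<in> D k" using Q by (auto simp: dyadic_cubes_def)
  have pos: "0 < c0" "0 < \<delta>" "c0 \<le> C0" using D by (auto simp: dyadic_system_def)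
  have "\<exists>zc :: int \<Rightarrow> 'a set \<Rightarrow> 'a. \<forall>k. \<forall>Q\<in>D k. ball (zc k Q) (c0 / 3 * \<delta> powi k) \<subseteq> Q \<and>
      Q \<subseteq> ball (zc k Q) (2 * C0 * \<delta> powi k)"
    using D unfolding dyadic_system_def by (elim conjE exE) (rule exI, assumption)
  then obtain zc :: "int \<Rightarrow> 'a set \<Rightarrow> 'a" where zc: "\<forall>k. \<forall>Q\<in>D k. ball (zc k Q) (c0 / 3 * \<delta> powi k) \<subseteq> Q \<and>
      Q \<subseteq> ball (zc k Q) (2 * C0 * \<delta> powi k)" ..
  define z where "z = zc k S"
  have z: "ball z (c0 / 3 * \<delta> powi k) \<subseteq> S" "S \<subseteq> ball z (2 * C0 * \<delta> powi k)"
    using zc QS(2) by (auto simp: z_def)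
  define l where "l = 2 * C0 * \<delta> powi k"
  have l: "0 < l" using pos by (simp add: l_def)
  have zS: "z \<in> S" using z(1) pos by auto
  then have ne: "S \<noteq> {}" by blast
  define E where "E = dilate C0 \<delta> lam Q"
  have E: "E = {x. infdist x S \<le> (lam - 1) * l}" by (simp add: E_def dilate_def side_length_def QS l_def)
  have "closed E" unfolding E by (intro closed_Collect_le continuous_on_infdist continuous_intros)
  then have "E \<in> sets \<mu>" by simp
  moreover have "E \<subseteq> ball z (2 * lam * l)"
  proof
    fix x assume "x \<in> E"
    then have x: "infdist x S \<le> (lam - 1) * l" by (simp add: E)
    have "dist x z - l \<le> infdist x S"
      unfolding infdist_notempty[OF ne]
    proof (rule cINF_greatest[OF ne])
      fix q assume "q \<in> S"
      then have "dist z q < l" using z(2) by (auto simp: l_def)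
      then show "dist x z - l \<le> dist x q" using dist_triangle[of x z q] by (simp add: dist_commute)
    qed
    then have "dist x z \<le> lam * l" using x by (simp add: algebra_simps)
    also have "\<dots> < 2 * lam * l" using l lam by simp
    finally show "x \<in> ball z (2 * lam * l)" by (simp add: dist_commute)
  qed
  moreover have "emeasure \<mu> (ball z (2 * lam * l)) \<le> ennreal (Cd ^ 2) * emeasure \<mu> E"
  proof -
    have "emeasure \<mu> (ball z (2 ^ 2 * (lam * l / 2))) \<le> ennreal (Cd ^ 2) * emeasure \<mu> (ball z (lam * l / 2))"
      using l lam by (intro doubling_power) auto
    also have "\<dots> \<le> ennreal (Cd ^ 2) * emeasure \<mu> E"
    proof (intro mult_left_mono emeasure_mono)
      show "ball z (lam * l / 2) \<subseteq> E"
      proof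
        fix x assume "x \<in> ball z (lam * l / 2)"
        then have "infdist x S \<le> lam * l / 2" using infdist_le[OF zS, of x] by (simp add: dist_commute)
        also have "\<dots> \<le> (lam - 1) * l"
          using mult_right_mono[of "lam / 2" "lam - 1" l] lam l by simp
        finally show "x \<in> E" by (simp add: E)
      qed
    qed (use \<open>E \<in> sets \<mu>\<close> in auto)
    finally show ?thesis by (simp add: mult_ac)
  qed
  moreover have "S \<subseteq> ball z (2 * lam * l)"
  proof -
    have "l \<le> 2 * lam * l" using l lam mult_right_mono[of 1 "2 * lam" l] by simp
    then show ?thesis using z(2) subset_ball[of l "2 * lam * l" z] by (auto simp: l_def)
  qed
  moreover have "0 < 2 * lam * l" using l lam by simp
  ultimately show ?thesis unfolding E_def QS(1) by (intro exI[of _ z] exI[of _ "2 * lam * l"]) simp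
qed

end

theorem theorem1p3:
  fixes \<mu> :: "'a::{metric_space, second_countable_topology} measure"
    and p0 p p' q0' t s' a a' b \<alpha> :: real and q0 s :: ereal
  assumes "doubling_space \<mu>"
    and "1 \<le> p0" and "ereal p0 < q0" and "p0 < p" and "ereal p < q0"
    and "p' = holder_conj_real (ereal p)"
    and "q0' = holder_conj_real q0"
    and "t = p / p0"
    and "s = q0 / ereal p"
    and "s' = holder_conj_real s"
    and "a = p / (t - 1)"
    and "a' = holder_conj_real (ereal a)"
    and "b = s' * p"
    and "\<alpha> = 1 / (s' * (p - p0)) + 1 / p'"
  shows "\<exists>C>0. \<forall>c0 C0 \<delta> (D :: int \<Rightarrow> 'a set set) lam \<epsilon> S (W :: 'a \<Rightarrow> complex ^ 'n ^ 'n).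
    dyadic_system \<mu> c0 C0 \<delta> D \<longrightarrow> 2 \<le> lam \<longrightarrow> 0 < \<epsilon> \<longrightarrow> \<epsilon> < 1 \<longrightarrow>
    S \<subseteq> dyadic_cubes D \<longrightarrow> sparse_family \<mu> \<epsilon> S snd \<longrightarrow>
    matrix_weight \<mu> W \<longrightarrow> A_const \<mu> a' b (\<lambda>x. mat_powr (W x) s') < \<infinity> \<longrightarrow>
    (let W' = (\<lambda>x. mat_powr (W x) (- 1 / (p - 1))) in
     \<forall>f\<in>weighted_space \<mu> p W. \<forall>g\<in>weighted_space \<mu> p' W'.
       (\<Sum>\<^sub>\<infinity>P\<in>S. emeasure \<mu> (snd P) *
          set_abs (cdot_set (convex_body_average \<mu> p0 (dilate C0 \<delta> lam P) f)
                            (convex_body_average \<mu> q0' (dilate C0 \<delta> lam P) g)))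
       \<le> ennreal (C / \<epsilon>) * ennreal_powr (A_const \<mu> a' b (\<lambda>x. mat_powr (W x) s')) \<alpha>
           * weighted_norm \<mu> p W f * weighted_norm \<mu> p' W' g)"
proof -
  from doubling_spaceD[OF assms(1)] obtain Cd where "doubling_measure \<mu> Cd" ..
  then interpret doubling_measure \<mu> Cd .
  note ex = exponent_relations[OF assms(2-14)]
  have p: "1 < p" using assms(2,4) by simp
  have p0': "0 < p" using p by simp
  define C where "C = sparse_form_constant CARD('n) p p' a b"
  have C: "0 < C" unfolding C_def using p0' ex by (intro sparse_form_constant_pos) auto
  show ?thesis
    unfolding Let_def
  proof (intro exI[of _ C] conjI C allI impI ballI)
    fix c0 C0 \<delta> lam \<epsilon> :: real and D :: "int \<Rightarrow> 'a set set" and S and W :: "'a \<Rightarrow> complex ^ 'n ^ 'n" and f g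
    assume D: "dyadic_system \<mu> c0 C0 \<delta> D" and lam: "2 \<le> lam" and \<epsilon>: "0 < \<epsilon>" "\<epsilon> < 1"
      and S: "S \<subseteq> dyadic_cubes D" and sparse: "sparse_family \<mu> \<epsilon> S snd"
      and W: "matrix_weight \<mu> W" and fin: "A_const \<mu> a' b (\<lambda>x. mat_powr (W x) s') < \<infinity>"
      and f: "f \<in> weighted_space \<mu> p W" and g: "g \<in> weighted_space \<mu> p' (\<lambda>x. mat_powr (W x) (- 1 / (p - 1)))"
    define AA where "AA = A_const \<mu> a' b (\<lambda>x. mat_powr (W x) s')"
    define K where "K = enn2real AA"
    have AA: "AA = ennreal K" "0 \<le> K" using fin by (auto simp: K_def AA_def)
    obtain P M where pair: "matrix_weight_pair \<mu> Cd P M K a b"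
      and PM: "AE x in \<mu>. pos_def (W x) \<and> mat_powr (W x) (1 / p) = P x \<and> mat_powr (W x) (- 1 / p) = M x"
      using matrix_weight_pair_of_weight[OF W fin ex(3,4) _ ex(5) assms(13) ex(9)] p unfolding K_def AA_def by auto
    have nf: "weighted_norm \<mu> p W f = (\<integral>\<^sup>+x. ennreal (norm (P x *v f x)) powe p \<partial>\<mu>) powe (1 / p)"
      using PM by (intro weighted_norm_eq) (auto elim!: eventually_mono)
    have ng: "weighted_norm \<mu> p' (\<lambda>x. mat_powr (W x) (- 1 / (p - 1))) g
      = (\<integral>\<^sup>+x. ennreal (norm (M x *v g x)) powe p' \<partial>\<mu>) powe (1 / p')"
    proof (intro weighted_norm_eq)
      have "1 / p' = 1 - 1 / p" using ex(8) by linarith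
      also have "1 - 1 / p = (p - 1) / p" using p by (simp add: diff_divide_distrib)
      finally have e: "- 1 / (p - 1) * (1 / p') = - 1 / p" using p by simp
      show "AE x in \<mu>. mat_powr (mat_powr (W x) (- 1 / (p - 1))) (1 / p') = M x"
        using PM
      proof eventually_elim
        case (elim x)
        then show ?case using mat_powr_mat_powr[of "W x" "- 1 / (p - 1)" "1 / p'"] unfolding e by simp
      qed
    qed
    obtain F where F: "disjoint_family_on F S" "\<And>Q. Q \<in> S \<Longrightarrow> F Q \<in> sets \<mu>" "\<And>Q. Q \<in> S \<Longrightarrow> F Q \<subseteq> snd Q"
      "\<And>Q. Q \<in> S \<Longrightarrow> ennreal \<epsilon> * emeasure \<mu> (snd Q) \<le> emeasure \<mu> (F Q)"
      using sparse unfolding sparse_family_def by blast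
    define E where "E Q = dilate C0 \<delta> lam Q" for Q :: "int \<times> 'a set"
    have "\<forall>Q\<in>S. \<exists>zR. 0 < snd zR \<and> E Q \<in> sets \<mu> \<and> E Q \<subseteq> ball (fst zR) (snd zR) \<and>
      emeasure \<mu> (ball (fst zR) (snd zR)) \<le> ennreal (Cd ^ 2) * emeasure \<mu> (E Q) \<and> snd Q \<subseteq> ball (fst zR) (snd zR)"
      unfolding E_def split_paired_Ex fst_conv snd_conv using S by (intro ballI dilate_geometry[OF D lam]) blast
    from bchoice[OF this] obtain zR where zR: "\<forall>Q\<in>S. 0 < snd (zR Q) \<and> E Q \<in> sets \<mu> \<and> E Q \<subseteq> ball (fst (zR Q)) (snd (zR Q)) \<and>
      emeasure \<mu> (ball (fst (zR Q)) (snd (zR Q))) \<le> ennreal (Cd ^ 2) * emeasure \<mu> (E Q) \<and> snd Q \<subseteq> ball (fst (zR Q)) (snd (zR Q))" ..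
    define T where "T Q = set_abs (cdot_set (convex_body_average \<mu> p0 (E Q) f) (convex_body_average \<mu> q0' (E Q) g))" for Q
    let ?RHS = "ennreal (C / \<epsilon>) * ennreal_powr AA \<alpha> * weighted_norm \<mu> p W f * weighted_norm \<mu> p' (\<lambda>x. mat_powr (W x) (- 1 / (p - 1))) g"
    \<comment> \<open>A sum of non-negative terms is the supremum of its finite partial sums, so finite families of cubes
      suffice.\<close>
    have "(\<Sum>Q\<in>J. emeasure \<mu> (snd Q) * T Q) \<le> ?RHS" if J: "finite J" "J \<subseteq> S" for J
    proof -
      have "(\<Sum>Q\<in>J. emeasure \<mu> (snd Q) * T Q) \<le> (\<Sum>Q\<in>J. ennreal (1 / \<epsilon>) * (emeasure \<mu> (F Q) * T Q))"
      proof (rule sum_mono)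
        fix Q assume "Q \<in> J"
        then have "ennreal (1 / \<epsilon>) * (ennreal \<epsilon> * emeasure \<mu> (snd Q)) \<le> ennreal (1 / \<epsilon>) * emeasure \<mu> (F Q)"
          using F(4)[of Q] J(2) by (intro mult_left_mono) auto
        moreover have "ennreal (1 / \<epsilon>) * ennreal \<epsilon> = 1" using \<epsilon> by (simp flip: ennreal_mult)
        ultimately have "emeasure \<mu> (snd Q) \<le> ennreal (1 / \<epsilon>) * emeasure \<mu> (F Q)"
          by (simp flip: mult.assoc)
        then show "emeasure \<mu> (snd Q) * T Q \<le> ennreal (1 / \<epsilon>) * (emeasure \<mu> (F Q) * T Q)"
          by (simp add: mult_right_mono flip: mult.assoc)
      qed
      also have "\<dots> = ennreal (1 / \<epsilon>) * (\<Sum>Q\<in>J. emeasure \<mu> (F Q) * T Q)" by (rule sum_distrib_left[symmetric])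
      also have "\<dots> \<le> ennreal (1 / \<epsilon>) * (ennreal (C * K powr \<alpha>) * (weighted_norm \<mu> p W f * weighted_norm \<mu> p' (\<lambda>x. mat_powr (W x) (- 1 / (p - 1))) g))"
      proof (rule mult_left_mono)
        have balls: "sparse_balls J (\<lambda>Q. fst (zR Q)) (\<lambda>Q. snd (zR Q)) E F"
          unfolding sparse_balls_def
        proof (intro conjI ballI)
          show "finite J" by (rule J(1))
          show "disjoint_family_on F J" using F(1) J(2) by (rule disjoint_family_on_mono[rotated])
        qed (use zR F(2,3) J(2) in blast)+
        have fg: "f \<in> borel_measurable \<mu>" "g \<in> borel_measurable \<mu>" using f g by (auto simp: weighted_space_def)
        show "(\<Sum>Q\<in>J. emeasure \<mu> (F Q) * T Q) \<le> ennreal (C * K powr \<alpha>) *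
          (weighted_norm \<mu> p W f * weighted_norm \<mu> p' (\<lambda>x. mat_powr (W x) (- 1 / (p - 1))) g)"
          unfolding nf ng T_def C_def ex(10)
          by (rule sparse_form_bound[OF assms(2) ex(1) p0' ex(2-4) ex(6-8) pair balls fg])
      qed simp
      also have "\<dots> = ?RHS"
      proof -
        have "ennreal (C / \<epsilon>) * ennreal_powr AA \<alpha> = ennreal (1 / \<epsilon>) * ennreal (C * K powr \<alpha>)"
          unfolding AA(1) ennreal_powr_ennreal[OF AA(2)] using C \<epsilon> by (simp flip: ennreal_mult)
        then show ?thesis by (simp only: mult.assoc)
      qed
      finally show ?thesis .
    qed
    then have "(\<Sum>\<^sub>\<infinity>Q\<in>S. emeasure \<mu> (snd Q) * T Q) \<le> ?RHS"
      by (subst nonneg_infsum_complete) (auto intro!: SUP_least)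
    then show "(\<Sum>\<^sub>\<infinity>P\<in>S. emeasure \<mu> (snd P) *
          set_abs (cdot_set (convex_body_average \<mu> p0 (dilate C0 \<delta> lam P) f)
                            (convex_body_average \<mu> q0' (dilate C0 \<delta> lam P) g)))
       \<le> ennreal (C / \<epsilon>) * ennreal_powr (A_const \<mu> a' b (\<lambda>x. mat_powr (W x) s')) \<alpha>
           * weighted_norm \<mu> p W f * weighted_norm \<mu> p' (\<lambda>x. mat_powr (W x) (- 1 / (p - 1))) g"
      unfolding T_def E_def AA_def .
  qed
qed

end
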